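(* Let $1\le p<\infty$, let $\Theta$ be an inner function in the upper half-plane with $\Theta'\in L^\infty(\mathbb{R})$, let $\mu$ be a (positive) Borel measure on $\mathbb{R}$, and let $\delta>0$. Then for every $f\in K^p_\Theta$, $$ \|f\|^p_{L^p(\mu)}\le\bigl(1+\delta\,\|\Theta'\|_\infty\bigr)^p\,D_\mu(\delta)\,\|f\|_p^p . $$
   Context: $\mathbb{C}^+=\{z\in\mathbb{C}:\operatorname{Im} z>0\}$. For $1\le p<\infty$, $H^p$ is the Hardy space of $\mathbb{C}^+$ (holomorphic $f$ on $\mathbb{C}^+$ with $\sup_{y>0}\int_{\mathbb{R}}|f(x+iy)|^p\,dx<\infty$), identified through boundary values with a closed subspace of $L^p(\mathbb{R})$. An inner function $\Theta$ is a bounded analytic function on $\mathbb{C}^+$ whose boundary values have modulus one almost everywhere on $\mathbb{R}$. The model space is $K^p_\Theta=H^p\cap\Theta\,\overline{H^p}$ (as a subspace of $L^p(\mathbb{R})$). The condition $\Theta'\in L^\infty(\mathbb{R})$ means $\Theta'\in H^\infty(\mathbb{C}^+)$; it implies that $\Theta$ is a meromorphic inner function (it has a meromorphic continuation to $\mathbb{C}$), so that $\Theta=e^{i\varphi}$ on $\mathbb{R}$ with $\varphi$ increasing and real analytic, and $|\Theta'|=\varphi'$ is bounded on $\mathbb{R}$; $\|\Theta'\|_\infty=\sup_{\mathbb{R}}|\Theta'|$. In this case the elements of $K^p_\Theta$ are meromorphic in $\mathbb{C}$ and analytic across $\mathbb{R}$, and $f(x)$, $x\in\mathbb{R}$, denotes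 the value of this continuation. $\|f\|_p$ is the norm of $L^p(\mathbb{R})$ with respect to Lebesgue measure, and $\|f\|_{L^p(\mu)}^p=\int_{\mathbb{R}}|f|^p\,d\mu$. For a positive measure $\mu$ and $\delta>0$, $$D_\mu(\delta)=\sup\Bigl\{\frac{\mu(I)}{|I|}: I\subset\mathbb{R}\text{ closed interval},\ |I|=\delta\Bigr\}=\sup_{x\in\mathbb{R}}\frac{\mu([x,x+\delta])}{\delta},$$ where $|I|$ is the length of $I$ (the value $+\infty$ is allowed, with $0\cdot\infty=0$). *)

theory Defs
  imports "HOL-Complex_Analysis.Complex_Analysis"
begin

definition upper_half_plane :: "complex set"
  where "upper_half_plane = {z. Im z > 0}"

definition hardy_space :: "real \<Rightarrow> (complex \<Rightarrow> complex) set"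
  where "hardy_space p = {f. f holomorphic_on upper_half_plane \<and>
    (SUP y\<in>{0<..}. \<integral>\<^sup>+x. ennreal (norm (f (Complex x y)) powr p) \<partial>lborel) < \<infinity>}"

text \<open>Boundary values are vertical limits, required almost everywhere; by Fatou's theorem they
  exist for every function considered below and agree with the nontangential limits.\<close>

definition has_boundary_values :: "(complex \<Rightarrow> complex) \<Rightarrow> (real \<Rightarrow> complex) \<Rightarrow> bool"
  where "has_boundary_values f g \<longleftrightarrow>
    (AE x in lborel. ((\<lambda>y. f (Complex x y)) \<longlongrightarrow> g x) (at_right 0))"

definition inner_function :: "(complex \<Rightarrow> complex) \<Rightarrow> bool"
  where "inner_function \<Theta> \<longleftrightarrow>
    \<Theta> holomorphic_on upper_half_plane \<and> bounded (\<Theta> ` upper_half_plane) \<and>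
    (\<exists>\<theta>. has_boundary_values \<Theta> \<theta> \<and> (AE x in lborel. norm (\<theta> x) = 1))"

text \<open>An element of the model space is represented by its holomorphic function on the upper
  half-plane. Its membership in \<open>\<Theta>\<close> times the conjugated Hardy space is an almost everywhere
  identity between boundary values on the real line.\<close>

definition model_space :: "real \<Rightarrow> (complex \<Rightarrow> complex) \<Rightarrow> (complex \<Rightarrow> complex) set"
  where "model_space p \<Theta> = {f \<in> hardy_space p. \<exists>h\<in>hardy_space p. \<exists>f\<^sub>0 \<theta> h\<^sub>0.
    has_boundary_values f f\<^sub>0 \<and> has_boundary_values \<Theta> \<theta> \<and> has_boundary_values h h\<^sub>0 \<and>
    (AE x in lborel. f\<^sub>0 x = \<theta> x * cnj (h\<^sub>0 x))}"

definition is_continuation :: "(complex \<Rightarrow> complex) \<Rightarrow> (complex \<Rightarrow> complex) \<Rightarrow> bool"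
  where "is_continuation f g \<longleftrightarrow> g meromorphic_on UNIV \<and> g analytic_on \<real> \<and>
    (\<forall>z\<in>upper_half_plane. g z = f z)"

text \<open>If \<open>\<Theta>'\<close> is bounded, then \<open>\<Theta>\<close> and all elements of its model spaces have such a continuation.
  Two continuations of the same function agree near the real line (and in the upper
  half-plane); the choice only affects isolated values in the lower half-plane.\<close>

definition continuation :: "(complex \<Rightarrow> complex) \<Rightarrow> complex \<Rightarrow> complex"
  where "continuation f = (SOME g. is_continuation f g)"

text \<open>The condition \<open>\<Theta>' \<in> L\<^sup>\<infinity>(\<real>)\<close> is understood as \<open>\<Theta>' \<in> H\<^sup>\<infinity>\<close> of the upper half-plane.\<close>

definition bounded_deriv :: "(complex \<Rightarrow> complex) \<Rightarrow> bool"
  where "bounded_deriv \<Theta> \<longleftrightarrow> bounded (deriv \<Theta> ` upper_half_plane)"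

definition deriv_sup_norm :: "(complex \<Rightarrow> complex) \<Rightarrow> real"
  where "deriv_sup_norm \<Theta> = (SUP x::real. norm (deriv (continuation \<Theta>) (complex_of_real x)))"

definition max_density :: "real measure \<Rightarrow> real \<Rightarrow> ennreal"
  where "max_density \<mu> \<delta> = (SUP x. emeasure \<mu> {x..x+\<delta>} / ennreal \<delta>)"

text \<open>The \<open>p\<close>-th power of the norm of \<open>L\<^sup>p(\<mu>)\<close>, evaluated on the values of the continuation
  on the real line.\<close>

definition Lp_norm_pow :: "real \<Rightarrow> real measure \<Rightarrow> (complex \<Rightarrow> complex) \<Rightarrow> ennreal"
  where "Lp_norm_pow p \<mu> f =
    (\<integral>\<^sup>+x. ennreal (norm (continuation f (complex_of_real x)) powr p) \<partial>\<mu>)"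

end

theory Submission imports Defs "HOL-Probability.Sinc_Integral" begin

text \<open>
Let \<open>M\<close> be the supremum of \<open>|\<Theta>'|\<close> on the real line. The theorem combines two estimates for an element
\<open>f\<close> of the model space. First, \<open>|f(x)|\<close> is at most the mean of \<open>|f| + \<delta> |f'|\<close> over \<open>[x, x + \<delta>]\<close>; raising
this to the power \<open>p\<close> by Jensen's inequality and integrating with respect to \<open>\<mu>\<close>, Tonelli's theorem produces the
factor \<open>D\<^sub>\<mu>(\<delta>)\<close> (lemmas \<open>norm_powr_le_window\<close> and \<open>Carleson_inequality\<close>). Second, the \<open>L\<^sup>p\<close> norm of \<open>|f| + \<delta> |f'|\<close>
is at most \<open>1 + \<delta> M\<close> times that of \<open>f\<close> (lemma \<open>Bernstein_power_mean\<close>). This Bernstein inequality holds with constant \<open>M\<close>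
because \<open>2 \<pi> |f'(x)|\<close> is at most the integral of \<open>|f(t)|\<close> against the symmetric kernel
\<open>|(\<Theta>(t) - \<Theta>(x)) / (t - x)|\<^sup>2\<close>, whose integral in either variable is at most \<open>2 \<pi> M\<close>. The formula for \<open>f'\<close>
(lemma \<open>deriv_formula\<close>) comes from Cauchy's formula by adding integrals that vanish since both \<open>f\<close> and the conjugate
of \<open>f\<close> times \<open>\<Theta>\<close> belong to the Hardy space. The mass of the kernel is computed from the Poisson formula
for \<open>\<Theta>\<close> (lemma \<open>nn_integral_difference_quotient_real\<close>).

These arguments need Cauchy's formula in terms of almost everywhere boundary values. The delicate case is \<open>p = 1\<close>, because
bounded sequences in \<open>L\<^sup>1\<close> may lose mass in the limit. Dividing by \<open>(z + \<i>)\<^sup>2\<close> reduces all exponents to this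
case. For \<open>F\<close> in \<open>H\<^sup>1\<close> the function \<open>sqrt |F|\<close> is subharmonic and bounded in \<open>L\<^sup>2\<close> on horizontal lines, where no
mass is lost on sets of finite measure. It is therefore at most the Poisson integral of its boundary values
(lemma \<open>hardy1_boundary.sqrt_norm_le_poisson\<close>). Squaring gives the same for \<open>|F|\<close>, so the integrals of \<open>|F|\<close> over horizontal lines are at most that of the boundary
values, and Scheffe's lemma yields convergence in mean. Cauchy's formulas pass to the limit.

The continuations on whose real values the norms are evaluated also have to be constructed. For \<open>\<Theta>\<close> this is a reflection.
An element \<open>f\<close> with boundary values \<open>\<Theta> cnj h\<close> is continued by \<open>\<Theta>(z) cnj (h (cnj z))\<close>. That the two pieces fit
together follows from Cauchy's formula, which represents both of them by a single integral that is continuous across the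
real line (lemmas \<open>J_off_real\<close> and \<open>J_tendsto_real\<close>).
\<close>

section \<open>Cauchy formulas on the real line for functions with decay\<close>

lemma integrable_inverse_one_plus_square: "integrable lborel (\<lambda>x::real. 1 / (1 + x\<^sup>2))"
  and integral_inverse_one_plus_square: "(\<integral>x. 1 / (1 + x\<^sup>2) \<partial>lborel) = pi"
  using integrable_inverse_1_plus_square LBINT_inverse_1_plus_square
  by (simp_all add: set_integrable_def interval_lebesgue_integral_def set_lebesgue_integral_def
      inverse_eq_divide)

lemma integrable_inverse_square_bound:
  fixes g :: "real \<Rightarrow> 'a::{banach, second_countable_topology}"
  assumes "g \<in> borel_measurable borel" "\<And>t. norm (g t) \<le> C / (1 + t\<^sup>2)"
  shows "integrable lborel g"
proof (rule Bochner_Integration.integrable_bound)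
  show "integrable lborel (\<lambda>t::real. C * (1 / (1 + t\<^sup>2)))"
    by (intro integrable_mult_right integrable_inverse_one_plus_square)
  show "AE t in lborel. norm (g t) \<le> norm (C * (1 / (1 + t\<^sup>2)))"
    using assms(2) by (intro AE_I2) (metis abs_ge_self mult.right_neutral order_trans real_norm_def times_divide_eq_right)
qed (use assms in simp)

text \<open>The contour is the rectangle of height \<open>R\<close> with base \<open>[-R, R]\<close>. Its other three sides have total length \<open>4R\<close>, which
is beaten by the decay of order \<open>1 / R\<^sup>2\<close>, so that only the integral over the base survives.\<close>
lemma half_plane_contour_limit:
  fixes g :: "complex \<Rightarrow> complex"
  assumes contour: "\<And>R. R \<ge> r \<Longrightarrow> (g has_contour_integral c) (rectpath (Complex (-R) 0) (Complex R R))"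
    and bound: "\<And>z. Im z \<ge> 0 \<Longrightarrow> r \<le> norm z \<Longrightarrow> norm (g z) \<le> C / (norm z)\<^sup>2"
    and int: "integrable lborel (\<lambda>t. g (complex_of_real t))"
  shows "(\<integral>t. g (complex_of_real t) \<partial>lborel) = c"
proof -
  have est: "norm ((LINT t|lborel. indicator {-R..R} t *\<^sub>R g (complex_of_real t)) - c) \<le> 4 * C / R"
    if R: "R \<ge> r" "R > 0" for R
  proof -
    define a1 a2 a3 a4 where "a1 = Complex (-R) 0" and "a2 = Complex R 0"
      and "a3 = Complex R R" and "a4 = Complex (-R) R"
    have rp: "rectpath (Complex (-R) 0) (Complex R R)
        = linepath a1 a2 +++ linepath a2 a3 +++ linepath a3 a4 +++ linepath a4 a1"
      by (simp add: rectpath_def Let_def a1_def a2_def a3_def a4_def)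
    have ci: "(g has_contour_integral c) (linepath a1 a2 +++ linepath a2 a3 +++ linepath a3 a4 +++ linepath a4 a1)"
      using contour[OF R(1)] by (simp add: rp)
    have i: "g contour_integrable_on linepath a1 a2" "g contour_integrable_on linepath a2 a3"
       "g contour_integrable_on linepath a3 a4" "g contour_integrable_on linepath a4 a1"
      using has_contour_integral_integrable[OF ci] by auto
    have c: "c = contour_integral (linepath a1 a2) g + (contour_integral (linepath a2 a3) g
         + (contour_integral (linepath a3 a4) g + contour_integral (linepath a4 a1) g))"
      using contour_integral_unique[OF ci] i by simp
    have CR: "C / R\<^sup>2 \<ge> 0"
      using order_trans[OF norm_ge_zero bound[of "Complex R 0"]] R by (simp add: cmod_def)
    then have C0: "C \<ge> 0"
      using R by (simp add: zero_le_divide_iff)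
    have le: "norm (g z) \<le> C / R\<^sup>2" if "Im z \<ge> 0" "R \<le> norm z" for z
    proof -
      have "norm (g z) \<le> C / (norm z)\<^sup>2"
        using bound[of z] that R by auto
      also have "0 < norm z" using that R by linarith
      then have "C / (norm z)\<^sup>2 \<le> C / R\<^sup>2"
        using that R C0 by (intro divide_left_mono power_mono mult_pos_pos zero_less_power) auto
      finally show ?thesis .
    qed
    have nz: "Im z \<ge> 0 \<and> R \<le> norm z"
      if "z \<in> closed_segment a2 a3 \<union> closed_segment a3 a4 \<union> closed_segment a4 a1" for z
      using that R complex_Re_le_cmod[of z] abs_Re_le_cmod[of z] abs_Im_le_cmod[of z]
      unfolding a1_def a2_def a3_def a4_def
      by (auto simp: closed_segment_same_Re closed_segment_same_Im closed_segment_eq_real_ivl split: if_splits)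
    have b: "norm (contour_integral (linepath a2 a3) g) \<le> C / R\<^sup>2 * norm (a3 - a2)"
      "norm (contour_integral (linepath a3 a4) g) \<le> C / R\<^sup>2 * norm (a4 - a3)"
      "norm (contour_integral (linepath a4 a1) g) \<le> C / R\<^sup>2 * norm (a1 - a4)"
      using i nz le CR by (blast intro: contour_integral_bound_linepath)+
    have "norm (a3 - a2) = R" "norm (a4 - a3) = 2 * R" "norm (a1 - a4) = R"
      using R by (auto simp: a1_def a2_def a3_def a4_def cmod_def real_sqrt_mult)
    with b have b: "norm (contour_integral (linepath a2 a3) g) \<le> C / R"
      "norm (contour_integral (linepath a3 a4) g) \<le> 2 * C / R"
      "norm (contour_integral (linepath a4 a1) g) \<le> C / R"
      using R by (simp_all add: power2_eq_square mult_ac)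
    have "contour_integral (linepath a1 a2) g = integral {Re a1..Re a2} (\<lambda>x. g (of_real x))"
      by (rule contour_integral_linepath_Reals_eq) (use R in \<open>auto simp: a1_def a2_def complex_is_Real_iff\<close>)
    also have "\<dots> = integral {-R..R} (\<lambda>x. g (of_real x))"
      by (simp add: a1_def a2_def)
    also have "\<dots> = (LINT t:{-R..R}|lborel. g (complex_of_real t))"
    proof (rule set_borel_integral_eq_integral(2)[symmetric])
      show "set_integrable lborel {- R..R} (\<lambda>x. g (complex_of_real x))"
        unfolding set_integrable_def by (rule integrable_mult_indicator[OF _ int]) simp
    qed
    finally have "contour_integral (linepath a1 a2) g = (LINT t|lborel. indicator {-R..R} t *\<^sub>R g (complex_of_real t))"
      by (simp add: set_lebesgue_integral_def)
    then have "norm ((LINT t|lborel. indicator {-R..R} t *\<^sub>R g (complex_of_real t)) - c)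
       = norm (contour_integral (linepath a2 a3) g
         + (contour_integral (linepath a3 a4) g + contour_integral (linepath a4 a1) g))"
      by (subst norm_minus_cancel[symmetric]) (simp add: c)
    also have "\<dots> \<le> C / R + (2 * C / R + C / R)"
      by (intro norm_triangle_mono b)
    also have "\<dots> = 4 * C / R"
      by (simp add: field_simps)
    finally show ?thesis .
  qed
  have "(\<lambda>n. LINT t|lborel. indicator {-real n..real n} t *\<^sub>R g (complex_of_real t))
      \<longlonglongrightarrow> (\<integral>t. g (complex_of_real t) \<partial>lborel)"
  proof (rule integral_dominated_convergence[where w = "\<lambda>t. norm (g (complex_of_real t))"])
    show "AE t in lborel. (\<lambda>n. indicator {-real n..real n} t *\<^sub>R g (complex_of_real t)) \<longlonglongrightarrow> g (complex_of_real t)"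
    proof (rule AE_I2)
      fix t :: real
      obtain N where N: "\<bar>t\<bar> \<le> real N"
        using real_arch_simple by blast
      have "\<forall>\<^sub>F n in sequentially. indicator {-real n..real n} t *\<^sub>R g (complex_of_real t) = g (complex_of_real t)"
        using eventually_ge_at_top[of N]
        by eventually_elim (use N in \<open>auto simp: indicator_def\<close>)
      then show "(\<lambda>n. indicator {-real n..real n} t *\<^sub>R g (complex_of_real t)) \<longlonglongrightarrow> g (complex_of_real t)"
        by (rule tendsto_eventually)
    qed
  qed (use int in \<open>auto simp: indicator_def borel_measurable_integrable integrable_norm\<close>)
  moreover have "(\<lambda>n. LINT t|lborel. indicator {-real n..real n} t *\<^sub>R g (complex_of_real t)) \<longlonglongrightarrow> c"
  proof (rule Lim_transform_bound[THEN LIM_zero_cancel])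
    show "\<forall>\<^sub>F n in sequentially. norm ((LINT t|lborel. indicator {-real n..real n} t *\<^sub>R g (complex_of_real t)) - c)
        \<le> norm (4 * C / real n)"
      using eventually_ge_at_top[of "max 1 (nat \<lceil>r\<rceil>)"]
    proof eventually_elim
      case (elim n)
      then have "r \<le> real n" "real n > 0"
        by linarith+
      from est[OF this] show ?case
        by (rule order_trans) (simp add: divide_right_mono)
    qed
    show "(\<lambda>n. 4 * C / real n) \<longlonglongrightarrow> 0"
      by real_asymp
  qed
  ultimately show ?thesis
    by (rule LIMSEQ_unique)
qed

lemma open_half_plane: "open {z. Im z > c}" and convex_half_plane: "convex {z. Im z > c}"
  using open_halfspace_Im_gt[of c] convex_halfspace_Im_gt[of c] by simp_all

lemma continuous_on_slice:
  assumes "continuous_on A F" "\<And>x. Complex x y \<in> A"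
  shows "continuous_on UNIV (\<lambda>x. F (Complex x y))"
  using assms by (intro continuous_on_compose2[OF assms(1)]) (auto intro!: continuous_intros simp: Complex_eq)

lemma borel_measurable_slice:
  assumes "continuous_on A F" "\<And>x. Complex x y \<in> A"
  shows "(\<lambda>x. F (Complex x y)) \<in> borel_measurable borel"
  using continuous_on_slice[OF assms] by (rule borel_measurable_continuous_onI)

lemma Complex_0_eq: "Complex t 0 = of_real t"
  by (simp add: complex_eq_iff)

lemma norm_real_minus_ge: "\<bar>Im z\<bar> \<le> norm (of_real t - z)"
  using abs_Im_le_cmod[of "of_real t - z"] by simp

text \<open>For functions that are holomorphic across the real line and decay quadratically, the Cauchy
formulas on the real line follow from contours alone. A Hardy function is brought into this class
by shifting it upwards and multiplying it by a damping factor.\<close>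
locale half_plane_decay =
  fixes F :: "complex \<Rightarrow> complex" and e C :: real
  assumes e_pos: "e > 0"
    and holo: "F holomorphic_on {z. Im z > -e}"
    and decay: "\<And>z. Im z \<ge> 0 \<Longrightarrow> norm (F z) \<le> C / (1 + (norm z)\<^sup>2)"
begin

lemma C_nonneg: "C \<ge> 0"
  using order_trans[OF norm_ge_zero decay[of 0]] by simp

lemma decay_square:
  assumes "Im z \<ge> 0" "norm z > 0" shows "norm (F z) \<le> C / (norm z)\<^sup>2"
proof -
  have "norm (F z) \<le> C / (1 + (norm z)\<^sup>2)" using decay assms by simp
  also have "\<dots> \<le> C / (norm z)\<^sup>2"
    using assms C_nonneg by (intro divide_left_mono mult_pos_pos) (auto simp: add_pos_nonneg)
  finally show ?thesis .
qed

lemma measurable_boundary: "(\<lambda>t. F (complex_of_real t)) \<in> borel_measurable borel"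
  using borel_measurable_slice[OF holomorphic_on_imp_continuous_on[OF holo], of 0] e_pos
  by (simp add: Complex_0_eq)

lemma integrable_boundary: "integrable lborel (\<lambda>t. F (complex_of_real t))"
  by (rule integrable_inverse_square_bound[where C = C])
    (use decay[of "complex_of_real _"] measurable_boundary in auto)

lemma integral_boundary: "(\<integral>t. F (complex_of_real t) \<partial>lborel) = 0"
proof (rule half_plane_contour_limit[where r = 1 and C = C])
  show "(F has_contour_integral 0) (rectpath (Complex (- R) 0) (Complex R R))" if "R \<ge> 1" for R
  proof (rule Cauchy_theorem_convex_simple[OF holo convex_half_plane])
    show "path_image (rectpath (Complex (- R) 0) (Complex R R)) \<subseteq> {z. Im z > -e}"
      using path_image_rectpath_subset_cbox[of "Complex (-R) 0" "Complex R R"] that e_pos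
      by (force simp: in_cbox_complex_iff)
  qed auto
  show "norm (F z) \<le> C / (norm z)\<^sup>2" if "Im z \<ge> 0" "1 \<le> norm z" for z
    using decay_square[of z] that by linarith
qed (use integrable_boundary in auto)

lemma integral_Cauchy_kernel_upper:
  assumes z: "Im z > 0"
  shows "(\<integral>t. F (complex_of_real t) / (of_real t - z) \<partial>lborel) = 2 * pi * \<i> * F z"
proof (rule half_plane_contour_limit[where r = "norm z + 1" and C = C and g = "\<lambda>w. F w / (w - z)"])
  \<comment> \<open>A rectangle of this size contains \<open>z\<close>, and for \<open>|w| \<ge> |z| + 1\<close> the factor \<open>1 / (w - z)\<close> has modulus at most 1.\<close>
  fix R assume R: "norm z + 1 \<le> R"
  let ?p = "rectpath (Complex (- R) 0) (Complex R R)"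
  have "\<bar>Re z\<bar> \<le> norm z" "\<bar>Im z\<bar> \<le> norm z"
    by (rule abs_Re_le_cmod abs_Im_le_cmod)+
  then have zin: "z \<in> box (Complex (- R) 0) (Complex R R)"
    using R z by (auto simp: in_box_complex_iff)
  have R': "R > 0" using R norm_ge_zero[of z] by linarith
  have "((\<lambda>w. F w / (w - z)) has_contour_integral (2*pi * \<i> * winding_number ?p z * F z)) ?p"
  proof (rule Cauchy_integral_formula_convex_simple[OF convex_half_plane holo])
    show "path_image ?p \<subseteq> {z. Im z > -e} - {z}"
      using path_image_rectpath_subset_cbox[of "Complex (-R) 0" "Complex R R"]
        path_image_rectpath_inter_box[of "Complex (-R) 0" "Complex R R"] zin R' e_pos
      by (force simp: in_cbox_complex_iff)
    show "z \<in> interior {z. Im z > -e}"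
      using z e_pos by (simp add: interior_open open_half_plane)
  qed auto
  also have "winding_number ?p z = 1"
    by (rule winding_number_rectpath) (rule zin)
  finally show "((\<lambda>w. F w / (w - z)) has_contour_integral (2*pi * \<i> * F z)) ?p"
    by simp
next
  fix w assume w: "Im w \<ge> 0" "norm z + 1 \<le> norm w"
  have 1: "norm (w - z) \<ge> 1"
    using w norm_triangle_ineq2[of w z] by linarith
  have "norm (F w / (w - z)) \<le> norm (F w) / 1"
    unfolding norm_divide using 1 by (intro divide_left_mono) auto
  also have "norm w > 0" using w norm_ge_zero[of z] by linarith
  with w have "norm (F w) / 1 \<le> C / (norm w)\<^sup>2"
    using decay_square[of w] by simp
  finally show "norm (F w / (w - z)) \<le> C / (norm w)\<^sup>2" .
next
  show "integrable lborel (\<lambda>t. F (complex_of_real t) / (of_real t - z))"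
  proof (rule Bochner_Integration.integrable_bound)
    show "integrable lborel (\<lambda>t. F (complex_of_real t) * of_real (1 / Im z))"
      using integrable_boundary by simp
    show "AE t in lborel. norm (F (complex_of_real t) / (of_real t - z))
        \<le> norm (F (complex_of_real t) * of_real (1 / Im z))"
    proof (rule AE_I2)
      fix t
      have "norm (F (complex_of_real t)) / norm (of_real t - z) \<le> norm (F (complex_of_real t)) / Im z"
        using norm_real_minus_ge[of z t] z by (intro divide_left_mono mult_pos_pos) auto
      then show "norm (F (complex_of_real t) / (of_real t - z))
        \<le> norm (F (complex_of_real t) * of_real (1 / Im z))"
        using z by (simp add: norm_divide norm_mult)
    qed
  qed (use measurable_boundary in measurable)
qed

lemma integral_Cauchy_kernel_lower:
  assumes z: "Im z < 0"
  shows "(\<integral>t. F (complex_of_real t) / (of_real t - z) \<partial>lborel) = 0"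
proof -
  let ?d = "min e (- Im z)"
  interpret G: half_plane_decay "\<lambda>w. F w / (w - z)" ?d "C / (- Im z)"
  proof
    show "?d > 0" using e_pos z by simp
    show "(\<lambda>w. F w / (w - z)) holomorphic_on {w. Im w > - ?d}"
      using z by (auto intro!: holomorphic_intros holomorphic_on_subset[OF holo])
    fix w assume w: "Im w \<ge> 0"
    have "- Im z \<le> norm (w - z)"
      using abs_Im_le_cmod[of "w - z"] w z by auto
    then have "norm (F w) / norm (w - z) \<le> (C / (1 + (norm w)\<^sup>2)) / (- Im z)"
      using z w decay[of w] C_nonneg by (intro frac_le) auto
    then show "norm (F w / (w - z)) \<le> C / (- Im z) / (1 + (norm w)\<^sup>2)"
      by (simp add: norm_divide field_simps)
  qed
  show ?thesis
    by (rule G.integral_boundary)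
qed

end

text \<open>Dominated convergence for a parameter in a first-countable space, where sequences decide limits.\<close>
lemma integral_tendsto_within:
  fixes s :: "'b::first_countable_topology \<Rightarrow> 'a \<Rightarrow> 'c::{banach, second_countable_topology}"
  assumes meas: "\<forall>\<^sub>F z in at a within S. s z \<in> borel_measurable M"
    and f: "f \<in> borel_measurable M" and w: "integrable M w"
    and bound: "\<forall>\<^sub>F z in at a within S. AE x in M. norm (s z x) \<le> w x"
    and lim: "AE x in M. ((\<lambda>z. s z x) \<longlongrightarrow> f x) (at a within S)"
  shows "((\<lambda>z. \<integral>x. s z x \<partial>M) \<longlongrightarrow> (\<integral>x. f x \<partial>M)) (at a within S)"
  unfolding tendsto_at_iff_sequentially
proof (intro allI impI)
  fix X assume X: "\<forall>i. X i \<in> S - {a}" "X \<longlonglongrightarrow> a"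
  have fl: "filterlim X (at a within S) sequentially"
    using X by (auto simp: filterlim_at)
  from eventually_conj[OF meas bound] have "\<forall>\<^sub>F i in sequentially.
      s (X i) \<in> borel_measurable M \<and> (AE x in M. norm (s (X i) x) \<le> w x)"
    by (rule eventually_compose_filterlim[OF _ fl])
  then obtain N where N: "\<And>i. i \<ge> N \<Longrightarrow> s (X i) \<in> borel_measurable M"
      "\<And>i. i \<ge> N \<Longrightarrow> AE x in M. norm (s (X i) x) \<le> w x"
    by (auto simp: eventually_sequentially)
  have "(\<lambda>i. \<integral>x. s (X (i + N)) x \<partial>M) \<longlonglongrightarrow> (\<integral>x. f x \<partial>M)"
  proof (rule integral_dominated_convergence[OF f _ w])
    show "AE x in M. (\<lambda>i. s (X (i + N)) x) \<longlonglongrightarrow> f x"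
      using lim
    proof eventually_elim
      case (elim x)
      from filterlim_compose[OF elim fl] show ?case
        by (rule LIMSEQ_ignore_initial_segment)
    qed
  qed (use N in auto)
  then show "((\<lambda>z. \<integral>x. s z x \<partial>M) \<circ> X) \<longlonglongrightarrow> (\<integral>x. f x \<partial>M)"
    unfolding o_def by (rule LIMSEQ_offset)
qed

lemma integrable_Cauchy_kernel:
  fixes w :: "real \<Rightarrow> complex"
  assumes w: "integrable lborel w" and a: "Im a \<noteq> 0"
  shows "integrable lborel (\<lambda>t. w t / (of_real t - a))"
proof (rule Bochner_Integration.integrable_bound)
  have [measurable]: "w \<in> borel_measurable borel" using w by auto
  show "integrable lborel (\<lambda>t. w t * of_real (1 / Im a))"
    using w by simp
  show "AE t in lborel. norm (w t / (of_real t - a)) \<le> norm (w t * of_real (1 / Im a))"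
  proof (rule AE_I2)
    fix t
    have "norm (w t) / norm (of_real t - a) \<le> norm (w t) / \<bar>Im a\<bar>"
      using norm_real_minus_ge[of a t] a by (intro divide_left_mono mult_pos_pos) auto
    then show "norm (w t / (of_real t - a)) \<le> norm (w t * of_real (1 / Im a))"
      by (simp add: norm_divide norm_mult)
  qed
  show "(\<lambda>t. w t / (of_real t - a)) \<in> borel_measurable lborel"
    by measurable
qed

text \<open>The difference quotient of the kernel is \<open>1 / ((t - z)(t - a))\<close>, which is bounded uniformly in \<open>t\<close> as
long as \<open>z\<close> stays away from the real line.\<close>
lemma has_field_derivative_Cauchy_transform:
  fixes w :: "real \<Rightarrow> complex"
  assumes w: "integrable lborel w" and a: "Im a \<noteq> 0"
  shows "((\<lambda>z. \<integral>t. w t / (of_real t - z) \<partial>lborel) has_field_derivative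
     (\<integral>t. w t / (of_real t - a)\<^sup>2 \<partial>lborel)) (at a)"
  unfolding has_field_derivative_iff
proof (rule Lim_transform_eventually)
  have [measurable]: "w \<in> borel_measurable borel" using w by auto
  let ?U = "{z. \<bar>Im z\<bar> > \<bar>Im a\<bar> / 2}"
  have op: "open ?U"
    by (intro open_Collect_less continuous_intros)
  then have ev: "\<forall>\<^sub>F z in at a. z \<in> ?U"
    using a by (intro eventually_at_in_open') auto
  then show "\<forall>\<^sub>F z in at a. (\<integral>t. w t / ((of_real t - z) * (of_real t - a)) \<partial>lborel)
    = ((\<integral>t. w t / (of_real t - z) \<partial>lborel) - (\<integral>t. w t / (of_real t - a) \<partial>lborel)) / (z - a)"
    using eventually_neq_at_within[of a]
  proof eventually_elim
    case (elim z)
    then have z: "Im z \<noteq> 0" "z \<noteq> a" by auto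
    have ne: "of_real t - z \<noteq> 0" "of_real t - a \<noteq> 0" for t
      using z a by (auto simp: complex_eq_iff)
    have "((\<integral>t. w t / (of_real t - z) \<partial>lborel) - (\<integral>t. w t / (of_real t - a) \<partial>lborel)) / (z - a)
      = (\<integral>t. (w t / (of_real t - z) - w t / (of_real t - a)) / (z - a) \<partial>lborel)"
      using integrable_Cauchy_kernel[OF w z(1)] integrable_Cauchy_kernel[OF w a] by simp
    also have "\<dots> = (\<integral>t. w t / ((of_real t - z) * (of_real t - a)) \<partial>lborel)"
    proof (rule Bochner_Integration.integral_cong[OF refl])
      fix t
      have "w t / (of_real t - z) - w t / (of_real t - a)
        = (w t / ((of_real t - z) * (of_real t - a))) * (z - a)"
        using ne[of t] by (simp add: divide_simps) (simp add: algebra_simps)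
      then show "(w t / (of_real t - z) - w t / (of_real t - a)) / (z - a)
        = w t / ((of_real t - z) * (of_real t - a))"
        using z by simp
    qed
    finally show ?case ..
  qed
  show "((\<lambda>z. \<integral>t. w t / ((of_real t - z) * (of_real t - a)) \<partial>lborel)
    \<longlongrightarrow> (\<integral>t. w t / (of_real t - a)\<^sup>2 \<partial>lborel)) (at a)"
  proof (rule integral_tendsto_within)
    show "integrable lborel (\<lambda>t. norm (w t) / ((\<bar>Im a\<bar> / 2) * \<bar>Im a\<bar>))"
      using w by simp
    show "\<forall>\<^sub>F z in at a. AE t in lborel.
       norm (w t / ((of_real t - z) * (of_real t - a))) \<le> norm (w t) / ((\<bar>Im a\<bar> / 2) * \<bar>Im a\<bar>)"
      using ev
    proof eventually_elim
      case (elim z)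
      have "(\<bar>Im a\<bar> / 2) * \<bar>Im a\<bar> \<le> norm (of_real t - z) * norm (of_real t - a)" for t
        using norm_real_minus_ge[of z t] norm_real_minus_ge[of a t] elim by (intro mult_mono) auto
      moreover have "norm (of_real t - z) > 0" "norm (of_real t - a) > 0" for t
        using norm_real_minus_ge[of z t] norm_real_minus_ge[of a t] elim a by auto
      ultimately have "norm (w t) / (norm (of_real t - z) * norm (of_real t - a))
          \<le> norm (w t) / ((\<bar>Im a\<bar> / 2) * \<bar>Im a\<bar>)" for t
        using a by (intro divide_left_mono mult_pos_pos) auto
      then show ?case
        by (simp add: norm_divide norm_mult)
    qed
    have "of_real t - a \<noteq> 0" for t
      using a by (auto simp: complex_eq_iff)
    then show "AE t in lborel. ((\<lambda>z. w t / ((of_real t - z) * (of_real t - a)))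
       \<longlongrightarrow> w t / (of_real t - a)\<^sup>2) (at a)"
      by (auto intro!: tendsto_eq_intros simp: power2_eq_square)
  qed simp_all
qed

section \<open>Square roots of moduli and the Poisson integral\<close>

text \<open>A family bounded in \<open>L\<^sup>1\<close> can lose mass in the limit; this is the obstacle to recovering an
\<open>H\<^sup>1\<close> function from its pointwise boundary values. The square root of the modulus of a holomorphic
function is still subharmonic, and it is bounded in \<open>L\<^sup>2\<close>. Bounding it by its Poisson integral
is therefore what later excludes the loss of mass.\<close>
definition poisson_kernel :: "complex \<Rightarrow> real \<Rightarrow> real"
  where "poisson_kernel z t = Im z / (pi * (norm (of_real t - z))\<^sup>2)"

lemma poisson_kernel_measurable [measurable]: "poisson_kernel z \<in> borel_measurable borel"
  unfolding poisson_kernel_def by measurable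

lemma poisson_kernel_eq: "poisson_kernel (Complex x y) t = y / (pi * ((t - x)\<^sup>2 + y\<^sup>2))"
  by (simp add: poisson_kernel_def cmod_power2)

lemma poisson_kernel_nonneg: "Im z > 0 \<Longrightarrow> poisson_kernel z t \<ge> 0"
  by (simp add: poisson_kernel_def)

lemma poisson_kernel_le: 
  assumes "Im z > 0" shows "poisson_kernel z t \<le> 1 / (pi * Im z)"
proof -
  have "(Im z)\<^sup>2 \<le> (norm (of_real t - z))\<^sup>2"
    using norm_real_minus_ge[of z t] assms by (intro power_mono) auto
  then have "Im z / (pi * (norm (of_real t - z))\<^sup>2) \<le> Im z / (pi * (Im z)\<^sup>2)"
    using assms by (intro divide_left_mono mult_left_mono mult_pos_pos) (auto simp: complex_eq_iff)
  also have "\<dots> = 1 / (pi * Im z)"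
    using assms by (simp add: power2_eq_square)
  finally show ?thesis by (simp add: poisson_kernel_def)
qed

lemma poisson_kernel_Im: 
  "poisson_kernel z t = Im (1 / (of_real t - z)) / pi"
  by (simp add: poisson_kernel_def Im_divide cmod_power2)

lemma poisson_kernel_swap: "poisson_kernel (Complex x y) t = poisson_kernel (Complex t y) x"
  by (simp add: poisson_kernel_eq power2_commute)

lemma integrable_standard_poisson_kernel: "integrable lborel (\<lambda>s::real. 1 / (pi * (1 + s\<^sup>2)))"
  and integral_standard_poisson_kernel: "(\<integral>s. 1 / (pi * (1 + s\<^sup>2)) \<partial>lborel) = 1"
proof -
  have eq: "(\<lambda>s::real. 1 / (pi * (1 + s\<^sup>2))) = (\<lambda>s. 1 / pi * (1 / (1 + s\<^sup>2)))"
    by auto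
  show "integrable lborel (\<lambda>s::real. 1 / (pi * (1 + s\<^sup>2)))"
    unfolding eq by (intro integrable_mult_right integrable_inverse_one_plus_square)
  have "(\<integral>s. 1 / pi * (1 / (1 + s\<^sup>2)) \<partial>lborel) = 1 / pi * pi"
    unfolding integral_mult_right_zero integral_inverse_one_plus_square ..
  then show "(\<integral>s. 1 / (pi * (1 + s\<^sup>2)) \<partial>lborel) = 1"
    unfolding eq by simp
qed

lemma poisson_kernel_affine:
  assumes "Im z > 0"
  shows "Im z * poisson_kernel z (Re z + Im z * s) = 1 / (pi * (1 + s\<^sup>2))"
proof -
  have "poisson_kernel z (Re z + Im z * s) = Im z / (pi * ((Im z * s)\<^sup>2 + (Im z)\<^sup>2))"
    using poisson_kernel_eq[of "Re z" "Im z"] by simp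
  also have "(Im z * s)\<^sup>2 + (Im z)\<^sup>2 = (Im z)\<^sup>2 * (1 + s\<^sup>2)"
    by (simp add: power_mult_distrib algebra_simps)
  finally show ?thesis
    using assms by (simp add: power2_eq_square)
qed

lemma nn_integral_poisson_kernel:
  assumes "Im z > 0"
  shows "(\<integral>\<^sup>+t. ennreal (poisson_kernel z t) \<partial>lborel) = 1"
proof -
  have "(\<integral>\<^sup>+t. ennreal (poisson_kernel z t) \<partial>lborel)
    = ennreal \<bar>Im z\<bar> * (\<integral>\<^sup>+s. ennreal (poisson_kernel z (Re z + Im z * s)) \<partial>lborel)"
    by (rule nn_integral_real_affine) (use assms in auto)
  also have "\<dots> = (\<integral>\<^sup>+s. ennreal (Im z * poisson_kernel z (Re z + Im z * s)) \<partial>lborel)"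
    using assms by (simp add: nn_integral_cmult[symmetric] ennreal_mult poisson_kernel_nonneg)
  also have "\<dots> = (\<integral>\<^sup>+s. ennreal (1 / (pi * (1 + s\<^sup>2))) \<partial>lborel)"
    using assms by (simp only: poisson_kernel_affine)
  also have "\<dots> = ennreal (\<integral>s. 1 / (pi * (1 + s\<^sup>2)) \<partial>lborel)"
    using integrable_standard_poisson_kernel by (intro nn_integral_eq_integral) auto
  also have "(\<integral>s. 1 / (pi * (1 + s\<^sup>2)) \<partial>lborel) = 1"
    by (rule integral_standard_poisson_kernel)
  finally show ?thesis by simp
qed

text \<open>The decay makes the boundary function \<open>w\<close> below integrable and lets the square root of \<open>|F|\<close> tend to
zero at infinity, so that the maximum principle applies on the unbounded half-plane.\<close>
locale half_plane_fast_decay =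
  fixes F :: "complex \<Rightarrow> complex" and e C :: real
  assumes e_pos: "e > 0"
    and holo: "F holomorphic_on {z. Im z > -e}"
    and decay: "\<And>z. Im z \<ge> 0 \<Longrightarrow> sqrt (norm (F z)) \<le> C / (1 + (norm z)\<^sup>2)"
begin

definition w :: "real \<Rightarrow> real" where "w t = sqrt (norm (F (complex_of_real t)))"

text \<open>The Poisson integral of \<open>w\<close> after the substitution \<open>t = Re z + Im z * s\<close>. In this form it also makes
sense on the real line, where it equals \<open>w\<close>, and its continuity up to the boundary is immediate.\<close>
definition H :: "complex \<Rightarrow> real"
  where "H z = (\<integral>s. w (Re z + Im z * s) * (1 / (pi * (1 + s\<^sup>2))) \<partial>lborel)"

lemma C_nonneg: "C \<ge> 0"
  using order_trans[OF real_sqrt_ge_zero[OF norm_ge_zero] decay[of 0]] by simp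

lemma continuous_F: "continuous_on {z. Im z \<ge> 0} F"
  using holomorphic_on_imp_continuous_on[OF holo] by (rule continuous_on_subset) (use e_pos in auto)

lemma continuous_w: "continuous_on UNIV w"
  unfolding w_def
  by (intro continuous_intros continuous_on_compose2[OF continuous_F]) auto

lemma measurable_w [measurable]: "w \<in> borel_measurable borel"
  using continuous_w by (rule borel_measurable_continuous_onI)

lemma w_nonneg: "w t \<ge> 0" and w_le: "w t \<le> C / (1 + t\<^sup>2)"
  using decay[of "complex_of_real t"] by (simp_all add: w_def)

lemma w_le_C: "w t \<le> C"
proof -
  have "C / (1 + t\<^sup>2) \<le> C / 1"
    using C_nonneg by (intro divide_left_mono) (auto simp: add_pos_nonneg)
  then show ?thesis using w_le[of t] by simp
qed

lemma integrable_w: "integrable lborel w"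
  by (rule integrable_inverse_square_bound[where C = C]) (use w_le w_nonneg in auto)

lemma H_nonneg: "H z \<ge> 0"
  unfolding H_def by (intro integral_nonneg_AE AE_I2) (simp add: w_nonneg)

lemma H_real: "H (complex_of_real x) = w x"
proof -
  have "(\<integral>s. w x * (1 / (pi * (1 + s\<^sup>2))) \<partial>lborel) = w x * 1"
    unfolding integral_mult_right_zero integral_standard_poisson_kernel ..
  then show ?thesis unfolding H_def by simp
qed

lemma H_poisson:
  assumes "Im z > 0"
  shows "H z = (\<integral>t. poisson_kernel z t * w t \<partial>lborel)"
proof -
  have "(\<integral>t. poisson_kernel z t * w t \<partial>lborel)
    = \<bar>Im z\<bar> *\<^sub>R (\<integral>s. poisson_kernel z (Re z + Im z * s) * w (Re z + Im z * s) \<partial>lborel)"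
    by (rule lborel_integral_real_affine) (use assms in auto)
  also have "\<dots> = (\<integral>s. w (Re z + Im z * s) * (Im z * poisson_kernel z (Re z + Im z * s)) \<partial>lborel)"
    using assms by (simp add: mult_ac flip: Bochner_Integration.integral_mult_right_zero)
  also have "\<dots> = H z"
    unfolding H_def poisson_kernel_affine[OF assms] ..
  finally show ?thesis ..
qed

lemma continuous_H: "continuous_on UNIV H"
proof -
  have "(H \<longlongrightarrow> H a) (at a)" for a
    unfolding H_def
  proof (rule integral_tendsto_within)
    show "integrable lborel (\<lambda>s. C * (1 / (pi * (1 + s\<^sup>2))))"
      by (intro integrable_mult_right integrable_standard_poisson_kernel)
    show "\<forall>\<^sub>F z in at a. AE s in lborel. norm (w (Re z + Im z * s) * (1 / (pi * (1 + s\<^sup>2)))) \<le> C * (1 / (pi * (1 + s\<^sup>2)))"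
    proof (intro always_eventually allI AE_I2)
      fix z and s :: real
      have "w (Re z + Im z * s) * (1 / (pi * (1 + s\<^sup>2))) \<le> C * (1 / (pi * (1 + s\<^sup>2)))"
        by (intro mult_right_mono w_le_C) simp
      then show "norm (w (Re z + Im z * s) * (1 / (pi * (1 + s\<^sup>2)))) \<le> C * (1 / (pi * (1 + s\<^sup>2)))"
        by (simp add: w_nonneg)
    qed
    show "AE s in lborel. ((\<lambda>z. w (Re z + Im z * s) * (1 / (pi * (1 + s\<^sup>2)))) \<longlongrightarrow> w (Re a + Im a * s) * (1 / (pi * (1 + s\<^sup>2)))) (at a)"
    proof (rule AE_I2)
      fix s :: real
      have "((\<lambda>z. w (Re z + Im z * s)) \<longlongrightarrow> w (Re a + Im a * s)) (at a)"
        by (rule continuous_on_tendsto_compose[OF continuous_w]) (auto intro!: tendsto_intros)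
      then show "((\<lambda>z. w (Re z + Im z * s) * (1 / (pi * (1 + s\<^sup>2)))) \<longlongrightarrow> w (Re a + Im a * s) * (1 / (pi * (1 + s\<^sup>2)))) (at a)"
        by (intro tendsto_mult tendsto_const)
    qed
  qed auto
  then show ?thesis
    by (simp add: continuous_on_def)
qed

text \<open>A Cauchy integral whose imaginary part is \<open>H\<close>. Writing the harmonic function \<open>H\<close> in this way allows
the maximum modulus principle for holomorphic functions to replace one for subharmonic functions.\<close>
definition A :: "complex \<Rightarrow> complex"
  where "A z = (\<integral>t. complex_of_real (w t) / (of_real t - z) \<partial>lborel) / pi"

lemma holomorphic_A: "A holomorphic_on {z. Im z > 0}"
proof -
  have "(\<lambda>z. \<integral>t. complex_of_real (w t) / (of_real t - z) \<partial>lborel) field_differentiable at a"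
    if "Im a > 0" for a
    using has_field_derivative_Cauchy_transform[of "\<lambda>t. complex_of_real (w t)" a] that integrable_w
    by (auto simp: field_differentiable_def)
  then show ?thesis
    unfolding A_def
    by (intro holomorphic_intros)
      (auto simp: holomorphic_on_def intro: field_differentiable_at_within)
qed

lemma Im_A:
  assumes "Im z > 0" shows "Im (A z) = H z"
proof -
  have int: "integrable lborel (\<lambda>t. complex_of_real (w t) / (of_real t - z))"
    using assms integrable_w by (intro integrable_Cauchy_kernel) auto
  have "Im (\<integral>t. complex_of_real (w t) / (of_real t - z) \<partial>lborel)
    = (\<integral>t. Im (complex_of_real (w t) / (of_real t - z)) \<partial>lborel)"
    using int by simp
  also have "\<dots> = (\<integral>t. pi * (poisson_kernel z t * w t) \<partial>lborel)"
    by (intro Bochner_Integration.integral_cong refl) (simp add: poisson_kernel_Im Im_divide)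
  also have "\<dots> = pi * H z"
    using assms by (simp add: H_poisson)
  finally show ?thesis
    by (simp add: A_def)
qed

text \<open>Maximum principle for \<open>v = sqrt |F| - H\<close>, which vanishes on the real line and is at most \<open>sqrt |F|\<close>. If
\<open>v\<close> were positive somewhere, it would attain a positive maximum. Near a maximum point \<open>F\<close> has no
zero, hence has a holomorphic square root \<open>S\<close>, and \<open>v\<close> dominates the real part of the holomorphic
function \<open>c S + i A\<close> with equality at the point when the unimodular constant \<open>c\<close> is chosen to make
\<open>c S\<close> positive there. So \<open>v\<close> is constant near each maximum point, which is impossible at a maximum
point with the largest imaginary part.\<close>
lemma sqrt_norm_le_H:
  assumes z1: "Im z1 > 0"
  shows "sqrt (norm (F z1)) \<le> H z1"
proof (rule ccontr)
  assume neg: "\<not> ?thesis"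
  define v where "v z = sqrt (norm (F z)) - H z" for z
  define m where "m = v z1"
  have m: "m > 0" using neg by (simp add: m_def v_def)
  have cont_v: "continuous_on {z. Im z \<ge> 0} v"
    unfolding v_def
    by (intro continuous_intros continuous_F continuous_on_subset[OF continuous_H]) auto
  define K where "K = {z. Im z \<ge> 0} \<inter> v -` {m..}"
  have "closed {z. Im z \<ge> 0}"
    using closed_halfspace_Im_ge[of 0] by simp
  then have "closed K"
    unfolding K_def using cont_v by (intro continuous_closed_preimage) auto
  moreover have "bounded K"
    unfolding bounded_iff
  proof (intro exI ballI)
    fix z assume z: "z \<in> K"
    have "m \<le> sqrt (norm (F z))"
      using z H_nonneg[of z] by (auto simp: K_def v_def)
    also have "\<dots> \<le> C / (1 + (norm z)\<^sup>2)"
      using z decay by (auto simp: K_def)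
    finally have "m * (1 + (norm z)\<^sup>2) \<le> C"
      by (simp add: pos_le_divide_eq add_pos_nonneg)
    then have "(norm z)\<^sup>2 \<le> C / m"
      using m by (simp add: pos_le_divide_eq algebra_simps)
    then show "norm z \<le> sqrt (C / m)"
      by (simp add: real_le_rsqrt)
  qed
  ultimately have "compact K" by (simp add: compact_eq_bounded_closed)
  have cont_K: "continuous_on K v"
    using cont_v by (rule continuous_on_subset) (auto simp: K_def)
  have z1K: "z1 \<in> K" using z1 by (auto simp: K_def m_def)
  obtain zm where zm: "zm \<in> K" "\<And>z. z \<in> K \<Longrightarrow> v z \<le> v zm"
    using continuous_attains_sup[OF \<open>compact K\<close> _ cont_K] z1K by blast
  define M where "M = v zm"
  have vM: "v z \<le> M" if "Im z \<ge> 0" for z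
    using zm(2)[of z] zm(2)[OF z1K] that by (cases "v z \<ge> m") (auto simp: K_def M_def m_def)
  have "M \<ge> m" using zm(1) by (simp add: M_def K_def)
  have "closed (K \<inter> v -` {M})"
    using \<open>closed K\<close> cont_K by (intro continuous_closed_preimage) auto
  then have "compact (K \<inter> v -` {M})"
    using compact_Int_closed[OF \<open>compact K\<close>, of "K \<inter> v -` {M}"] by (simp add: Int_assoc[symmetric])
  moreover have "zm \<in> K \<inter> v -` {M}" using zm by (simp add: M_def)
  ultimately obtain z0 where z0: "z0 \<in> K" "v z0 = M" "\<And>z. z \<in> K \<Longrightarrow> v z = M \<Longrightarrow> Im z \<le> Im z0"
    using continuous_attains_sup[of "K \<inter> v -` {M}" Im] continuous_on_Im[OF continuous_on_id]
    by (metis (no_types, lifting) Int_iff empty_iff singletonD vimage_eq vimage_singleton_eq)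
  \<comment> \<open>On the real line \<open>v\<close> vanishes, because \<open>H\<close> has the boundary values \<open>w\<close>.\<close>
  have Im0: "Im z0 > 0"
  proof (rule ccontr)
    assume "\<not> Im z0 > 0"
    then have "z0 = complex_of_real (Re z0)"
      using z0(1) by (auto simp: K_def complex_eq_iff)
    then have "v z0 = 0"
      using H_real[of "Re z0"] by (simp add: v_def w_def)
    then show False using z0 \<open>M \<ge> m\<close> m by simp
  qed
  have F0: "F z0 \<noteq> 0"
    using z0 \<open>M \<ge> m\<close> m H_nonneg[of z0] by (auto simp: v_def)
  have "open {z. Im z > 0}" by (rule open_half_plane)
  moreover have cont: "continuous_on {z. Im z > 0} F"
    using continuous_F by (rule continuous_on_subset) auto
  ultimately have "open ({z. Im z > 0} \<inter> F -` (- {0}))"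
    by (intro continuous_open_preimage) auto
  moreover have "z0 \<in> {z. Im z > 0} \<inter> F -` (- {0})" using Im0 F0 by simp
  ultimately obtain r where r: "r > 0" "ball z0 r \<subseteq> {z. Im z > 0} \<inter> F -` (- {0})"
    by (meson openE)
  have "F holomorphic_on ball z0 r"
    using holo by (rule holomorphic_on_subset) (use r e_pos in auto)
  moreover have "F z \<noteq> 0" if "z \<in> ball z0 r" for z
    using r that by blast
  ultimately obtain S where S: "S holomorphic_on ball z0 r" "\<And>z. z \<in> ball z0 r \<Longrightarrow> F z = (S z)\<^sup>2"
    using contractible_imp_holomorphic_sqrt[OF _ convex_imp_contractible[OF convex_ball]] by blast
  have normS: "norm (S z) = sqrt (norm (F z))" if "z \<in> ball z0 r" for z
    using S(2)[OF that] by (simp add: norm_power)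
  define c where "c = cnj (S z0) / norm (S z0)"
  have S0: "S z0 \<noteq> 0" using F0 S(2)[of z0] r by auto
  have normc: "norm c = 1" using S0 by (simp add: c_def norm_divide)
  have cS0: "c * S z0 = norm (S z0)"
    using S0 complex_norm_square[of "S z0"] by (simp add: c_def power2_eq_square mult_ac nonzero_divide_eq_eq)
  define \<Phi> where "\<Phi> z = c * S z + \<i> * A z" for z
  have ballIm: "Im z > 0" if "z \<in> ball z0 r" for z using r that by auto
  have hol\<Phi>: "(\<lambda>z. exp (\<Phi> z)) holomorphic_on ball z0 r"
    unfolding \<Phi>_def
    by (intro holomorphic_intros S holomorphic_on_subset[OF holomorphic_A]) (use ballIm in auto)
  have Re\<Phi>: "Re (\<Phi> z) \<le> v z" if "z \<in> ball z0 r" for z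
  proof -
    have "Re (c * S z) \<le> norm (c * S z)" by (rule complex_Re_le_cmod)
    then show ?thesis
      using Im_A[OF ballIm[OF that]] normS[OF that] by (simp add: \<Phi>_def v_def norm_mult normc)
  qed
  have Re\<Phi>0: "Re (\<Phi> z0) = M"
  proof -
    have "z0 \<in> ball z0 r" using r by simp
    then have "Re (\<Phi> z0) = v z0"
      using Im_A[OF Im0] normS[of z0] by (simp add: \<Phi>_def v_def cS0)
    then show ?thesis using z0 by simp
  qed
  have "(\<lambda>z. exp (\<Phi> z)) constant_on ball z0 r"
  proof (rule maximum_modulus_principle[OF hol\<Phi> open_ball connected_ball open_ball order_refl])
    show "z0 \<in> ball z0 r" using r by simp
    show "norm (exp (\<Phi> z)) \<le> norm (exp (\<Phi> z0))" if "z \<in> ball z0 r" for z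
      using Re\<Phi>[OF that] vM[of z] ballIm[OF that] Re\<Phi>0 by simp
  qed
  then have const: "exp (\<Phi> z) = exp (\<Phi> z0)" if "z \<in> ball z0 r" for z
    using that r unfolding constant_on_def by (metis centre_in_ball)
  \<comment> \<open>A point of the disc above \<open>z0\<close>, contradicting the choice of \<open>z0\<close> as the highest maximum point.\<close>
  define z2 where "z2 = z0 + \<i> * of_real (r / 2)"
  have z2: "z2 \<in> ball z0 r" using r by (simp add: z2_def dist_norm norm_mult)
  have "Re (\<Phi> z2) = M"
    using arg_cong[OF const[OF z2], of norm] Re\<Phi>0 by simp
  then have "v z2 = M"
    using Re\<Phi>[OF z2] vM[of z2] ballIm[OF z2] by simp
  moreover have "z2 \<in> K"
    using ballIm[OF z2] \<open>v z2 = M\<close> \<open>M \<ge> m\<close> by (simp add: K_def)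
  ultimately have "Im z2 \<le> Im z0" by (intro z0(3))
  then show False using r by (simp add: z2_def)
qed

lemma sqrt_norm_le_poisson:
  assumes "Im z > 0"
  shows "ennreal (sqrt (norm (F z))) \<le> (\<integral>\<^sup>+t. ennreal (poisson_kernel z t * w t) \<partial>lborel)"
proof -
  have "integrable lborel (\<lambda>t. poisson_kernel z t * w t)"
  proof (rule Bochner_Integration.integrable_bound)
    show "integrable lborel (\<lambda>t. 1 / (pi * Im z) * w t)"
      using integrable_w by simp
    show "AE t in lborel. norm (poisson_kernel z t * w t) \<le> norm (1 / (pi * Im z) * w t)"
    proof (rule AE_I2)
      fix t
      have "poisson_kernel z t * w t \<le> 1 / (pi * Im z) * w t"
        by (intro mult_right_mono poisson_kernel_le assms w_nonneg)
      then show "norm (poisson_kernel z t * w t) \<le> norm (1 / (pi * Im z) * w t)"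
        using poisson_kernel_nonneg[OF assms] assms by (simp add: abs_mult w_nonneg)
    qed
  qed simp
  then have "(\<integral>\<^sup>+t. ennreal (poisson_kernel z t * w t) \<partial>lborel) = ennreal (H z)"
    unfolding H_poisson[OF assms] using assms
    by (intro nn_integral_eq_integral) (auto simp: w_nonneg poisson_kernel_nonneg)
  then show ?thesis
    using sqrt_norm_le_H[OF assms] by (simp add: ennreal_leI)
qed

end

section \<open>A weighted form of Jensen's inequality\<close>

text \<open>The graph of \<open>u powr p\<close> lies above its tangent at \<open>r\<close>; this is Young's inequality for \<open>u powr p\<close> and \<open>r powr p\<close>.\<close>
lemma powr_tangent:
  fixes p r u :: real
  assumes "1 \<le> p" "0 < r" "0 \<le> u"
  shows "p * r powr (p - 1) * u \<le> u powr p + (p - 1) * r powr p"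
proof (cases "u = 0")
  case False
  then have u: "u > 0" using assms by simp
  have "(u powr p) powr (1 / p) * (r powr p) powr (1 - 1 / p) \<le> 1 / p * u powr p + (1 - 1 / p) * r powr p"
    by (rule Youngs_inequality_0) (use assms u in auto)
  also have "(u powr p) powr (1 / p) = u"
    using assms u by (simp add: powr_powr)
  also have "(r powr p) powr (1 - 1 / p) = r powr (p - 1)"
    using assms by (simp add: powr_powr algebra_simps)
  finally have "p * (u * r powr (p - 1)) \<le> p * (1 / p * u powr p + (1 - 1 / p) * r powr p)"
    using assms by (intro mult_left_mono) auto
  then show ?thesis
    using assms by (simp add: algebra_simps)
qed (use assms in auto)

text \<open>Jensen's inequality for a measure of total mass at most \<open>m\<close> that consists of a point mass \<open>c\<close>, at which
the function takes the value \<open>a\<close>, and of the density \<open>k\<close>. Admitting a point mass is what yields the sharp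
constant later: there the value of a function at a point and an integral mean of it are estimated
together. Integrating the tangent inequality keeps both sides meaningful when an integral is infinite.\<close>
lemma weighted_power_mean:
  fixes k u :: "'a \<Rightarrow> real"
  assumes p: "1 \<le> p" and m: "0 < m" and c: "0 \<le> c" "0 \<le> a" and s: "0 \<le> s"
    and [measurable]: "k \<in> borel_measurable M" "u \<in> borel_measurable M"
    and nn: "\<And>x. 0 \<le> k x" "\<And>x. 0 \<le> u x"
    and le: "ennreal s \<le> ennreal (c * a) + (\<integral>\<^sup>+x. ennreal (k x * u x) \<partial>M)"
    and mass: "ennreal c + (\<integral>\<^sup>+x. ennreal (k x) \<partial>M) \<le> ennreal m"
  shows "ennreal (s powr p) \<le> ennreal (m powr (p - 1)) *
           (ennreal (c * a powr p) + (\<integral>\<^sup>+x. ennreal (k x * u x powr p) \<partial>M))"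
proof (cases "s = 0")
  case False
  then have s: "s > 0" using s by simp
  \<comment> \<open>The mean value is the point at which the tangent gives the optimal bound.\<close>
  define r where "r = s / m"
  have r: "r > 0" using s m by (simp add: r_def)
  define q where "q = p * r powr (p - 1)"
  have q: "q \<ge> 0" using p by (simp add: q_def)
  define d where "d = (p - 1) * r powr p"
  have d: "d \<ge> 0" using p by (simp add: d_def)
  have tangent: "q * u \<le> u powr p + d" if "u \<ge> 0" for u
    using powr_tangent[OF p r that] by (simp add: q_def d_def)
  define X where "X = ennreal (c * a powr p) + (\<integral>\<^sup>+x. ennreal (k x * u x powr p) \<partial>M)"
  have rm: "q * s = r powr p * m + d * m"
  proof -
    have "s = r * m" using m by (simp add: r_def)
    moreover have "r powr (p - 1) * r = r powr p"
      using r by (simp add: powr_diff)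
    ultimately show ?thesis by (simp add: q_def d_def algebra_simps)
  qed
  have "ennreal (q * s) = ennreal q * ennreal s"
    using q s by (simp add: ennreal_mult)
  also have "\<dots> \<le> ennreal q * (ennreal (c * a) + (\<integral>\<^sup>+x. ennreal (k x * u x) \<partial>M))"
    by (intro mult_left_mono le) simp
  also have "\<dots> = ennreal (c * (q * a)) + (\<integral>\<^sup>+x. ennreal (k x * (q * u x)) \<partial>M)"
    using q c nn by (simp add: distrib_left nn_integral_cmult[symmetric] ennreal_mult[symmetric] mult_ac)
  also have "\<dots> \<le> ennreal (c * (a powr p + d)) + (\<integral>\<^sup>+x. ennreal (k x * (u x powr p + d)) \<partial>M)"
    by (intro add_mono nn_integral_mono ennreal_leI mult_left_mono tangent nn c)
  also have "\<dots> = (ennreal (c * a powr p) + ennreal (d * c))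
      + ((\<integral>\<^sup>+x. ennreal (k x * u x powr p) \<partial>M) + ennreal d * (\<integral>\<^sup>+x. ennreal (k x) \<partial>M))"
    using d c nn by (simp add: distrib_left nn_integral_cmult[symmetric] nn_integral_add[symmetric]
        ennreal_mult[symmetric] mult_ac flip: ennreal_plus)
  also have "\<dots> = X + ennreal d * (ennreal c + (\<integral>\<^sup>+x. ennreal (k x) \<partial>M))"
    using d c by (simp add: X_def distrib_left ennreal_mult[symmetric] add_ac)
  also have "\<dots> \<le> X + ennreal d * ennreal m"
    by (intro add_left_mono mult_left_mono mass) simp
  finally have "ennreal (r powr p * m) + ennreal (d * m) \<le> X + ennreal (d * m)"
    using d m by (simp add: rm ennreal_mult[symmetric])
  then have "ennreal (r powr p * m) \<le> X"
    by (simp add: ennreal_add_left_cancel_le add.commute[of _ "ennreal (d * m)"])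
  then have "ennreal (m powr (p - 1)) * ennreal (r powr p * m) \<le> ennreal (m powr (p - 1)) * X"
    by (intro mult_left_mono) simp_all
  also have "ennreal (m powr (p - 1)) * ennreal (r powr p * m) = ennreal (m powr (p - 1) * (r powr p * m))"
    using m by (simp add: ennreal_mult)
  also have "m powr (p - 1) * (r powr p * m) = s powr p"
    using m s by (simp add: r_def powr_divide powr_diff)
  finally show ?thesis unfolding X_def .
qed simp

section \<open>Functions in \<open>H\<^sup>1\<close> on horizontal lines\<close>

lemma hardy_space_holomorphic: "F \<in> hardy_space p \<Longrightarrow> F holomorphic_on {z. Im z > 0}"
  by (simp add: hardy_space_def upper_half_plane_def)

lemma holomorphic_slice_measurable:
  assumes "F holomorphic_on {z. Im z > 0}" "y > 0"
  shows "(\<lambda>x. F (Complex x y)) \<in> borel_measurable borel"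
  using holomorphic_on_imp_continuous_on[OF assms(1)] by (rule borel_measurable_slice) (use assms in simp)

lemma hardy_space_bound:
  assumes "F \<in> hardy_space p"
  obtains B where "B \<ge> 0" "\<And>y. y > 0 \<Longrightarrow> (\<integral>\<^sup>+x. ennreal (norm (F (Complex x y)) powr p) \<partial>lborel) \<le> ennreal B"
proof
  let ?S = "SUP y\<in>{0<..}. \<integral>\<^sup>+x. ennreal (norm (F (Complex x y)) powr p) \<partial>lborel"
  have "?S < \<infinity>" using assms by (simp add: hardy_space_def)
  then have S: "ennreal (enn2real ?S) = ?S" by simp
  show "(\<integral>\<^sup>+x. ennreal (norm (F (Complex x y)) powr p) \<partial>lborel) \<le> ennreal (enn2real ?S)" if "y > 0" for y
    unfolding S using that by (intro SUP_upper) simp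
qed simp

text \<open>A factor of modulus at most one in the upper half-plane that decays at infinity and tends to one
pointwise as \<open>n\<close> grows; it reduces shifted Hardy functions to functions with decay.\<close>
definition damping :: "nat \<Rightarrow> complex \<Rightarrow> complex"
  where "damping n w = \<i> * of_nat n / (w + \<i> * of_nat n)"

lemma holomorphic_damping: "damping n holomorphic_on {z. Im z > - real n}"
proof -
  have "w + \<i> * of_nat n \<noteq> 0" if "Im w > - real n" for w
    using that by (auto simp: complex_eq_iff)
  then show ?thesis
    unfolding damping_def by (intro holomorphic_intros) auto
qed

lemma norm_damping_denominator:
  "(norm (w + \<i> * of_nat n))\<^sup>2 = (norm w)\<^sup>2 + 2 * real n * Im w + (real n)\<^sup>2"
  unfolding cmod_power2 by (simp add: power2_eq_square algebra_simps)

lemma norm_damping: "(norm (damping n w))\<^sup>2 = (real n)\<^sup>2 / (norm (w + \<i> * of_nat n))\<^sup>2"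
  by (simp add: damping_def norm_divide norm_mult power_divide)

lemma damping_le_1:
  assumes "Im w \<ge> 0" shows "norm (damping n w) \<le> 1"
proof -
  have "(real n)\<^sup>2 \<le> (norm (w + \<i> * of_nat n))\<^sup>2"
    unfolding norm_damping_denominator using assms by simp
  then have "real n \<le> norm (w + \<i> * of_nat n)"
    by (simp add: power2_le_iff_abs_le)
  then show ?thesis
    by (simp add: damping_def norm_divide norm_mult divide_le_eq_1)
qed

lemma damping_decay:
  assumes w: "Im w \<ge> 0" and n: "n \<ge> 1"
  shows "(norm (damping n w))\<^sup>2 \<le> (real n)\<^sup>2 / (1 + (norm w)\<^sup>2)"
proof -
  have "1 \<le> (real n)\<^sup>2" using n by simp
  then have le: "1 + (norm w)\<^sup>2 \<le> (norm (w + \<i> * of_nat n))\<^sup>2"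
    unfolding norm_damping_denominator using w by (simp add: add_increasing)
  have pos: "0 < 1 + (norm w)\<^sup>2" by (simp add: add_pos_nonneg)
  show ?thesis
    unfolding norm_damping using le by (rule divide_left_mono)
      (simp, rule mult_pos_pos[OF less_le_trans[OF pos le] pos])
qed

lemma damping_tendsto: "(\<lambda>n. damping n z) \<longlonglongrightarrow> 1"
proof (rule Lim_transform_eventually)
  have "(\<lambda>n. inverse (of_nat n :: complex)) \<longlonglongrightarrow> 0"
    by (rule lim_inverse_n)
  then have "(\<lambda>n. \<i> / (z * inverse (of_nat n) + \<i>)) \<longlonglongrightarrow> \<i> / (z * 0 + \<i>)"
    by (intro tendsto_divide tendsto_add tendsto_mult tendsto_const) auto
  then show "(\<lambda>n. \<i> / (z * inverse (of_nat n) + \<i>)) \<longlonglongrightarrow> 1"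
    by simp
  show "\<forall>\<^sub>F n in sequentially. \<i> / (z * inverse (of_nat n) + \<i>) = damping n z"
    using eventually_gt_at_top[of 0]
    by eventually_elim (simp add: damping_def field_simps)
qed

locale hardy1 =
  fixes F :: "complex \<Rightarrow> complex" and B :: real
  assumes holo: "F holomorphic_on {z. Im z > 0}"
    and B_nonneg: "B \<ge> 0"
    and bound: "\<And>y. y > 0 \<Longrightarrow> (\<integral>\<^sup>+x. ennreal (norm (F (Complex x y))) \<partial>lborel) \<le> ennreal B"
begin

lemma measurable_slice: "y > 0 \<Longrightarrow> (\<lambda>x. F (Complex x y)) \<in> borel_measurable borel"
  using holo by (rule holomorphic_slice_measurable)

lemma integrable_slice:
  assumes "y > 0" shows "integrable lborel (\<lambda>x. F (Complex x y))"
  unfolding integrable_iff_bounded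
  using measurable_slice[OF assms] bound[OF assms] by (auto simp: less_top[symmetric] top_unique)

text \<open>A primitive \<open>\<Gamma>\<close> of \<open>F\<close> satisfies \<open>|\<Gamma>(z + h) - \<Gamma>(z)| \<le> B\<close> for every \<open>h \<ge> 0\<close>, since this difference is an
integral of \<open>F\<close> along a horizontal segment. Cauchy's estimate for its derivative bounds
\<open>F(z + h) - F(z)\<close> by \<open>2 B / Im z\<close> for all \<open>h\<close>, and averaging over \<open>h\<close> in \<open>[0, 1]\<close> compares \<open>F(z)\<close> with the
mean of \<open>F\<close> over a segment of length one.\<close>
lemma pointwise_bound:
  assumes z: "Im z > 0"
  shows "norm (F z) \<le> B * (1 + 2 / Im z)"
proof -
  obtain \<Gamma> where \<Gamma>: "\<And>z. Im z > 0 \<Longrightarrow> (\<Gamma> has_field_derivative F z) (at z)"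
  proof -
    obtain g where "\<And>z. z \<in> {z. Im z > 0} \<Longrightarrow> (g has_field_derivative F z) (at z within {z. Im z > 0})"
      using holomorphic_convex_primitive'[OF convex_half_plane open_half_plane holo] by blast
    then show ?thesis
      using that[of g] by (simp add: at_within_open[OF _ open_half_plane])
  qed
  have window: "((\<lambda>s. F (z + of_real s)) has_integral (\<Gamma> (z + of_real h) - \<Gamma> z)) {0..h}"
    if "Im z > 0" "h \<ge> 0" for z h
  proof -
    have "((\<lambda>s. F (z + of_real s)) has_integral (\<Gamma> (z + of_real h) - \<Gamma> (z + of_real 0))) {0..h}"
    proof (rule fundamental_theorem_of_calculus)
      fix s assume "s \<in> {0..h}"
      have "((\<lambda>s. z + complex_of_real s) has_vector_derivative 1) (at s within {0..h})"
        by (auto intro!: derivative_eq_intros)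
      from field_vector_diff_chain_within[OF this, of \<Gamma> "F (z + of_real s)"]
      show "((\<lambda>s. \<Gamma> (z + of_real s)) has_vector_derivative F (z + of_real s)) (at s within {0..h})"
        using \<Gamma>[of "z + of_real s"] that by (simp add: o_def has_field_derivative_at_within)
    qed fact
    then show ?thesis by simp
  qed
  have window_bound: "norm (\<Gamma> (z + of_real h) - \<Gamma> z) \<le> B" if "Im z > 0" "h \<ge> 0" for z h
  proof -
    have eq: "F (Complex x (Im z)) = F (z + of_real (x - Re z))" for x
      by (rule arg_cong[of _ _ F]) (simp add: complex_eq_iff)
    have cont: "continuous_on UNIV (\<lambda>s. F (z + of_real s))"
      using that by (intro continuous_on_compose2[OF holomorphic_on_imp_continuous_on[OF holo]] continuous_intros) auto
    then have [measurable]: "(\<lambda>s. F (z + of_real s)) \<in> borel_measurable borel"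
      by (rule borel_measurable_continuous_onI)
    have "(\<integral>\<^sup>+s. ennreal (norm (F (z + of_real s))) \<partial>lborel)
      = (\<integral>\<^sup>+x. ennreal (norm (F (z + of_real (- Re z + 1 * x)))) \<partial>lborel)"
      using nn_integral_real_affine[of "\<lambda>s. ennreal (norm (F (z + of_real s)))" 1 "- Re z"] by simp
    also have "\<dots> = (\<integral>\<^sup>+x. ennreal (norm (F (Complex x (Im z)))) \<partial>lborel)"
      by (simp add: eq add.commute[of "- Re z"])
    also have "\<dots> \<le> ennreal B"
      using bound that by simp
    finally have nnB: "(\<integral>\<^sup>+s. ennreal (norm (F (z + of_real s))) \<partial>lborel) \<le> ennreal B" .
    then have int: "integrable lborel (\<lambda>s. F (z + of_real s))"
      unfolding integrable_iff_bounded by (auto simp: less_top[symmetric] top_unique)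
    have seti: "set_integrable lborel {0..h} (\<lambda>s. F (z + of_real s))"
      unfolding set_integrable_def by (rule integrable_mult_indicator[OF _ int]) simp
    have "\<Gamma> (z + of_real h) - \<Gamma> z = (LINT s:{0..h}|lborel. F (z + of_real s))"
      using window[OF that] set_borel_integral_eq_integral(2)[OF seti] by (simp add: integral_unique)
    also have "norm \<dots> \<le> (\<integral>s. norm (indicator {0..h} s *\<^sub>R F (z + of_real s)) \<partial>lborel)"
      unfolding set_lebesgue_integral_def by (rule integral_norm_bound)
    also have "\<dots> \<le> (\<integral>s. norm (F (z + of_real s)) \<partial>lborel)"
      using int by (intro integral_mono_AE')  (auto simp: indicator_def)
    also have "\<dots> \<le> B"
      using nnB int B_nonneg by (subst integral_eq_nn_integral) (auto intro: enn2real_leI)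
    finally show ?thesis .
  qed
  have diff: "norm (F (z + of_real h) - F z) \<le> 2 * B / Im z" if "h \<ge> 0" for h
  proof -
    let ?g = "\<lambda>w. \<Gamma> (w + of_real h) - \<Gamma> w"
    have d: "(?g has_field_derivative (F (w + of_real h) - F w)) (at w)" if "Im w > 0" for w
      using \<Gamma>[of w] \<Gamma>[of "w + of_real h"] that
      by (auto intro!: derivative_eq_intros DERIV_chain2[where g = "\<lambda>w. w + of_real h"])
    have im: "Im w > 0" if "w \<in> cball z (Im z / 2)" for w
      using that z abs_Im_le_cmod[of "z - w"] by (simp add: dist_norm)
    have hol: "?g holomorphic_on cball z (Im z / 2)"
      unfolding holomorphic_on_def field_differentiable_def
      using d im has_field_derivative_at_within by blast
    have "norm ((deriv ^^ 1) ?g z) \<le> fact 1 * B / (Im z / 2) ^ 1"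
    proof (rule Cauchy_inequality)
      show "?g holomorphic_on ball z (Im z / 2)"
        using hol by (rule holomorphic_on_subset) auto
      show "continuous_on (cball z (Im z / 2)) ?g"
        using hol by (rule holomorphic_on_imp_continuous_on)
      show "norm (?g w) \<le> B" if "norm (z - w) = Im z / 2" for w
        using im[of w] that window_bound[of w h] \<open>h \<ge> 0\<close> by (simp add: dist_norm)
    qed (use z in simp)
    then show ?thesis
      using DERIV_imp_deriv[OF d[OF z]] by (simp add: mult.commute)
  qed
  have hi: "((\<lambda>s. F (z + of_real s) - F z) has_integral (\<Gamma> (z + of_real 1) - \<Gamma> z) - F z) {0..1}"
    using has_integral_diff[OF window[OF z, of 1] has_integral_const_real[of "F z" 0 1]] by simp
  have "norm ((\<Gamma> (z + of_real 1) - \<Gamma> z) - F z) \<le> 2 * B / Im z * measure lborel {0..1::real}"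
    using has_integral_bound[OF _ hi[folded box_real]] diff z B_nonneg by auto
  then have "norm ((\<Gamma> (z + of_real 1) - \<Gamma> z) - F z) \<le> 2 * B / Im z"
    by simp
  moreover have "norm (F z) \<le> norm (\<Gamma> (z + of_real 1) - \<Gamma> z) + norm ((\<Gamma> (z + of_real 1) - \<Gamma> z) - F z)"
    using norm_triangle_ineq4[of "\<Gamma> (z + of_real 1) - \<Gamma> z" "(\<Gamma> (z + of_real 1) - \<Gamma> z) - F z"] by simp
  ultimately show ?thesis
    using window_bound[OF z, of 1] by (simp add: algebra_simps)
qed

lemma shift_bound:
  assumes "Im w \<ge> 0" "e > 0"
  shows "norm (F (w + \<i> * of_real e)) \<le> B * (1 + 2 / e)"
proof -
  have "norm (F (w + \<i> * of_real e)) \<le> B * (1 + 2 / (Im w + e))"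
    using pointwise_bound[of "w + \<i> * of_real e"] assms by simp
  also have "\<dots> \<le> B * (1 + 2 / e)"
    using assms B_nonneg by (intro mult_left_mono add_left_mono divide_left_mono) auto
  finally show ?thesis .
qed

text \<open>A shifted function is bounded by the pointwise estimate. It is damped with the fourth power because
the square root of its modulus has to decay quadratically. The right-hand side does not depend on
the damping, so the damping can be removed on the left.\<close>
lemma sqrt_norm_shift_le_poisson:
  assumes z: "Im z > 0" and e: "e > 0"
  shows "ennreal (sqrt (norm (F (z + \<i> * of_real e)))) \<le>
    (\<integral>\<^sup>+t. ennreal (poisson_kernel z t * sqrt (norm (F (Complex t e)))) \<partial>lborel)"
proof (rule LIMSEQ_le_const2)
  define G where "G n w = F (w + \<i> * of_real e) * damping n w ^ 4" for n w
  have sqrt_G: "sqrt (norm (G n w)) = sqrt (norm (F (w + \<i> * of_real e))) * (norm (damping n w))\<^sup>2" for n w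
  proof -
    have "norm (G n w) = norm (F (w + \<i> * of_real e)) * ((norm (damping n w))\<^sup>2)\<^sup>2"
      by (simp add: G_def norm_mult norm_power)
    then show ?thesis
      by (simp only: real_sqrt_mult real_sqrt_abs) simp
  qed
  show "(\<lambda>n. ennreal (sqrt (norm (G n z)))) \<longlonglongrightarrow> ennreal (sqrt (norm (F (z + \<i> * of_real e))))"
  proof -
    have "(\<lambda>n. G n z) \<longlonglongrightarrow> F (z + \<i> * of_real e) * 1 ^ 4"
      unfolding G_def by (intro tendsto_mult tendsto_power tendsto_const damping_tendsto)
    then show ?thesis
      by (intro tendsto_ennrealI tendsto_real_sqrt tendsto_norm) simp
  qed
  show "\<exists>N. \<forall>n\<ge>N. ennreal (sqrt (norm (G n z))) \<le>
    (\<integral>\<^sup>+t. ennreal (poisson_kernel z t * sqrt (norm (F (Complex t e)))) \<partial>lborel)"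
  proof (intro exI[of _ 1] allI impI)
    fix n :: nat assume n: "n \<ge> 1"
    define K where "K = B * (1 + 2 / e)"
    interpret G: half_plane_fast_decay "G n" "min e (real n)" "sqrt K * (real n)\<^sup>2"
    proof
      show "min e (real n) > 0" using e n by simp
      show "G n holomorphic_on {z. Im z > - min e (real n)}"
        unfolding G_def
        by (intro holomorphic_intros holomorphic_on_compose_gen[OF _ holo, unfolded o_def]
            holomorphic_on_subset[OF holomorphic_damping]) auto
      fix w assume w: "Im w \<ge> 0"
      have "sqrt (norm (F (w + \<i> * of_real e))) * (norm (damping n w))\<^sup>2 \<le> sqrt K * ((real n)\<^sup>2 / (1 + (norm w)\<^sup>2))"
        using shift_bound[OF w e] damping_decay[OF w n] e B_nonneg by (intro mult_mono) (auto simp: K_def)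
      then show "sqrt (norm (G n w)) \<le> sqrt K * (real n)\<^sup>2 / (1 + (norm w)\<^sup>2)"
        by (simp add: sqrt_G)
    qed
    have "ennreal (sqrt (norm (G n z))) \<le> (\<integral>\<^sup>+t. ennreal (poisson_kernel z t * G.w t) \<partial>lborel)"
      by (rule G.sqrt_norm_le_poisson[OF z])
    also have "\<dots> \<le> (\<integral>\<^sup>+t. ennreal (poisson_kernel z t * sqrt (norm (F (Complex t e)))) \<partial>lborel)"
    proof (intro nn_integral_mono ennreal_leI mult_left_mono poisson_kernel_nonneg z)
      fix t
      have "(norm (damping n (of_real t)))\<^sup>2 \<le> 1"
        by (intro power_le_one damping_le_1) auto
      then have "sqrt (norm (F (of_real t + \<i> * of_real e))) * (norm (damping n (of_real t)))\<^sup>2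
         \<le> sqrt (norm (F (of_real t + \<i> * of_real e)))"
        by (intro mult_left_le) auto
      moreover have "of_real t + \<i> * of_real e = Complex t e" by (simp add: complex_eq_iff)
      ultimately show "G.w t \<le> sqrt (norm (F (Complex t e)))"
        by (simp add: G.w_def sqrt_G)
    qed
    finally show "ennreal (sqrt (norm (G n z))) \<le> \<dots>" .
  qed
qed

end

section \<open>Recovering \<open>H\<^sup>1\<close> functions from boundary values\<close>

lemma has_boundary_values_AE_cong:
  assumes "has_boundary_values F f" "AE x in lborel. f x = g x"
  shows "has_boundary_values F g"
  using assms unfolding has_boundary_values_def by eventually_elim simp

lemma has_boundary_values_unique:
  assumes "has_boundary_values F f" "has_boundary_values F g"
  shows "AE x in lborel. f x = g x"
  using assms unfolding has_boundary_values_def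
  by eventually_elim (rule tendsto_unique[OF trivial_limit_at_right_real])

lemma inverse_Suc_at_right: "filterlim (\<lambda>n. inverse (real (Suc n))) (at_right 0) sequentially"
  using LIMSEQ_inverse_real_of_nat
  by (auto simp: filterlim_at intro!: always_eventually)

text \<open>Boundary values are determined only up to null sets of an incomplete measure and need not be Borel
measurable; limits along the heights \<open>1 / (n + 1)\<close> are.\<close>
lemma has_boundary_values_measurable_version:
  assumes holo: "F holomorphic_on {z. Im z > 0}" and F: "has_boundary_values F f"
  obtains f\<^sub>0 where "f\<^sub>0 \<in> borel_measurable borel" "has_boundary_values F f\<^sub>0" "AE x in lborel. f x = f\<^sub>0 x"
proof
  define f\<^sub>0 where "f\<^sub>0 x = lim (\<lambda>n. F (Complex x (inverse (real (Suc n)))))" for x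
  show "f\<^sub>0 \<in> borel_measurable borel"
    unfolding f\<^sub>0_def
    by (rule borel_measurable_lim_metric, rule holomorphic_slice_measurable[OF holo]) simp
  show eq: "AE x in lborel. f x = f\<^sub>0 x"
    using F unfolding has_boundary_values_def
  proof eventually_elim
    case (elim x)
    from filterlim_compose[OF elim inverse_Suc_at_right]
    show ?case unfolding f\<^sub>0_def by (intro limI[symmetric])
  qed
  show "has_boundary_values F f\<^sub>0"
    by (rule has_boundary_values_AE_cong[OF F eq])
qed

context hardy1 begin

lemma shift_tendsto:
  assumes z: "Im z > 0"
  shows "(\<lambda>n. F (z + \<i> * of_real (inverse (real (Suc n))))) \<longlonglongrightarrow> F z"
proof -
  have "(\<lambda>n. z + \<i> * of_real (inverse (real (Suc n)))) \<longlonglongrightarrow> z + \<i> * of_real 0"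
    by (intro tendsto_intros LIMSEQ_inverse_real_of_nat)
  then show ?thesis
    using z by (intro continuous_on_tendsto_compose[OF holomorphic_on_imp_continuous_on[OF holo]])
      (auto intro!: always_eventually add_pos_pos simp del: of_nat_Suc)
qed

lemma damped_decay:
  assumes e: "e > 0" and n: "n \<ge> 1"
  shows "half_plane_decay (\<lambda>w. F (w + \<i> * of_real e) * damping n w ^ 2) (min e (real n)) (B * (1 + 2 / e) * (real n)\<^sup>2)"
proof
  show "min e (real n) > 0" using e n by simp
  show "(\<lambda>w. F (w + \<i> * of_real e) * damping n w ^ 2) holomorphic_on {z. Im z > - min e (real n)}"
    by (intro holomorphic_intros holomorphic_on_compose_gen[OF _ holo, unfolded o_def]
        holomorphic_on_subset[OF holomorphic_damping]) auto
  fix w assume w: "Im w \<ge> 0"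
  have "norm (F (w + \<i> * of_real e)) * (norm (damping n w))\<^sup>2
      \<le> (B * (1 + 2 / e)) * ((real n)\<^sup>2 / (1 + (norm w)\<^sup>2))"
    using e B_nonneg by (intro mult_mono shift_bound damping_decay w n) auto
  then show "norm (F (w + \<i> * of_real e) * damping n w ^ 2) \<le> B * (1 + 2 / e) * (real n)\<^sup>2 / (1 + (norm w)\<^sup>2)"
    by (simp add: norm_mult norm_power)
qed

text \<open>The factor \<open>k\<close> will be \<open>1\<close> or a Cauchy kernel, so this transfers the Cauchy formulas from the damped
functions to the restriction of \<open>F\<close> to a horizontal line.\<close>
lemma damped_integral_limit:
  assumes e: "e > 0" and [measurable]: "k \<in> borel_measurable borel" and k: "\<And>t. norm (k t) \<le> K"
  shows "(\<lambda>n. \<integral>t. F (of_real t + \<i> * of_real e) * damping n (of_real t) ^ 2 * k t \<partial>lborel)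
    \<longlonglongrightarrow> (\<integral>t. F (Complex t e) * k t \<partial>lborel)"
proof (rule integral_dominated_convergence)
  have eq: "of_real t + \<i> * of_real e = Complex t e" for t by (simp add: complex_eq_iff)
  note [measurable] = measurable_slice[OF e]
  have K: "K \<ge> 0" using order_trans[OF norm_ge_zero k] .
  show "integrable lborel (\<lambda>t. norm (F (Complex t e)) * K)"
    using integrable_slice[OF e] by simp
  show "AE t in lborel. (\<lambda>n. F (of_real t + \<i> * of_real e) * damping n (of_real t) ^ 2 * k t)
      \<longlonglongrightarrow> F (Complex t e) * k t"
  proof (rule AE_I2)
    fix t
    have "(\<lambda>n. F (Complex t e) * damping n (of_real t) ^ 2 * k t) \<longlonglongrightarrow> F (Complex t e) * 1 ^ 2 * k t"
      by (intro tendsto_mult tendsto_power tendsto_const damping_tendsto)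
    then show "(\<lambda>n. F (of_real t + \<i> * of_real e) * damping n (of_real t) ^ 2 * k t)
      \<longlonglongrightarrow> F (Complex t e) * k t" by (simp add: eq)
  qed
  show "AE t in lborel. norm (F (of_real t + \<i> * of_real e) * damping n (of_real t) ^ 2 * k t)
    \<le> norm (F (Complex t e)) * K" for n
  proof (rule AE_I2)
    fix t
    have "norm (F (Complex t e)) * norm (damping n (of_real t)) ^ 2 * norm (k t) \<le> norm (F (Complex t e)) * 1 ^ 2 * K"
      using K by (intro mult_mono power_mono k damping_le_1) auto
    then show "norm (F (of_real t + \<i> * of_real e) * damping n (of_real t) ^ 2 * k t)
      \<le> norm (F (Complex t e)) * K"
      by (simp add: eq norm_mult norm_power)
  qed
  show "(\<lambda>t. F (of_real t + \<i> * of_real e) * damping n (of_real t) ^ 2 * k t) \<in> borel_measurable lborel" for n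
    unfolding eq damping_def by measurable
  show "(\<lambda>t. F (Complex t e) * k t) \<in> borel_measurable lborel"
    by measurable
qed

end

locale hardy1_boundary = hardy1 +
  fixes F0 :: "real \<Rightarrow> complex"
  assumes measurable_F0 [measurable]: "F0 \<in> borel_measurable borel"
    and boundary: "has_boundary_values F F0"
begin

lemma boundary_sequence: "AE x in lborel. (\<lambda>n. F (Complex x (inverse (real (Suc n))))) \<longlonglongrightarrow> F0 x"
  using boundary unfolding has_boundary_values_def
  by eventually_elim (rule filterlim_compose[OF _ inverse_Suc_at_right])

lemma integrable_F0: "integrable lborel F0"
proof -
  have "(\<integral>\<^sup>+x. ennreal (norm (F0 x)) \<partial>lborel)
      = (\<integral>\<^sup>+x. liminf (\<lambda>n. ennreal (norm (F (Complex x (inverse (real (Suc n))))))) \<partial>lborel)"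
  proof (rule nn_integral_cong_AE)
    show "AE x in lborel. ennreal (norm (F0 x)) = liminf (\<lambda>n. ennreal (norm (F (Complex x (inverse (real (Suc n)))))))"
      using boundary_sequence
    proof eventually_elim
      case (elim x)
      then have "(\<lambda>n. ennreal (norm (F (Complex x (inverse (real (Suc n))))))) \<longlonglongrightarrow> ennreal (norm (F0 x))"
        by (intro tendsto_ennrealI tendsto_norm)
      from lim_imp_Liminf[OF _ this] show ?case by simp
    qed
  qed
  also have "\<dots> \<le> liminf (\<lambda>n. \<integral>\<^sup>+x. ennreal (norm (F (Complex x (inverse (real (Suc n)))))) \<partial>lborel)"
    by (intro nn_integral_liminf) (use measurable_slice in measurable)
  also have "\<dots> \<le> ennreal B"
    by (intro Liminf_le always_eventually allI bound) simp_all
  finally show ?thesis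
    unfolding integrable_iff_bounded by (auto simp: less_top[symmetric] top_unique)
qed

text \<open>The step from horizontal lines to the real line. The square roots \<open>w\<close> of \<open>|F|\<close> on these lines are
bounded in \<open>L\<^sup>2\<close>, and the inequality \<open>w \<le> min w K + w\<^sup>2 / K\<close> shows that truncating them at a large \<open>K\<close>
changes their Poisson integrals only slightly. Dominated convergence applies to the truncations.\<close>
lemma sqrt_norm_le_poisson:
  assumes z: "Im z > 0"
  shows "ennreal (sqrt (norm (F z))) \<le>
    (\<integral>\<^sup>+t. ennreal (poisson_kernel z t * sqrt (norm (F0 t))) \<partial>lborel)"
proof (rule ennreal_le_epsilon)
  fix \<epsilon> :: real assume \<epsilon>: "\<epsilon> > 0"
  \<comment> \<open>With this level the truncation error \<open>B / (pi * Im z * K)\<close> is less than \<open>\<epsilon>\<close>.\<close>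
  define K where "K = (B + 1) / (pi * Im z * \<epsilon>)"
  have K: "K > 0" using z \<epsilon> B_nonneg by (simp add: K_def)
  define e where "e n = inverse (real (Suc n))" for n
  have e: "e n > 0" for n by (simp add: e_def)
  note [measurable] = measurable_slice[OF e]
  have P0: "poisson_kernel z t \<ge> 0" for t using poisson_kernel_nonneg[OF z] .
  let ?I = "\<lambda>g. \<integral>\<^sup>+t. ennreal (poisson_kernel z t * min (sqrt (norm (g t))) K) \<partial>lborel"
  have "(\<lambda>n. ?I (\<lambda>t. F (Complex t (e n)))) \<longlonglongrightarrow> ?I F0"
  proof (rule nn_integral_dominated_convergence)
    show "AE t in lborel. ennreal (poisson_kernel z t * min (sqrt (norm (F (Complex t (e n))))) K)
      \<le> ennreal (K * poisson_kernel z t)" for n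
      using P0 K by (intro AE_I2 ennreal_leI) (simp add: mult.commute[of K] mult_left_mono)
    show "(\<integral>\<^sup>+ t. ennreal (K * poisson_kernel z t) \<partial>lborel) < \<infinity>"
      using K P0 nn_integral_poisson_kernel[OF z] by (simp add: ennreal_mult nn_integral_cmult)
    show "AE t in lborel. (\<lambda>n. ennreal (poisson_kernel z t * min (sqrt (norm (F (Complex t (e n))))) K))
      \<longlonglongrightarrow> ennreal (poisson_kernel z t * min (sqrt (norm (F0 t))) K)"
      using boundary_sequence
      by eventually_elim (intro tendsto_ennrealI tendsto_intros, simp add: e_def)
  qed measurable
  then have lim: "(\<lambda>n. ?I (\<lambda>t. F (Complex t (e n))) + ennreal \<epsilon>) \<longlonglongrightarrow> ?I F0 + ennreal \<epsilon>"
    by (intro tendsto_add tendsto_const)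
  have "(\<lambda>n. F (z + \<i> * of_real (e n))) \<longlonglongrightarrow> F z"
    unfolding e_def by (rule shift_tendsto[OF z])
  then have lim': "(\<lambda>n. ennreal (sqrt (norm (F (z + \<i> * of_real (e n)))))) \<longlonglongrightarrow> ennreal (sqrt (norm (F z)))"
    by (intro tendsto_ennrealI tendsto_real_sqrt tendsto_norm)
  have split: "w \<le> min w K + w\<^sup>2 / K" if "w \<ge> 0" for w :: real
  proof (cases "w \<le> K")
    case False
    then have "w * K \<le> w * w" using that by (intro mult_left_mono) auto
    then have "w \<le> w\<^sup>2 / K" using K by (simp add: pos_le_divide_eq power2_eq_square)
    then show ?thesis using K by (simp add: min_def)
  qed (use K in auto)
  have "ennreal (sqrt (norm (F (z + \<i> * of_real (e n))))) \<le> ?I (\<lambda>t. F (Complex t (e n))) + ennreal \<epsilon>" for n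
  proof -
    have "ennreal (sqrt (norm (F (z + \<i> * of_real (e n)))))
        \<le> (\<integral>\<^sup>+t. ennreal (poisson_kernel z t * sqrt (norm (F (Complex t (e n))))) \<partial>lborel)"
      by (rule sqrt_norm_shift_le_poisson[OF z e])
    also have "\<dots> \<le> (\<integral>\<^sup>+t. ennreal (poisson_kernel z t * min (sqrt (norm (F (Complex t (e n))))) K)
         + ennreal (1 / (pi * Im z * K)) * ennreal (norm (F (Complex t (e n)))) \<partial>lborel)"
    proof (rule nn_integral_mono)
      fix t
      let ?w = "sqrt (norm (F (Complex t (e n))))"
      have "poisson_kernel z t * ?w \<le> poisson_kernel z t * (min ?w K + ?w\<^sup>2 / K)"
        by (intro mult_left_mono split P0) simp
      also have "\<dots> = poisson_kernel z t * min ?w K + poisson_kernel z t * (?w\<^sup>2 / K)"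
        by (simp add: distrib_left)
      also have "\<dots> \<le> poisson_kernel z t * min ?w K + 1 / (pi * Im z) * (?w\<^sup>2 / K)"
        using K by (intro add_left_mono mult_right_mono poisson_kernel_le z) auto
      also have "1 / (pi * Im z) * (?w\<^sup>2 / K) = 1 / (pi * Im z * K) * norm (F (Complex t (e n)))"
        by simp
      finally show "ennreal (poisson_kernel z t * ?w) \<le> ennreal (poisson_kernel z t * min ?w K)
         + ennreal (1 / (pi * Im z * K)) * ennreal (norm (F (Complex t (e n))))"
        using P0 K z by (simp add: ennreal_mult[symmetric] ennreal_plus[symmetric] ennreal_leI del: ennreal_plus)
    qed
    also have "\<dots> = ?I (\<lambda>t. F (Complex t (e n)))
         + ennreal (1 / (pi * Im z * K)) * (\<integral>\<^sup>+t. ennreal (norm (F (Complex t (e n)))) \<partial>lborel)"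
      by (simp add: nn_integral_add nn_integral_cmult)
    also have "\<dots> \<le> ?I (\<lambda>t. F (Complex t (e n))) + ennreal (1 / (pi * Im z * K)) * ennreal B"
      by (intro add_left_mono mult_left_mono bound e) simp
    also have "ennreal (1 / (pi * Im z * K)) * ennreal B = ennreal (\<epsilon> * (B / (B + 1)))"
      using z \<epsilon> B_nonneg by (simp add: K_def ennreal_mult[symmetric])
    also have "\<dots> \<le> ennreal \<epsilon>"
      using \<epsilon> B_nonneg by (intro ennreal_leI mult_left_le) auto
    finally show ?thesis by (simp add: add_left_mono)
  qed
  then have "ennreal (sqrt (norm (F z))) \<le> ?I F0 + ennreal \<epsilon>"
    by (intro LIMSEQ_le[OF lim' lim]) auto
  also have "?I F0 \<le> (\<integral>\<^sup>+t. ennreal (poisson_kernel z t * sqrt (norm (F0 t))) \<partial>lborel)"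
    by (intro nn_integral_mono ennreal_leI mult_left_mono P0) simp
  finally show "ennreal (sqrt (norm (F z))) \<le>
    (\<integral>\<^sup>+t. ennreal (poisson_kernel z t * sqrt (norm (F0 t))) \<partial>lborel) + ennreal \<epsilon>"
    by (simp add: add_right_mono)
qed

text \<open>The Cauchy-Schwarz inequality for the probability density given by the Poisson kernel.\<close>
lemma norm_le_poisson:
  assumes z: "Im z > 0"
  shows "ennreal (norm (F z)) \<le> (\<integral>\<^sup>+t. ennreal (poisson_kernel z t * norm (F0 t)) \<partial>lborel)"
proof -
  have "ennreal (sqrt (norm (F z)) powr 2) \<le> ennreal (1 powr (2 - 1)) *
     (ennreal (0 * 0 powr 2) + (\<integral>\<^sup>+t. ennreal (poisson_kernel z t * sqrt (norm (F0 t)) powr 2) \<partial>lborel))"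
    by (rule weighted_power_mean)
      (use sqrt_norm_le_poisson[OF z] nn_integral_poisson_kernel[OF z] poisson_kernel_nonneg[OF z] in auto)
  then show ?thesis
    by (simp add: powr_numeral)
qed

lemma nn_integral_slice_le:
  assumes y: "y > 0"
  shows "(\<integral>\<^sup>+x. ennreal (norm (F (Complex x y))) \<partial>lborel) \<le> (\<integral>\<^sup>+t. ennreal (norm (F0 t)) \<partial>lborel)"
proof -
  have P0: "poisson_kernel (Complex x y) t \<ge> 0" for x t using y by (simp add: poisson_kernel_nonneg)
  have [measurable]: "(\<lambda>(x, t). poisson_kernel (Complex x y) t) \<in> borel_measurable (borel \<Otimes>\<^sub>M borel)"
    unfolding poisson_kernel_eq by measurable
  have "(\<integral>\<^sup>+x. ennreal (norm (F (Complex x y))) \<partial>lborel)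
    \<le> (\<integral>\<^sup>+x. \<integral>\<^sup>+t. ennreal (poisson_kernel (Complex x y) t * norm (F0 t)) \<partial>lborel \<partial>lborel)"
    by (intro nn_integral_mono norm_le_poisson) (simp add: y)
  also have "\<dots> = (\<integral>\<^sup>+t. \<integral>\<^sup>+x. ennreal (poisson_kernel (Complex x y) t * norm (F0 t)) \<partial>lborel \<partial>lborel)"
    by (rule lborel_pair.Fubini') measurable
  also have "\<dots> = (\<integral>\<^sup>+t. ennreal (norm (F0 t)) * (\<integral>\<^sup>+x. ennreal (poisson_kernel (Complex t y) x) \<partial>lborel) \<partial>lborel)"
    using P0 by (intro nn_integral_cong)
      (simp add: ennreal_mult nn_integral_cmult mult.commute poisson_kernel_swap[of _ y])
  also have "\<dots> = (\<integral>\<^sup>+t. ennreal (norm (F0 t)) \<partial>lborel)"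
    using y by (simp add: nn_integral_poisson_kernel)
  finally show ?thesis .
qed

text \<open>The Poisson kernel has mass one in either variable, so no horizontal line carries more mass than the
boundary values. Scheffe's lemma turns this and pointwise convergence into convergence in mean.\<close>
lemma slices_converge_L1:
  "(\<lambda>n. \<integral>x. norm (F (Complex x (inverse (real (Suc n)))) - F0 x) \<partial>lborel) \<longlonglongrightarrow> 0"
proof -
  let ?d = "\<lambda>n x. F (Complex x (inverse (real (Suc n)))) - F0 x"
  have int: "integrable lborel (?d n)" for n
    using integrable_slice integrable_F0 by simp
  have "(\<lambda>n. \<integral>\<^sup>+x. ennreal (norm (?d n x)) \<partial>lborel) \<longlonglongrightarrow> 0"
    by (rule Scheffe_lemma1)
      (use integrable_slice integrable_F0 boundary_sequence in
        \<open>auto intro!: Limsup_bounded always_eventually nn_integral_slice_le\<close>)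
  then have "(\<lambda>n. enn2real (\<integral>\<^sup>+x. ennreal (norm (?d n x)) \<partial>lborel)) \<longlonglongrightarrow> enn2real 0"
    by (intro tendsto_enn2real) auto
  moreover have "enn2real (\<integral>\<^sup>+x. ennreal (norm (?d n x)) \<partial>lborel) = (\<integral>x. norm (?d n x) \<partial>lborel)" for n
    using int[of n] by (intro integral_eq_nn_integral[symmetric]) auto
  ultimately show ?thesis by simp
qed

lemma integral_bounded_multiplier_limit:
  assumes [measurable]: "k \<in> borel_measurable borel" and k: "\<And>t. norm (k t) \<le> K"
  shows "(\<lambda>n. \<integral>t. F (Complex t (inverse (real (Suc n)))) * k t \<partial>lborel) \<longlonglongrightarrow> (\<integral>t. F0 t * k t \<partial>lborel)"
proof (rule LIM_zero_cancel, rule Lim_null_comparison)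
  have K: "K \<ge> 0" using order_trans[OF norm_ge_zero k] .
  let ?d = "\<lambda>n x. F (Complex x (inverse (real (Suc n)))) - F0 x"
  have int: "integrable lborel (?d n)" for n
    using integrable_slice integrable_F0 by simp
  have intk: "integrable lborel (\<lambda>t. g t * k t)" if g: "integrable lborel g" for g :: "real \<Rightarrow> complex"
  proof (rule Bochner_Integration.integrable_bound)
    have [measurable]: "g \<in> borel_measurable borel" using g by auto
    show "integrable lborel (\<lambda>t. g t * of_real K)" using g by simp
    show "AE t in lborel. norm (g t * k t) \<le> norm (g t * of_real K)"
      using k K by (auto simp: norm_mult intro!: mult_left_mono)
    show "(\<lambda>t. g t * k t) \<in> borel_measurable lborel" by measurable
  qed
  show "(\<lambda>n. (\<integral>x. norm (?d n x) \<partial>lborel) * K) \<longlonglongrightarrow> 0"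
    using tendsto_mult_left_zero[OF slices_converge_L1] .
  show "\<forall>\<^sub>F n in sequentially. norm ((\<integral>t. F (Complex t (inverse (real (Suc n)))) * k t \<partial>lborel) - (\<integral>t. F0 t * k t \<partial>lborel))
     \<le> (\<integral>x. norm (?d n x) \<partial>lborel) * K"
  proof (intro always_eventually allI)
    fix n
    have "(\<integral>t. F (Complex t (inverse (real (Suc n)))) * k t \<partial>lborel) - (\<integral>t. F0 t * k t \<partial>lborel)
       = (\<integral>t. ?d n t * k t \<partial>lborel)"
      using intk[OF integrable_slice[of "inverse (real (Suc n))"]] intk[OF integrable_F0]
      by (simp add: left_diff_distrib)
    also have "norm \<dots> \<le> (\<integral>t. norm (?d n t * k t) \<partial>lborel)"
      by (rule integral_norm_bound)
    also have "\<dots> \<le> (\<integral>t. norm (?d n t) * K \<partial>lborel)"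
      using int[of n] k K by (intro integral_mono_AE' AE_I2) (auto simp: norm_mult intro!: mult_left_mono)
    finally show "norm ((\<integral>t. F (Complex t (inverse (real (Suc n)))) * k t \<partial>lborel) - (\<integral>t. F0 t * k t \<partial>lborel))
     \<le> (\<integral>x. norm (?d n x) \<partial>lborel) * K" by simp
  qed
qed

text \<open>A Cauchy formula with kernel \<open>k\<close> for all damped shifted functions is inherited by the boundary values:
the damping is removed on each horizontal line, and the line is lowered to the real one. The constant \<open>c\<close>
is zero in the cases where the integrals vanish.\<close>
lemma integral_boundary_from_damped:
  assumes z: "Im z > 0" and k_meas: "k \<in> borel_measurable borel" and k: "\<And>t. norm (k t) \<le> K"
    and damped: "\<And>e n. e > 0 \<Longrightarrow> n \<ge> 1 \<Longrightarrow>
      (\<integral>t. F (of_real t + \<i> * of_real e) * damping n (of_real t) ^ 2 * k t \<partial>lborel)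
        = c * (F (z + \<i> * of_real e) * damping n z ^ 2)"
  shows "(\<integral>t. F0 t * k t \<partial>lborel) = c * F z"
proof -
  have slice: "(\<integral>t. F (Complex t e) * k t \<partial>lborel) = c * F (z + \<i> * of_real e)" if e: "e > 0" for e
  proof (rule LIMSEQ_unique[OF damped_integral_limit[OF e k_meas k]])
    let ?a = "\<lambda>n. \<integral>t. F (of_real t + \<i> * of_real e) * damping n (of_real t) ^ 2 * k t \<partial>lborel"
    have ev: "\<forall>\<^sub>F n in sequentially. c * (F (z + \<i> * of_real e) * damping n z ^ 2) = ?a n"
      using damped[OF e] by (intro eventually_mono[OF eventually_ge_at_top[of 1]]) (rule sym)
    have "(\<lambda>n. c * (F (z + \<i> * of_real e) * damping n z ^ 2)) \<longlonglongrightarrow> c * (F (z + \<i> * of_real e) * 1 ^ 2)"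
      by (intro tendsto_mult tendsto_power tendsto_const damping_tendsto)
    from Lim_transform_eventually[OF this ev] show "?a \<longlonglongrightarrow> c * F (z + \<i> * of_real e)"
      by simp
  qed
  have eq: "(\<lambda>n. \<integral>t. F (Complex t (inverse (real (Suc n)))) * k t \<partial>lborel)
      = (\<lambda>n. c * F (z + \<i> * of_real (inverse (real (Suc n)))))"
    by (intro ext slice) simp
  have "(\<lambda>n. c * F (z + \<i> * of_real (inverse (real (Suc n))))) \<longlonglongrightarrow> c * F z"
    by (intro tendsto_mult tendsto_const shift_tendsto z)
  with integral_bounded_multiplier_limit[OF k_meas k] show ?thesis
    unfolding eq by (rule LIMSEQ_unique)
qed

lemma integral_boundary: "(\<integral>t. F0 t \<partial>lborel) = 0"
proof -
  have "(\<integral>t. F0 t * 1 \<partial>lborel) = 0 * F \<i>"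
    by (rule integral_boundary_from_damped)
      (use half_plane_decay.integral_boundary[OF damped_decay] in auto)
  then show ?thesis by simp
qed

lemma Cauchy_kernel_bounded: "Im z \<noteq> 0 \<Longrightarrow> norm (1 / (of_real t - z)) \<le> 1 / \<bar>Im z\<bar>"
  using norm_real_minus_ge[of z t] unfolding norm_divide by (intro frac_le) auto

lemma integral_Cauchy_kernel_upper:
  assumes z: "Im z > 0"
  shows "(\<integral>t. F0 t / (of_real t - z) \<partial>lborel) = 2 * pi * \<i> * F z"
proof -
  have "(\<integral>t. F0 t * (1 / (of_real t - z)) \<partial>lborel) = (2 * pi * \<i>) * F z"
  proof (rule integral_boundary_from_damped[OF z _ Cauchy_kernel_bounded])
    show "(\<integral>t. F (of_real t + \<i> * of_real e) * damping n (of_real t) ^ 2 * (1 / (of_real t - z)) \<partial>lborel)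
        = (2 * pi * \<i>) * (F (z + \<i> * of_real e) * damping n z ^ 2)" if "e > 0" "n \<ge> 1" for e n
      using half_plane_decay.integral_Cauchy_kernel_upper[OF damped_decay[OF that] z] by simp
  qed (use z in simp_all)
  then show ?thesis by simp
qed

lemma integral_Cauchy_kernel_lower:
  assumes z: "Im z < 0"
  shows "(\<integral>t. F0 t / (of_real t - z) \<partial>lborel) = 0"
proof -
  have "(\<integral>t. F0 t * (1 / (of_real t - z)) \<partial>lborel) = 0 * F \<i>"
  proof (rule integral_boundary_from_damped[OF _ _ Cauchy_kernel_bounded])
    show "(\<integral>t. F (of_real t + \<i> * of_real e) * damping n (of_real t) ^ 2 * (1 / (of_real t - z)) \<partial>lborel)
        = 0 * (F (\<i> + \<i> * of_real e) * damping n \<i> ^ 2)" if "e > 0" "n \<ge> 1" for e n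
      using half_plane_decay.integral_Cauchy_kernel_lower[OF damped_decay[OF that] z] by simp
  qed (use z in simp_all)
  then show ?thesis by simp
qed

end

section \<open>Quadratically decaying kernels against boundary values\<close>

text \<open>The division by \<open>(z + \<i>)\<^sup>2\<close> makes one class out of all the functions that are needed: the Hardy spaces
with exponent at least one, bounded functions, and products of a Hardy function with an inner function.
Everything about them reduces to \<open>H\<^sup>1\<close>, and kernels that decay quadratically can be integrated against
their boundary values.\<close>
locale weighted_hardy =
  fixes g :: "complex \<Rightarrow> complex" and B :: real and g0 :: "real \<Rightarrow> complex"
  assumes holo: "g holomorphic_on {z. Im z > 0}"
    and B_nonneg: "B \<ge> 0"
    and bound: "\<And>y. y > 0 \<Longrightarrow> (\<integral>\<^sup>+x. ennreal (norm (g (Complex x y) / (Complex x y + \<i>)\<^sup>2)) \<partial>lborel) \<le> ennreal B"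
    and measurable_g0 [measurable]: "g0 \<in> borel_measurable borel"
    and boundary: "has_boundary_values g g0"

sublocale weighted_hardy \<subseteq> H: hardy1_boundary "\<lambda>z. g z / (z + \<i>)\<^sup>2" B "\<lambda>t. g0 t / (of_real t + \<i>)\<^sup>2"
proof
  have "z + \<i> \<noteq> 0" if "Im z > 0" for z
    using that by (auto simp: complex_eq_iff)
  then show "(\<lambda>z. g z / (z + \<i>)\<^sup>2) holomorphic_on {z. Im z > 0}"
    by (intro holomorphic_intros holo) auto
  show "has_boundary_values (\<lambda>z. g z / (z + \<i>)\<^sup>2) (\<lambda>t. g0 t / (of_real t + \<i>)\<^sup>2)"
    using boundary unfolding has_boundary_values_def
  proof eventually_elim
    case (elim x)
    have ne: "of_real x + \<i> \<noteq> 0" by (auto simp: complex_eq_iff)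
    have "((\<lambda>y. Complex x y + \<i>) \<longlongrightarrow> Complex x 0 + \<i>) (at_right 0)"
      by (intro tendsto_intros)
    then show ?case
      using ne by (intro tendsto_divide elim tendsto_power) (auto simp: Complex_0_eq)
  qed
qed (use B_nonneg bound in auto)

lemma real_plus_i_nonzero: "of_real t + \<i> \<noteq> 0"
  by (auto simp: complex_eq_iff)

lemma real_minus_nonreal_nonzero: "Im a \<noteq> 0 \<Longrightarrow> of_real t - a \<noteq> 0"
  by (auto simp: complex_eq_iff)

context weighted_hardy begin

text \<open>Up to constants this is the Cauchy integral of the boundary values, which vanishes in the lower
half-plane. It makes the next formula uniform in the positions of the two poles.\<close>
definition extension :: "complex \<Rightarrow> complex"
  where "extension z = (if Im z > 0 then g z else 0)"

lemma integrable_weight: "integrable lborel (\<lambda>t. g0 t / (of_real t + \<i>)\<^sup>2)"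
  by (rule H.integrable_F0)

lemma integral_Cauchy_kernel:
  assumes "Im a \<noteq> 0"
  shows "(\<integral>t. g0 t / (of_real t + \<i>)\<^sup>2 / (of_real t - a) \<partial>lborel) = 2 * pi * \<i> * extension a / (a + \<i>)\<^sup>2"
  using assms H.integral_Cauchy_kernel_upper[of a] H.integral_Cauchy_kernel_lower[of a]
  by (cases "Im a > 0") (auto simp: extension_def)

text \<open>Partial fractions express \<open>(t + \<i>)\<^sup>2 / ((t - a)(t - b))\<close> through a constant and the two Cauchy kernels,
to which the formulas for \<open>H\<^sup>1\<close> apply. Taking \<open>a\<close> and \<open>b\<close> conjugate gives the Poisson formula.\<close>
lemma integral_two_kernels:
  assumes a: "Im a \<noteq> 0" and b: "Im b \<noteq> 0" and ab: "a \<noteq> b"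
  shows "integrable lborel (\<lambda>t. g0 t / ((of_real t - a) * (of_real t - b)))" (is ?int)
    and "(\<integral>t. g0 t / ((of_real t - a) * (of_real t - b)) \<partial>lborel)
      = 2 * pi * \<i> * ((extension a - extension b) / (a - b))" (is ?val)
proof -
  let ?F = "\<lambda>t. g0 t / (of_real t + \<i>)\<^sup>2"
  have eq: "g0 t / ((of_real t - a) * (of_real t - b))
    = ?F t + ((a + \<i>)\<^sup>2 / (a - b)) * (?F t / (of_real t - a)) - ((b + \<i>)\<^sup>2 / (a - b)) * (?F t / (of_real t - b))" for t
  proof -
    let ?T = "complex_of_real t"
    note ne = real_plus_i_nonzero[of t] real_minus_nonreal_nonzero[OF a, of t] real_minus_nonreal_nonzero[OF b, of t]
    have "(?T + \<i>)\<^sup>2 / ((?T - a) * (?T - b)) = 1 + (a + \<i>)\<^sup>2 / (a - b) / (?T - a) - (b + \<i>)\<^sup>2 / (a - b) / (?T - b)"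
      using ne ab by (simp add: divide_simps) (simp add: algebra_simps power2_eq_square)
    then have "?F t * ((?T + \<i>)\<^sup>2 / ((?T - a) * (?T - b)))
       = ?F t * (1 + (a + \<i>)\<^sup>2 / (a - b) / (?T - a) - (b + \<i>)\<^sup>2 / (a - b) / (?T - b))" by simp
    then show ?thesis using ne by (simp add: ring_distribs mult_ac)
  qed
  note int = integrable_weight integrable_Cauchy_kernel[OF integrable_weight a] integrable_Cauchy_kernel[OF integrable_weight b]
  show ?int unfolding eq
    by (intro Bochner_Integration.integrable_add Bochner_Integration.integrable_diff integrable_mult_right int)
  have "extension a = 0" if "a = -\<i>" using that by (simp add: extension_def)
  then have A: "(a + \<i>)\<^sup>2 * (extension a / (a + \<i>)\<^sup>2) = extension a"
    by (cases "a = -\<i>") (auto simp: add_eq_0_iff2)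
  have "extension b = 0" if "b = -\<i>" using that by (simp add: extension_def)
  then have B: "(b + \<i>)\<^sup>2 * (extension b / (b + \<i>)\<^sup>2) = extension b"
    by (cases "b = -\<i>") (auto simp: add_eq_0_iff2)
  have regroup: "0 + x / d * (c * u / x) - y / d * (c * v / y) = c * ((x * (u / x)) / d - (y * (v / y)) / d)"
    for c d u v x y :: complex
    by (cases "x = 0"; cases "y = 0") (auto simp: divide_simps, simp_all add: algebra_simps)
  have "(\<integral>t. g0 t / ((of_real t - a) * (of_real t - b)) \<partial>lborel)
    = (\<integral>t. ?F t \<partial>lborel) + ((a + \<i>)\<^sup>2 / (a - b)) * (\<integral>t. ?F t / (of_real t - a) \<partial>lborel)
       - ((b + \<i>)\<^sup>2 / (a - b)) * (\<integral>t. ?F t / (of_real t - b) \<partial>lborel)"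
    unfolding eq by (simp only: int Bochner_Integration.integral_add Bochner_Integration.integral_diff
      Bochner_Integration.integrable_add integrable_mult_right integral_mult_right_zero simp_thms)
  also have "\<dots> = 2 * pi * \<i> * (((a + \<i>)\<^sup>2 * (extension a / (a + \<i>)\<^sup>2)) / (a - b) - ((b + \<i>)\<^sup>2 * (extension b / (b + \<i>)\<^sup>2)) / (a - b))"
    unfolding integral_Cauchy_kernel[OF a] integral_Cauchy_kernel[OF b] H.integral_boundary
    by (rule regroup)
  finally show ?val
    unfolding A B by (simp add: diff_divide_distrib)
qed

text \<open>The same partial fractions with a double pole; the additional term is the derivative of a Cauchy
transform, which is known on both sides of the real line.\<close>
lemma integral_double_kernel:
  assumes a: "Im a \<noteq> 0"
  shows "integrable lborel (\<lambda>t. g0 t / (of_real t - a)\<^sup>2)" (is ?int)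
    and "(\<integral>t. g0 t / (of_real t - a)\<^sup>2 \<partial>lborel) = (if Im a > 0 then 2 * pi * \<i> * deriv g a else 0)" (is ?val)
proof -
  let ?F = "\<lambda>t. g0 t / (of_real t + \<i>)\<^sup>2"
  let ?c = "2 * complex_of_real pi * \<i>"
  have eq: "g0 t / (of_real t - a)\<^sup>2
    = ?F t + (2 * (a + \<i>)) * (?F t / (of_real t - a)) + (a + \<i>)\<^sup>2 * (?F t / (of_real t - a)\<^sup>2)" for t
  proof -
    let ?T = "complex_of_real t"
    note ne = real_plus_i_nonzero[of t] real_minus_nonreal_nonzero[OF a, of t]
    have "(?T + \<i>)\<^sup>2 / (?T - a)\<^sup>2 = 1 + 2 * (a + \<i>) / (?T - a) + (a + \<i>)\<^sup>2 / (?T - a)\<^sup>2"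
      using ne by (simp add: divide_simps power2_eq_square) (simp add: algebra_simps)
    then have "?F t * ((?T + \<i>)\<^sup>2 / (?T - a)\<^sup>2)
       = ?F t * (1 + 2 * (a + \<i>) / (?T - a) + (a + \<i>)\<^sup>2 / (?T - a)\<^sup>2)" by simp
    then show ?thesis using ne by (simp add: ring_distribs mult_ac)
  qed
  have int2: "integrable lborel (\<lambda>t. ?F t / (of_real t - a)\<^sup>2)"
    using integrable_Cauchy_kernel[OF integrable_Cauchy_kernel[OF integrable_weight a] a]
    by (simp add: power2_eq_square mult.assoc)
  note int = integrable_weight integrable_Cauchy_kernel[OF integrable_weight a] int2
  show ?int unfolding eq
    by (intro Bochner_Integration.integrable_add Bochner_Integration.integrable_diff integrable_mult_right int)
  have val: "(\<integral>t. g0 t / (of_real t - a)\<^sup>2 \<partial>lborel)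
    = (2 * (a + \<i>)) * (?c * extension a / (a + \<i>)\<^sup>2) + (a + \<i>)\<^sup>2 * (\<integral>t. ?F t / (of_real t - a)\<^sup>2 \<partial>lborel)"
    unfolding eq by (simp only: int Bochner_Integration.integral_add
      Bochner_Integration.integrable_add integrable_mult_right integral_mult_right_zero simp_thms
      H.integral_boundary integral_Cauchy_kernel[OF a] add_0_left of_real_mult of_real_numeral)
  have D: "((\<lambda>z. \<integral>t. ?F t / (of_real t - z) \<partial>lborel) has_field_derivative
     (\<integral>t. ?F t / (of_real t - a)\<^sup>2 \<partial>lborel)) (at a)"
    by (rule has_field_derivative_Cauchy_transform[OF integrable_weight a])
  show ?val
  proof (cases "Im a > 0")
    case True
    have ai: "a + \<i> \<noteq> 0" using True by (auto simp: complex_eq_iff)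
    have "((\<lambda>z. ?c * (g z / (z + \<i>)\<^sup>2)) has_field_derivative
     (\<integral>t. ?F t / (of_real t - a)\<^sup>2 \<partial>lborel)) (at a)"
      using D open_half_plane[of 0]
      by (rule has_field_derivative_transform_within_open) (use True H.integral_Cauchy_kernel_upper in simp_all)
    moreover have "(g has_field_derivative deriv g a) (at a)"
      using holo True open_half_plane by (intro holomorphic_derivI) auto
    then have "((\<lambda>z. ?c * (g z / (z + \<i>)\<^sup>2)) has_field_derivative
      ?c * ((deriv g a * (a + \<i>)\<^sup>2 - g a * (2 * (a + \<i>))) / ((a + \<i>)\<^sup>2 * (a + \<i>)\<^sup>2))) (at a)"
      using ai by (auto intro!: derivative_eq_intros simp: power2_eq_square right_diff_distrib mult_ac)
    ultimately have J: "(\<integral>t. ?F t / (of_real t - a)\<^sup>2 \<partial>lborel)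
       = ?c * ((deriv g a * (a + \<i>)\<^sup>2 - g a * (2 * (a + \<i>))) / ((a + \<i>)\<^sup>2 * (a + \<i>)\<^sup>2))"
      by (rule DERIV_unique)
    have "2 * s * (c * G / s\<^sup>2) + s\<^sup>2 * (c * ((D * s\<^sup>2 - G * (2 * s)) / (s\<^sup>2 * s\<^sup>2))) = c * D"
      if "s \<noteq> 0" for c D G s :: complex
      using that by (simp add: field_simps power2_eq_square)
    from this[OF ai] show ?thesis
      unfolding val J using True by (simp add: extension_def)
  next
    case False
    have "((\<lambda>z. 0) has_field_derivative (\<integral>t. ?F t / (of_real t - a)\<^sup>2 \<partial>lborel)) (at a)"
      using D open_halfspace_Im_lt[of 0]
      by (rule has_field_derivative_transform_within_open) (use False a H.integral_Cauchy_kernel_lower in simp_all)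
    then have "(\<integral>t. ?F t / (of_real t - a)\<^sup>2 \<partial>lborel) = 0"
      using DERIV_const[of 0 "at a"] by (rule DERIV_unique)
    then show ?thesis
      unfolding val using False by (simp add: extension_def)
  qed
qed

end

lemma norm_weight_le:
  assumes "y > 0" shows "1 + x\<^sup>2 \<le> norm ((Complex x y + \<i>)\<^sup>2)"
proof -
  have "norm ((Complex x y + \<i>)\<^sup>2) = x\<^sup>2 + (y + 1)\<^sup>2"
    by (simp add: norm_power cmod_power2)
  moreover have "1 \<le> (y + 1)\<^sup>2"
    using assms by (simp add: power2_eq_square algebra_simps)
  ultimately show ?thesis by simp
qed

lemma weighted_bound_bounded:
  assumes K: "\<And>z. Im z > 0 \<Longrightarrow> norm (g z) \<le> K" and y: "y > 0"
  shows "(\<integral>\<^sup>+x. ennreal (norm (g (Complex x y) / (Complex x y + \<i>)\<^sup>2)) \<partial>lborel) \<le> ennreal (K * pi)"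
proof -
  have K0: "K \<ge> 0" using order_trans[OF norm_ge_zero K[of \<i>]] by simp
  have "(\<integral>\<^sup>+x. ennreal (norm (g (Complex x y) / (Complex x y + \<i>)\<^sup>2)) \<partial>lborel)
    \<le> (\<integral>\<^sup>+x. ennreal (K * (1 / (1 + x\<^sup>2))) \<partial>lborel)"
  proof (intro nn_integral_mono ennreal_leI)
    fix x
    have "norm (g (Complex x y)) / norm ((Complex x y + \<i>)\<^sup>2) \<le> K / (1 + x\<^sup>2)"
      using K0 y K norm_weight_le[OF y] by (intro frac_le) (auto simp: add_pos_nonneg)
    then show "norm (g (Complex x y) / (Complex x y + \<i>)\<^sup>2) \<le> K * (1 / (1 + x\<^sup>2))"
      by (simp add: norm_divide)
  qed
  also have "\<dots> = ennreal (\<integral>x. K * (1 / (1 + x\<^sup>2)) \<partial>lborel)"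
    using K0 by (intro nn_integral_eq_integral integrable_mult_right integrable_inverse_one_plus_square) auto
  also have "\<dots> = ennreal (K * pi)"
    unfolding integral_mult_right_zero integral_inverse_one_plus_square ..
  finally show ?thesis .
qed

lemma weighted_bound_hardy_space:
  assumes f: "f \<in> hardy_space p" and p: "1 \<le> p"
  obtains B where "B \<ge> 0"
    "\<And>y. y > 0 \<Longrightarrow> (\<integral>\<^sup>+x. ennreal (norm (f (Complex x y) / (Complex x y + \<i>)\<^sup>2)) \<partial>lborel) \<le> ennreal B"
proof -
  obtain A where A: "A \<ge> 0"
    "\<And>y. y > 0 \<Longrightarrow> (\<integral>\<^sup>+x. ennreal (norm (f (Complex x y)) powr p) \<partial>lborel) \<le> ennreal A"
    by (rule hardy_space_bound[OF f]) blast
  show ?thesis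
  proof (rule that[of "A + pi"])
    show "A + pi \<ge> 0" using A by simp
    fix y :: real assume y: "y > 0"
    have [measurable]: "(\<lambda>x. f (Complex x y)) \<in> borel_measurable borel"
      using hardy_space_holomorphic[OF f] y by (rule holomorphic_slice_measurable)
    have "(\<integral>\<^sup>+x. ennreal (norm (f (Complex x y) / (Complex x y + \<i>)\<^sup>2)) \<partial>lborel)
      \<le> (\<integral>\<^sup>+x. ennreal (norm (f (Complex x y)) powr p) + ennreal (1 / (1 + x\<^sup>2)) \<partial>lborel)"
    proof (rule nn_integral_mono)
      fix x
      let ?u = "norm (f (Complex x y))"
      have u: "?u \<le> ?u powr p + 1"
        using powr_mono[of 1 p ?u] p by (cases "?u \<ge> 1") (auto simp: add_increasing)
      have "?u / norm ((Complex x y + \<i>)\<^sup>2) \<le> (?u powr p + 1) / (1 + x\<^sup>2)"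
        using u y norm_weight_le[OF y] by (intro frac_le) (auto simp: add_pos_nonneg)
      also have "\<dots> = ?u powr p / (1 + x\<^sup>2) + 1 / (1 + x\<^sup>2)"
        by (simp add: add_divide_distrib)
      also have "?u powr p / (1 + x\<^sup>2) \<le> ?u powr p / 1"
        by (intro divide_left_mono) (auto simp: add_pos_nonneg)
      finally show "ennreal (norm (f (Complex x y) / (Complex x y + \<i>)\<^sup>2)) \<le> ennreal (?u powr p) + ennreal (1 / (1 + x\<^sup>2))"
        by (simp add: norm_divide ennreal_leI flip: ennreal_plus)
    qed
    also have "\<dots> = (\<integral>\<^sup>+x. ennreal (norm (f (Complex x y)) powr p) \<partial>lborel) + (\<integral>\<^sup>+x. ennreal (1 / (1 + x\<^sup>2)) \<partial>lborel)"
      by (intro nn_integral_add) measurable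
    also have "(\<integral>\<^sup>+x. ennreal (1 / (1 + x\<^sup>2)) \<partial>lborel) = ennreal pi"
      using integrable_inverse_one_plus_square integral_inverse_one_plus_square
      by (subst nn_integral_eq_integral) auto
    also have "(\<integral>\<^sup>+x. ennreal (norm (f (Complex x y)) powr p) \<partial>lborel) + ennreal pi \<le> ennreal A + ennreal pi"
      by (intro add_right_mono A y)
    finally show "(\<integral>\<^sup>+x. ennreal (norm (f (Complex x y) / (Complex x y + \<i>)\<^sup>2)) \<partial>lborel) \<le> ennreal (A + pi)"
      using A by simp
  qed
qed

lemma weighted_bound_mult:
  assumes "\<And>y. y > 0 \<Longrightarrow> (\<integral>\<^sup>+x. ennreal (norm (f (Complex x y) / (Complex x y + \<i>)\<^sup>2)) \<partial>lborel) \<le> ennreal B"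
    and K: "\<And>z. Im z > 0 \<Longrightarrow> norm (g z) \<le> K" and y: "y > 0" and f: "f holomorphic_on {z. Im z > 0}"
  shows "(\<integral>\<^sup>+x. ennreal (norm (f (Complex x y) * g (Complex x y) / (Complex x y + \<i>)\<^sup>2)) \<partial>lborel) \<le> ennreal (K * B)"
proof -
  have K0: "K \<ge> 0" using order_trans[OF norm_ge_zero K[of \<i>]] by simp
  have [measurable]: "(\<lambda>x. f (Complex x y)) \<in> borel_measurable borel"
    using f y by (rule holomorphic_slice_measurable)
  have [measurable]: "(\<lambda>x. Complex x y) \<in> borel_measurable borel"
    by (intro borel_measurable_continuous_onI continuous_intros)
  have "(\<integral>\<^sup>+x. ennreal (norm (f (Complex x y) * g (Complex x y) / (Complex x y + \<i>)\<^sup>2)) \<partial>lborel)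
    \<le> (\<integral>\<^sup>+x. ennreal K * ennreal (norm (f (Complex x y) / (Complex x y + \<i>)\<^sup>2)) \<partial>lborel)"
  proof (rule nn_integral_mono)
    fix x
    have "norm (f (Complex x y)) * norm (g (Complex x y)) / norm ((Complex x y + \<i>)\<^sup>2)
       \<le> norm (f (Complex x y)) * K / norm ((Complex x y + \<i>)\<^sup>2)"
      using y by (intro divide_right_mono mult_left_mono K) auto
    then show "ennreal (norm (f (Complex x y) * g (Complex x y) / (Complex x y + \<i>)\<^sup>2))
       \<le> ennreal K * ennreal (norm (f (Complex x y) / (Complex x y + \<i>)\<^sup>2))"
      using K0 by (simp add: ennreal_mult[symmetric] norm_mult norm_divide mult_ac ennreal_leI)
  qed
  also have "\<dots> = ennreal K * (\<integral>\<^sup>+x. ennreal (norm (f (Complex x y) / (Complex x y + \<i>)\<^sup>2)) \<partial>lborel)"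
    by (rule nn_integral_cmult) measurable
  also have "\<dots> \<le> ennreal K * ennreal B"
    by (intro mult_left_mono assms(1) y) simp
  finally show ?thesis using K0 by (simp add: ennreal_mult')
qed

section \<open>Continuation of inner functions with bounded derivative\<close>

lemma Complex_tendsto_real: "((\<lambda>y. Complex x y) \<longlongrightarrow> complex_of_real x) (at_right 0)"
proof -
  have "((\<lambda>y. Complex x y) \<longlongrightarrow> Complex x 0) (at_right 0)"
    by (intro tendsto_intros)
  then show ?thesis by (simp add: Complex_0_eq)
qed

lemma eventually_Im_pos: "\<forall>\<^sub>F y in at_right 0. Im (Complex x y) > 0"
  by (simp add: eventually_at_right_less)

text \<open>A nonempty open set has positive Lebesgue measure.\<close>
lemma continuous_AE_constant:
  fixes \<phi> :: "real \<Rightarrow> real"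
  assumes cont: "continuous_on UNIV \<phi>" and ae: "AE x in lborel. \<phi> x = c"
  shows "\<phi> x = c"
proof -
  let ?S = "{x. \<phi> x \<noteq> c}"
  have op: "open ?S"
    using cont by (intro open_Collect_neq continuous_on_const)
  have "?S \<in> null_sets lborel"
    using ae op by (subst AE_iff_null_sets) auto
  then have "negligible ?S"
    by (simp add: negligible_iff_null_sets null_sets_completionI)
  with op have "?S = {}"
    using open_not_negligible by blast
  then show ?thesis by blast
qed

lemma is_continuationI:
  assumes holo: "f holomorphic_on {z. Im z > 0}"
    and near: "\<And>x. \<exists>r>0. g holomorphic_on ball (complex_of_real x) r"
    and upper: "\<And>z. Im z > 0 \<Longrightarrow> g z = f z"
    and lower: "\<And>z. Im z < 0 \<Longrightarrow> g z = q z" and q: "q meromorphic_on {z. Im z < 0}"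
  shows "is_continuation f g"
proof -
  have an: "g analytic_on \<real>"
    using near by (fastforce simp: analytic_on_def Reals_def)
  have "g meromorphic_on {z}" for z
  proof -
    consider "Im z > 0" | "Im z < 0" | "z \<in> \<real>"
      by (metis complex_is_Real_iff linorder_neqE_linordered_idom)
    then show ?thesis
    proof cases
      case 1
      have "g holomorphic_on {z. Im z > 0}"
        using upper holo by (subst holomorphic_cong[OF refl]) auto
      then have "g analytic_on {z}"
        using 1 open_half_plane by (auto simp: analytic_at)
      then show ?thesis by (rule analytic_on_imp_meromorphic_on)
    next
      case 2
      have "q meromorphic_on {z}"
        using q by (rule meromorphic_on_subset) (use 2 in simp)
      moreover have "\<forall>\<^sub>F w in at z. g w = q w"
        using eventually_at_in_open'[OF open_halfspace_Im_lt[of 0], of z] 2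
        by (auto elim!: eventually_mono simp: lower)
      ultimately show ?thesis
        using meromorphic_on_cong[of "{z}" g q] by auto
    next
      case 3
      then have "g analytic_on {z}" using an by (auto intro: analytic_on_subset)
      then show ?thesis by (rule analytic_on_imp_meromorphic_on)
    qed
  qed
  then have "g meromorphic_on UNIV"
    by (subst meromorphic_on_meromorphic_at) auto
  then show ?thesis
    using an upper by (auto simp: is_continuation_def upper_half_plane_def)
qed

lemma reflection_meromorphic:
  assumes "(\<lambda>z. cnj (h (cnj z))) holomorphic_on {z. Im z < 0}"
  shows "(\<lambda>z. cnj (h (cnj z))) meromorphic_on {z. Im z < 0}"
  using assms open_halfspace_Im_lt[of 0]
  by (intro analytic_on_imp_meromorphic_on) (simp add: analytic_on_open)

locale continued =
  fixes f :: "complex \<Rightarrow> complex"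
  assumes ex_continuation: "\<exists>g. is_continuation f g"
begin

lemma is_continuation: "is_continuation f (continuation f)"
  unfolding continuation_def using ex_continuation by (rule someI_ex)

lemma meromorphic: "continuation f meromorphic_on UNIV"
  and analytic: "continuation f analytic_on \<real>"
  and eq_upper: "Im z > 0 \<Longrightarrow> continuation f z = f z"
  using is_continuation by (auto simp: is_continuation_def upper_half_plane_def)

lemma analytic_at_real: "continuation f analytic_on {complex_of_real x}"
  using analytic by (rule analytic_on_subset) auto

lemma isCont_real: "isCont (continuation f) (complex_of_real x)"
  using analytic_at_real by (rule analytic_at_imp_isCont)

lemma DERIV_real: "(continuation f has_field_derivative deriv (continuation f) (complex_of_real x)) (at (complex_of_real x))"
  using analytic_at_real by (meson analytic_on_imp_differentiable_at field_differentiable_derivI insertI1)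

lemma continuous_real: "continuous_on UNIV (\<lambda>x. continuation f (complex_of_real x))"
  unfolding continuous_on_eq_continuous_at[OF open_UNIV]
  by (auto intro!: isCont_o2[where f = complex_of_real, OF _ isCont_real] continuous_intros)

lemma continuous_deriv_real: "continuous_on UNIV (\<lambda>x. deriv (continuation f) (complex_of_real x))"
  unfolding continuous_on_eq_continuous_at[OF open_UNIV]
  by (auto intro!: isCont_o2[where f = complex_of_real, OF _ analytic_at_imp_isCont[OF analytic_deriv[OF analytic_at_real]]] continuous_intros)

lemma measurable_real [measurable]: "(\<lambda>x. continuation f (complex_of_real x)) \<in> borel_measurable borel"
  using continuous_real by (rule borel_measurable_continuous_onI)

lemma measurable_deriv_real [measurable]: "(\<lambda>x. deriv (continuation f) (complex_of_real x)) \<in> borel_measurable borel"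
  using continuous_deriv_real by (rule borel_measurable_continuous_onI)

lemma boundary_limit: "((\<lambda>y. f (Complex x y)) \<longlongrightarrow> continuation f (complex_of_real x)) (at_right 0)"
proof (rule Lim_transform_eventually)
  show "((\<lambda>y. continuation f (Complex x y)) \<longlongrightarrow> continuation f (complex_of_real x)) (at_right 0)"
    by (rule isCont_tendsto_compose[OF isCont_real Complex_tendsto_real])
  show "\<forall>\<^sub>F y in at_right 0. continuation f (Complex x y) = f (Complex x y)"
    using eventually_Im_pos[of x] by eventually_elim (rule eq_upper)
qed

lemma has_boundary_values: "has_boundary_values f (\<lambda>x. continuation f (complex_of_real x))"
  unfolding has_boundary_values_def using boundary_limit by simp

lemma deriv_eq_upper: "Im z > 0 \<Longrightarrow> deriv (continuation f) z = deriv f z"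
  using eventually_nhds_in_open[OF open_half_plane, of z 0]
  by (intro deriv_cong_ev) (auto elim!: eventually_mono simp: eq_upper)

lemma deriv_boundary_limit:
  "((\<lambda>y. deriv f (Complex x y)) \<longlongrightarrow> deriv (continuation f) (complex_of_real x)) (at_right 0)"
proof (rule Lim_transform_eventually)
  show "((\<lambda>y. deriv (continuation f) (Complex x y)) \<longlongrightarrow> deriv (continuation f) (complex_of_real x)) (at_right 0)"
    by (rule isCont_tendsto_compose[OF analytic_at_imp_isCont[OF analytic_deriv[OF analytic_at_real]] Complex_tendsto_real])
  show "\<forall>\<^sub>F y in at_right 0. deriv (continuation f) (Complex x y) = deriv f (Complex x y)"
    using eventually_Im_pos[of x] by eventually_elim (rule deriv_eq_upper)
qed

end

lemma holomorphic_reflection: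
  assumes "h holomorphic_on {z. Im z > 0}"
  shows "(\<lambda>z. cnj (h (cnj z))) holomorphic_on {z. Im z < 0}"
proof -
  have im: "cnj ` {z. Im z < 0} = {z. Im z > 0}"
    by (auto intro!: image_eqI[of _ cnj "cnj _"])
  have "(cnj \<circ> h \<circ> cnj) holomorphic_on {z. Im z < 0}"
    by (rule holomorphic_on_compose_cnj_cnj) (use assms open_halfspace_Im_lt[of 0] im in auto)
  then show ?thesis by (simp add: o_def)
qed

lemma bounded_deriv_extension:
  assumes holo: "\<Theta> holomorphic_on {z. Im z > 0}" and bd: "bounded_deriv \<Theta>"
  obtains E where "continuous_on {z. Im z \<ge> 0} E" "\<And>z. Im z > 0 \<Longrightarrow> E z = \<Theta> z"
proof -
  obtain L where L: "\<And>z. Im z > 0 \<Longrightarrow> norm (deriv \<Theta> z) \<le> L"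
    using bd by (auto simp: bounded_deriv_def bounded_iff upper_half_plane_def)
  have lip: "norm (\<Theta> z - \<Theta> w) \<le> L * norm (z - w)" if "Im z > 0" "Im w > 0" for z w
  proof (rule field_differentiable_bound[of "{z. Im z > 0}"])
    show "(\<Theta> has_field_derivative deriv \<Theta> z) (at z within {z. Im z > 0})" if "z \<in> {z. Im z > 0}" for z
      using holomorphic_derivI[OF holo open_half_plane that] .
  qed (use that L convex_half_plane in auto)
  have "L \<ge> 0" using order_trans[OF norm_ge_zero L[of \<i>]] by simp
  then have "L-lipschitz_on {z. Im z > 0} \<Theta>"
    using lip by (intro lipschitz_onI) (auto simp: dist_norm)
  then have "uniformly_continuous_on {z. Im z > 0} \<Theta>"
    by (rule lipschitz_on_uniformly_continuous)
  then obtain E where E: "uniformly_continuous_on (closure {z. Im z > 0}) E" "\<And>z. z \<in> {z. Im z > 0} \<Longrightarrow> \<Theta> z = E z"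
    by (rule uniformly_continuous_on_extension_on_closure) blast
  have "closure {z. Im z > 0} = {z. Im z \<ge> 0}"
    using closure_halfspace_gt[of \<i> 0] by simp
  then show ?thesis
    using E that[of E] by (simp add: uniformly_continuous_imp_continuous)
qed

text \<open>A bounded derivative makes \<open>\<Theta>\<close> Lipschitz, hence continuous up to the real line, and by continuity
its boundary values have modulus one everywhere. The reflected function \<open>1 / cnj (\<Theta> (cnj z))\<close> then
continues \<open>\<Theta>\<close> across the real line. It is meromorphic in the lower half-plane, with poles at the
reflected zeros of \<open>\<Theta>\<close>.\<close>
lemma inner_function_continuation_exists:
  assumes inner: "inner_function \<Theta>" and bd: "bounded_deriv \<Theta>"
  shows "\<exists>g. is_continuation \<Theta> g"
proof -
  have holo: "\<Theta> holomorphic_on {z. Im z > 0}"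
    using inner by (simp add: inner_function_def upper_half_plane_def)
  obtain E where E: "continuous_on {z. Im z \<ge> 0} E" "\<And>z. Im z > 0 \<Longrightarrow> E z = \<Theta> z"
    using bounded_deriv_extension[OF holo bd] by blast
  have E1: "norm (E (complex_of_real x)) = 1" for x
  proof (rule continuous_AE_constant[of "\<lambda>x. norm (E (complex_of_real x))"])
    show "continuous_on UNIV (\<lambda>x. norm (E (complex_of_real x)))"
      by (intro continuous_intros continuous_on_compose2[OF E(1)]) auto
    have hb: "has_boundary_values \<Theta> (\<lambda>x. E (complex_of_real x))"
      unfolding has_boundary_values_def
    proof (rule AE_I2)
      fix x
      have "((\<lambda>y. E (Complex x y)) \<longlongrightarrow> E (complex_of_real x)) (at_right 0)"
        by (rule continuous_on_tendsto_compose[OF E(1) Complex_tendsto_real])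
          (use eventually_Im_pos[of x] in \<open>auto elim: eventually_mono\<close>)
      then show "((\<lambda>y. \<Theta> (Complex x y)) \<longlongrightarrow> E (complex_of_real x)) (at_right 0)"
        by (rule Lim_transform_eventually) (use eventually_Im_pos[of x] E(2) in \<open>auto elim: eventually_mono\<close>)
    qed
    obtain \<theta> where \<theta>: "has_boundary_values \<Theta> \<theta>" "AE x in lborel. norm (\<theta> x) = 1"
      using inner by (auto simp: inner_function_def)
    show "AE x in lborel. norm (E (complex_of_real x)) = 1"
      using has_boundary_values_unique[OF hb \<theta>(1)] \<theta>(2) by eventually_elim simp
  qed
  define g where "g z = (if Im z \<ge> 0 then E z else 1 / cnj (E (cnj z)))" for z
  have g_upper: "g z = \<Theta> z" if "Im z > 0" for z using that E(2) by (simp add: g_def)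
  have reflect: "(\<lambda>z. cnj (\<Theta> (cnj z))) holomorphic_on {z. Im z < 0}"
    by (rule holomorphic_reflection[OF holo])
  have g_lower: "g z = inverse (cnj (\<Theta> (cnj z)))" if "Im z < 0" for z
    using that E(2)[of "cnj z"] by (simp add: g_def inverse_eq_divide)
  have near: "\<exists>r>0. g holomorphic_on ball (complex_of_real x) r" for x
  proof -
    have "continuous (at (complex_of_real x) within {z. Im z \<ge> 0}) E"
      using E(1) by (simp add: continuous_on_eq_continuous_within)
    then have "\<exists>d>0. \<forall>z. Im z \<ge> 0 \<longrightarrow> dist z (complex_of_real x) < d \<longrightarrow> dist (E z) (E (complex_of_real x)) < 1"
      unfolding continuous_within_eps_delta by (metis mem_Collect_eq zero_less_one)
    then obtain r where r: "r > 0" "\<And>z. Im z \<ge> 0 \<Longrightarrow> dist z (complex_of_real x) < r \<Longrightarrow> dist (E z) (E (complex_of_real x)) < 1"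
      by blast
    let ?B = "ball (complex_of_real x) r"
    have ne: "E z \<noteq> 0" if "z \<in> ?B" "Im z \<ge> 0" for z
      using r(2)[of z] that E1[of x] by (auto simp: dist_commute)
    have cB: "cnj z \<in> ?B" if "z \<in> ?B" for z
      using that complex_mod_cnj[of "of_real x - z"] by (simp add: dist_norm)
    have cont: "continuous_on ?B g"
    proof -
      have "continuous_on (?B \<inter> {z. Im z \<ge> 0} \<union> ?B \<inter> {z. Im z \<le> 0}) (\<lambda>z. if Im z \<ge> 0 then E z else 1 / cnj (E (cnj z)))"
      proof (rule continuous_on_cases_local)
        show "closedin (top_of_set (?B \<inter> {z. Im z \<ge> 0} \<union> ?B \<inter> {z. Im z \<le> 0})) (?B \<inter> {z. Im z \<ge> 0})"
          using closed_halfspace_Im_ge[of 0] by (auto simp: closedin_closed)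
        show "closedin (top_of_set (?B \<inter> {z. Im z \<ge> 0} \<union> ?B \<inter> {z. Im z \<le> 0})) (?B \<inter> {z. Im z \<le> 0})"
          using closed_halfspace_Im_le[of 0] by (auto simp: closedin_closed)
        show "continuous_on (?B \<inter> {z. Im z \<ge> 0}) E"
          using E(1) by (rule continuous_on_subset) auto
        show "continuous_on (?B \<inter> {z. Im z \<le> 0}) (\<lambda>z. 1 / cnj (E (cnj z)))"
          using ne cB by (intro continuous_intros continuous_on_compose2[OF E(1)]) auto
        show "E z = 1 / cnj (E (cnj z))"
          if "(z \<in> ?B \<inter> {z. Im z \<ge> 0} \<and> \<not> 0 \<le> Im z) \<or> (z \<in> ?B \<inter> {z. Im z \<le> 0} \<and> 0 \<le> Im z)" for z
        proof -
          have z: "z = complex_of_real (Re z)" using that by (auto simp: complex_eq_iff)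
          have "E z * cnj (E z) = 1"
            using E1[of "Re z"] z complex_norm_square[of "E z"] by simp
          moreover have "cnj z = z" using z by (metis complex_cnj_complex_of_real)
          ultimately show ?thesis by (metis nonzero_eq_divide_eq mult_zero_right zero_neq_one)
        qed
      qed
      moreover have "?B \<inter> {z. Im z \<ge> 0} \<union> ?B \<inter> {z. Im z \<le> 0} = ?B" by auto
      ultimately show ?thesis by (simp add: g_def[abs_def])
    qed
    have "g holomorphic_on ?B"
    proof (rule holomorphic_on_paste_across_line[of _ \<i> _ 0])
      have "(\<lambda>z. inverse (cnj (\<Theta> (cnj z)))) holomorphic_on ?B \<inter> {z. Im z < 0}"
      proof (intro holomorphic_intros holomorphic_on_subset[OF reflect])
        show "cnj (\<Theta> (cnj z)) \<noteq> 0" if "z \<in> ?B \<inter> {z. Im z < 0}" for z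
          using ne[of "cnj z"] cB[of z] E(2)[of "cnj z"] that by auto
      qed auto
      then show "g holomorphic_on ?B \<inter> {z. \<i> \<bullet> z < 0}"
        using g_lower by (subst holomorphic_cong[OF refl]) auto
      have "\<Theta> holomorphic_on ?B \<inter> {z. Im z > 0}"
        using holo by (rule holomorphic_on_subset) auto
      then show "g holomorphic_on ?B \<inter> {z. 0 < \<i> \<bullet> z}"
        using g_upper by (subst holomorphic_cong[OF refl]) auto
    qed (use cont in auto)
    then show ?thesis using r by blast
  qed
  have "is_continuation \<Theta> g"
  proof (rule is_continuationI[OF holo near g_upper g_lower])
    show "(\<lambda>z. inverse (cnj (\<Theta> (cnj z)))) meromorphic_on {z. Im z < 0}"
      by (intro meromorphic_on_inverse reflection_meromorphic reflect)
  qed auto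
  then show ?thesis by blast
qed

section \<open>Difference quotients of the inner function\<close>

locale inner_bounded_deriv =
  fixes \<Theta> :: "complex \<Rightarrow> complex"
  assumes inner: "inner_function \<Theta>" and bounded_deriv: "bounded_deriv \<Theta>"

sublocale inner_bounded_deriv \<subseteq> continued \<Theta>
  by unfold_locales (rule inner_function_continuation_exists[OF inner bounded_deriv])

context inner_bounded_deriv begin

abbreviation T :: "complex \<Rightarrow> complex" where "T \<equiv> continuation \<Theta>"
abbreviation \<tau> :: "real \<Rightarrow> complex" where "\<tau> t \<equiv> T (complex_of_real t)"

lemma holo: "\<Theta> holomorphic_on {z. Im z > 0}"
  using inner by (simp add: inner_function_def upper_half_plane_def)

lemma norm_T_real: "norm (\<tau> x) = 1"
proof (rule continuous_AE_constant[of "\<lambda>x. norm (\<tau> x)"])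
  show "continuous_on UNIV (\<lambda>x. norm (\<tau> x))"
    by (intro continuous_intros continuous_real)
  obtain \<theta> where \<theta>: "has_boundary_values \<Theta> \<theta>" "AE x in lborel. norm (\<theta> x) = 1"
    using inner by (auto simp: inner_function_def)
  show "AE x in lborel. norm (\<tau> x) = 1"
    using has_boundary_values_unique[OF has_boundary_values \<theta>(1)] \<theta>(2) by eventually_elim simp
qed

lemma T_mult_cnj: "\<tau> x * cnj (\<tau> x) = 1"
  using norm_T_real[of x] complex_norm_square[of "\<tau> x"] by simp

lemma norm_deriv_le_sup: "norm (deriv T (complex_of_real x)) \<le> deriv_sup_norm \<Theta>"
  unfolding deriv_sup_norm_def
proof (rule cSUP_upper)
  obtain L where L: "\<And>z. Im z > 0 \<Longrightarrow> norm (deriv \<Theta> z) \<le> L"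
    using bounded_deriv by (auto simp: bounded_deriv_def bounded_iff upper_half_plane_def)
  show "bdd_above (range (\<lambda>x. norm (deriv T (complex_of_real x))))"
  proof (rule bdd_aboveI2)
    fix x
    show "norm (deriv T (complex_of_real x)) \<le> L"
    proof (rule tendsto_upperbound[OF tendsto_norm[OF deriv_boundary_limit]])
      show "\<forall>\<^sub>F y in at_right 0. norm (deriv \<Theta> (Complex x y)) \<le> L"
        using eventually_Im_pos[of x] by eventually_elim (rule L)
    qed (rule trivial_limit_at_right_real)
  qed
qed simp

lemma deriv_sup_norm_nonneg: "deriv_sup_norm \<Theta> \<ge> 0"
  using order_trans[OF norm_ge_zero norm_deriv_le_sup[of 0]] .

lemma bounded_upper: obtains K where "\<And>z. Im z > 0 \<Longrightarrow> norm (\<Theta> z) \<le> K"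
  using inner by (auto simp: inner_function_def bounded_iff upper_half_plane_def)

lemma weighted_hardy_inner:
  assumes "\<And>z. Im z > 0 \<Longrightarrow> norm (\<Theta> z) \<le> K"
  shows "weighted_hardy \<Theta> (K * pi) (\<lambda>t. \<tau> t)"
proof
  show "K * pi \<ge> 0" using order_trans[OF norm_ge_zero assms[of \<i>]] by simp
qed (use weighted_bound_bounded[OF assms] holo has_boundary_values in auto)

text \<open>Near \<open>x\<close> the difference quotients are bounded by the derivative, and far from \<open>x\<close> they decay like \<open>1 / |t|\<close>
since \<open>T\<close> is bounded. The factor \<open>|t + \<i>|\<close> records both. The bound is uniform for \<open>z\<close> on either side of
the real line, which is what continuation across the line needs.\<close>
lemma quotient_bound:
  obtains r C where "r > 0" "r \<le> 1/2" "T holomorphic_on ball (complex_of_real x) r"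
    "\<And>z t. z \<in> ball (complex_of_real x) r \<Longrightarrow>
       norm ((\<tau> t - T z) / (of_real t - z)) * norm (of_real t + \<i>) \<le> C"
proof -
  obtain R where R: "R > 0" "T holomorphic_on ball (complex_of_real x) R"
    using analytic_at_real[of x] by (auto simp: analytic_on_def)
  let ?D = "cball (complex_of_real x) (R / 2)"
  have holD: "T holomorphic_on ?D" and hold: "deriv T holomorphic_on ?D"
    using R holomorphic_deriv[OF R(2)] by (auto elim!: holomorphic_on_subset)
  have comp: "compact (T ` ?D)" "compact (deriv T ` ?D)"
    using holD hold by (auto intro!: compact_continuous_image holomorphic_on_imp_continuous_on)
  obtain B where B: "\<And>z. z \<in> ?D \<Longrightarrow> norm (T z) \<le> B"
    using compact_imp_bounded[OF comp(1)] unfolding bounded_iff by blast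
  obtain D where D: "\<And>z. z \<in> ?D \<Longrightarrow> norm (deriv T z) \<le> D"
    using compact_imp_bounded[OF comp(2)] unfolding bounded_iff by blast
  have BD0: "B \<ge> 0" "D \<ge> 0"
    using order_trans[OF norm_ge_zero B[of "complex_of_real x"]] order_trans[OF norm_ge_zero D[of "complex_of_real x"]] R by auto
  define r where "r = min (1/2) (R / 4)"
  define q where "q = max D ((1 + B) / (R / 4))"
  have q0: "q \<ge> 0" using BD0 by (simp add: q_def)
  have r: "r > 0" "r \<le> R / 4" "r \<le> 1/2" using R by (auto simp: r_def)
  show ?thesis
  proof (rule that[OF r(1,3)])
    show "T holomorphic_on ball (complex_of_real x) r"
      using R(2) by (rule holomorphic_on_subset) (use r R in auto)
    fix z t assume z: "z \<in> ball (complex_of_real x) r"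
    let ?t = "complex_of_real t"
    have zD: "z \<in> ?D" using z r by auto
    have diff: "norm (T ?t - T z) \<le> 1 + B"
      using norm_triangle_ineq4[of "T ?t" "T z"] norm_T_real[of t] B[OF zD] by linarith
    have lip: "norm (T ?t - T z) \<le> q * norm (?t - z)"
    proof (cases "?t \<in> ?D")
      case True
      have "norm (T ?t - T z) \<le> D * norm (?t - z)"
      proof (rule field_differentiable_bound[of ?D])
        show "(T has_field_derivative deriv T w) (at w within ?D)" if "w \<in> ?D" for w
          using holomorphic_derivI[OF R(2) open_ball, of w ?D] that R(1) by auto
      qed (use D zD True in auto)
      also have "\<dots> \<le> q * norm (?t - z)"
        by (intro mult_right_mono) (simp_all add: q_def)
      finally show ?thesis .
    next
      case False
      have "R / 2 < dist (complex_of_real x) ?t" using False by simp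
      also have "\<dots> \<le> dist (complex_of_real x) z + dist z ?t" by (rule dist_triangle)
      finally have "norm (?t - z) \<ge> R / 4"
        using z r by (simp add: dist_norm norm_minus_commute)
      then have "(1 + B) / (R / 4) * (R / 4) \<le> q * norm (?t - z)"
        using R BD0 by (intro mult_mono) (auto simp: q_def)
      then show ?thesis using diff R by simp
    qed
    show "norm ((T ?t - T z) / (?t - z)) * norm (?t + \<i>) \<le> (1 + B) + q * (\<bar>x\<bar> + 2)"
    proof (cases "?t = z")
      case False
      then have pos: "norm (?t - z) > 0" by simp
      have "norm (?t + \<i>) \<le> norm (?t - z) + norm (z + \<i>)"
        using norm_triangle_ineq[of "?t - z" "z + \<i>"] by simp
      then have "norm ((T ?t - T z) / (?t - z)) * norm (?t + \<i>)
         \<le> norm ((T ?t - T z) / (?t - z)) * (norm (?t - z) + norm (z + \<i>))"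
        by (rule mult_left_mono) simp
      also have "\<dots> = norm (T ?t - T z) + norm ((T ?t - T z) / (?t - z)) * norm (z + \<i>)"
        using pos by (simp add: norm_divide distrib_left)
      also have "\<dots> \<le> (1 + B) + q * (\<bar>x\<bar> + 2)"
      proof (intro add_mono diff mult_mono)
        show "norm ((T ?t - T z) / (?t - z)) \<le> q"
          using lip pos by (simp add: norm_divide pos_divide_le_eq)
        have "norm (z + \<i>) \<le> norm (complex_of_real x) + norm (z - complex_of_real x) + norm \<i>"
          using norm_triangle_ineq[of "of_real x + (z - complex_of_real x)" \<i>]
            norm_triangle_ineq[of "complex_of_real x" "z - complex_of_real x"] by simp
        also have "\<dots> \<le> \<bar>x\<bar> + 1 + 1"
          using z r by (simp add: dist_norm norm_minus_commute)
        finally show "norm (z + \<i>) \<le> \<bar>x\<bar> + 2" by simp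
      qed (use q0 in auto)
      finally show ?thesis .
    qed (use q0 BD0 in auto)
  qed
qed

text \<open>Up to normalization this is the squared norm of the reproducing kernel at \<open>z\<close>. Since \<open>|T(t)| = 1\<close>, expanding the square
leaves the Poisson integrals of \<open>1\<close>, of \<open>\<Theta>\<close> and of its conjugate, whose values at \<open>z\<close> are known.\<close>
lemma nn_integral_difference_quotient_upper:
  assumes z: "Im z > 0"
  shows "(\<integral>\<^sup>+t. ennreal ((norm ((\<tau> t - \<Theta> z) / (of_real t - z)))\<^sup>2) \<partial>lborel)
    = ennreal (pi * (1 - (norm (\<Theta> z))\<^sup>2) / Im z)"
proof -
  obtain K where K: "\<And>z. Im z > 0 \<Longrightarrow> norm (\<Theta> z) \<le> K" by (rule bounded_upper) blast
  interpret W: weighted_hardy \<Theta> "K * pi" "\<lambda>t. \<tau> t"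
    by (rule weighted_hardy_inner[OF K])
  interpret U: weighted_hardy "\<lambda>_. 1" "1 * pi" "\<lambda>_. 1"
  proof
    show "has_boundary_values (\<lambda>_. 1) (\<lambda>_. 1)" by (simp add: has_boundary_values_def)
  qed (use weighted_bound_bounded[of "\<lambda>_. 1" 1] in auto)
  let ?k = "\<lambda>t. (of_real t - z) * (of_real t - cnj z)"
  have k: "?k t = complex_of_real ((norm (of_real t - z))\<^sup>2)" for t
    using complex_norm_square[of "of_real t - z"] by simp
  have zz: "z - cnj z = 2 * \<i> * Im z" by (simp add: complex_eq_iff)
  have im: "Im z \<noteq> 0" "Im (cnj z) \<noteq> 0" "z \<noteq> cnj z" using z by (auto simp: complex_eq_iff)
  have W_int: "integrable lborel (\<lambda>t. \<tau> t / ?k t)"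
    and W_val: "(\<integral>t. \<tau> t / ?k t \<partial>lborel) = pi * \<Theta> z / Im z"
    using W.integral_two_kernels[OF im] z im by (simp_all add: W.extension_def zz)
  have U_int: "integrable lborel (\<lambda>t. 1 / ?k t)"
    and U_val: "(\<integral>t. 1 / ?k t \<partial>lborel) = of_real (pi / Im z)"
    using U.integral_two_kernels[OF im] z im by (simp_all add: U.extension_def zz)
  have cnjk: "cnj (\<tau> t) / ?k t = cnj (\<tau> t / ?k t)" for t
    by (simp add: k)
  have C_int: "integrable lborel (\<lambda>t. cnj (\<tau> t) / ?k t)"
    unfolding cnjk using W_int by (rule integrable_cnj)
  have C_val: "(\<integral>t. cnj (\<tau> t) / ?k t \<partial>lborel) = cnj (pi * \<Theta> z / Im z)"
    unfolding cnjk using Bochner_Integration.integral_cnj[of lborel "\<lambda>t. \<tau> t / ?k t"] by (simp only: W_val)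
  define E where "E t = (norm ((\<tau> t - \<Theta> z) / (of_real t - z)))\<^sup>2" for t :: real
  have E: "complex_of_real (E t) = (1 + \<Theta> z * cnj (\<Theta> z)) * (1 / ?k t)
      - cnj (\<Theta> z) * (\<tau> t / ?k t) - \<Theta> z * (cnj (\<tau> t) / ?k t)" for t
  proof -
    have "complex_of_real (E t) = (\<tau> t - \<Theta> z) * cnj (\<tau> t - \<Theta> z) / ?k t"
      unfolding E_def k complex_norm_square[symmetric] by (simp add: norm_divide power_divide)
    also have "(\<tau> t - \<Theta> z) * cnj (\<tau> t - \<Theta> z)
       = (1 + \<Theta> z * cnj (\<Theta> z)) - cnj (\<Theta> z) * \<tau> t - \<Theta> z * cnj (\<tau> t)"
      using T_mult_cnj[of t] by (simp add: algebra_simps)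
    finally show ?thesis by (simp add: diff_divide_distrib)
  qed
  have int: "integrable lborel (\<lambda>t. complex_of_real (E t))"
    unfolding E by (intro Bochner_Integration.integrable_diff integrable_mult_right U_int W_int C_int)
  have "complex_of_real (\<integral>t. E t \<partial>lborel) = (\<integral>t. complex_of_real (E t) \<partial>lborel)"
    by simp
  also have "\<dots> = (1 + \<Theta> z * cnj (\<Theta> z)) * of_real (pi / Im z) - cnj (\<Theta> z) * (pi * \<Theta> z / Im z)
      - \<Theta> z * cnj (pi * \<Theta> z / Im z)"
    unfolding E by (simp only: Bochner_Integration.integral_diff Bochner_Integration.integrable_diff
        integrable_mult_right integral_mult_right_zero U_int W_int C_int U_val W_val C_val simp_thms)
  also have "\<dots> = complex_of_real (pi * (1 - (norm (\<Theta> z))\<^sup>2) / Im z)"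
    using complex_norm_square[of "\<Theta> z"] by (simp add: algebra_simps add_divide_distrib diff_divide_distrib)
  finally have val: "(\<integral>t. E t \<partial>lborel) = pi * (1 - (norm (\<Theta> z))\<^sup>2) / Im z"
    by (simp only: of_real_eq_iff)
  have "integrable lborel E" using int by (simp add: complex_of_real_integrable_eq)
  moreover have "E t \<ge> 0" for t by (simp add: E_def)
  ultimately have "(\<integral>\<^sup>+t. ennreal (E t) \<partial>lborel) = ennreal (\<integral>t. E t \<partial>lborel)"
    by (intro nn_integral_eq_integral) auto
  then show ?thesis
    unfolding val by (simp only: E_def)
qed

text \<open>Fatou's lemma as \<open>z\<close> descends to \<open>x\<close>. The factor \<open>1 - |\<Theta>(z)|\<close> is at most \<open>|T(x) - \<Theta>(z)|\<close>, so that its quotient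
by \<open>Im z\<close> is controlled by the derivative at \<open>x\<close>, and the remaining factor \<open>1 + |\<Theta>(z)|\<close> tends to 2.\<close>
lemma nn_integral_difference_quotient_real:
  "(\<integral>\<^sup>+t. ennreal ((norm ((\<tau> t - \<tau> x) / (of_real t - complex_of_real x)))\<^sup>2) \<partial>lborel)
    \<le> ennreal (2 * pi * norm (deriv T (complex_of_real x)))"
proof -
  define z where "z n = Complex x (inverse (real (Suc n)))" for n
  have Imz: "Im (z n) > 0" for n by (simp add: z_def)
  have zlim: "z \<longlonglongrightarrow> complex_of_real x"
    unfolding z_def using filterlim_compose[OF Complex_tendsto_real inverse_Suc_at_right] .
  have Tz: "\<Theta> (z n) = T (z n)" for n using eq_upper[OF Imz] by simp
  have \<Theta>lim: "(\<lambda>n. \<Theta> (z n)) \<longlonglongrightarrow> \<tau> x"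
    unfolding Tz by (rule isCont_tendsto_compose[OF isCont_real zlim])
  let ?q = "\<lambda>n t. (norm ((\<tau> t - \<Theta> (z n)) / (of_real t - z n)))\<^sup>2"
  have "(\<integral>\<^sup>+t. ennreal ((norm ((\<tau> t - \<tau> x) / (of_real t - complex_of_real x)))\<^sup>2) \<partial>lborel)
    = (\<integral>\<^sup>+t. liminf (\<lambda>n. ennreal (?q n t)) \<partial>lborel)"
  proof (rule nn_integral_cong_AE)
    show "AE t in lborel. ennreal ((norm ((\<tau> t - \<tau> x) / (of_real t - complex_of_real x)))\<^sup>2)
       = liminf (\<lambda>n. ennreal (?q n t))"
      using AE_lborel_singleton[of x]
    proof eventually_elim
      case (elim t)
      then have "(\<lambda>n. ennreal (?q n t)) \<longlonglongrightarrow>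
         ennreal ((norm ((\<tau> t - \<tau> x) / (of_real t - complex_of_real x)))\<^sup>2)"
        by (intro tendsto_ennrealI tendsto_power tendsto_norm tendsto_divide tendsto_diff tendsto_const \<Theta>lim zlim) auto
      from lim_imp_Liminf[OF _ this] show ?case by simp
    qed
  qed
  also have "\<dots> \<le> liminf (\<lambda>n. \<integral>\<^sup>+t. ennreal (?q n t) \<partial>lborel)"
    by (rule nn_integral_liminf) measurable
  also have "\<dots> \<le> liminf (\<lambda>n. ennreal (pi * (norm ((T (z n) - \<tau> x) / (z n - complex_of_real x)) * (1 + norm (\<Theta> (z n))))))"
  proof (intro Liminf_mono always_eventually allI)
    fix n
    have "1 - (norm (\<Theta> (z n)))\<^sup>2 = (1 - norm (\<Theta> (z n))) * (1 + norm (\<Theta> (z n)))"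
      by (simp add: power2_eq_square algebra_simps)
    also have "\<dots> \<le> norm (T (z n) - \<tau> x) * (1 + norm (\<Theta> (z n)))"
      using norm_triangle_ineq2[of "\<tau> x" "\<Theta> (z n)"] norm_T_real[of x] Tz[of n]
      by (intro mult_right_mono) (auto simp: norm_minus_commute)
    finally have "pi * (1 - (norm (\<Theta> (z n)))\<^sup>2) / Im (z n)
       \<le> pi * (norm (T (z n) - \<tau> x) * (1 + norm (\<Theta> (z n)))) / Im (z n)"
      using Imz[of n] by (intro divide_right_mono mult_left_mono) auto
    also have "\<dots> = pi * (norm (T (z n) - \<tau> x) / Im (z n) * (1 + norm (\<Theta> (z n))))"
      by simp
    finally have "pi * (1 - (norm (\<Theta> (z n)))\<^sup>2) / Im (z n)
       \<le> pi * (norm (T (z n) - \<tau> x) / Im (z n) * (1 + norm (\<Theta> (z n))))" .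
    moreover have "norm (T (z n) - \<tau> x) / Im (z n) = norm ((T (z n) - \<tau> x) / (z n - complex_of_real x))"
      unfolding norm_divide using Imz[of n] by (simp add: z_def cmod_def)
    ultimately show "(\<integral>\<^sup>+t. ennreal (?q n t) \<partial>lborel)
       \<le> ennreal (pi * (norm ((T (z n) - \<tau> x) / (z n - complex_of_real x)) * (1 + norm (\<Theta> (z n)))))"
      unfolding nn_integral_difference_quotient_upper[OF Imz] by (simp add: ennreal_leI)
  qed
  also have "\<dots> = ennreal (pi * (norm (deriv T (complex_of_real x)) * (1 + norm (\<tau> x))))"
  proof (rule lim_imp_Liminf)
    have ne: "z n \<noteq> complex_of_real x" for n using Imz[of n] by auto
    have "filterlim z (at (complex_of_real x)) sequentially"
      using zlim ne by (auto simp: filterlim_at)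
    from filterlim_compose[OF DERIV_real[unfolded has_field_derivative_iff] this]
    have "(\<lambda>n. (T (z n) - \<tau> x) / (z n - complex_of_real x)) \<longlonglongrightarrow> deriv T (complex_of_real x)" .
    then show "(\<lambda>n. ennreal (pi * (norm ((T (z n) - \<tau> x) / (z n - complex_of_real x)) * (1 + norm (\<Theta> (z n))))))
       \<longlonglongrightarrow> ennreal (pi * (norm (deriv T (complex_of_real x)) * (1 + norm (\<tau> x))))"
      by (intro tendsto_ennrealI tendsto_mult tendsto_add tendsto_norm tendsto_const \<Theta>lim)
  qed simp
  also have "pi * (norm (deriv T (complex_of_real x)) * (1 + norm (\<tau> x))) = 2 * pi * norm (deriv T (complex_of_real x))"
    by (simp add: norm_T_real)
  finally show ?thesis .
qed

end

section \<open>Continuation of elements of the model space\<close>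

lemma borel_measurable_cnj [measurable (raw)]:
  "g \<in> borel_measurable M \<Longrightarrow> (\<lambda>x. cnj (g x)) \<in> borel_measurable M"
  by (rule measurable_compose[OF _ borel_measurable_continuous_onI]) (auto intro: continuous_intros)

text \<open>An element of a model space is used only through the function \<open>h\<close> that describes its boundary values as
\<open>T\<close> times the conjugate of those of \<open>h\<close>; the exponent enters through the bounds alone.\<close>
locale model_element = inner_bounded_deriv +
  fixes f h :: "complex \<Rightarrow> complex" and Bf Bh :: real and h0 :: "real \<Rightarrow> complex"
  assumes weighted_h: "weighted_hardy h Bh h0"
    and weighted_f: "weighted_hardy f Bf (\<lambda>t. continuation \<Theta> (complex_of_real t) * cnj (h0 t))"
begin

sublocale h: weighted_hardy h Bh h0 by (rule weighted_h)
sublocale f: weighted_hardy f Bf "\<lambda>t. \<tau> t * cnj (h0 t)" by (rule weighted_f)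

lemmas measurable_h0 [measurable] = h.measurable_g0

lemma integrable_h_weight: "integrable lborel (\<lambda>t. norm (h0 t) / (norm (of_real t + \<i>))\<^sup>2)"
  using integrable_norm[OF h.integrable_weight] by (simp add: norm_divide norm_power)

text \<open>Because \<open>T cnj h0\<close> is the boundary function of \<open>f\<close>, the numerator \<open>cnj h0 (T(t) - T(z))\<close> splits into
Cauchy integrals of \<open>f\<close> and of the reflection of \<open>h\<close>. In this form the singularity at \<open>t = z\<close> is removable,
so \<open>J\<close> stays continuous on the real line. The factor \<open>1 / (t + \<i>)\<close> provides convergence.\<close>
definition J :: "complex \<Rightarrow> complex"
  where "J z = (\<integral>t. cnj (h0 t) * ((\<tau> t - T z) / (of_real t - z)) / (of_real t + \<i>) \<partial>lborel)"

lemma J_off_real: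
  assumes z: "Im z \<noteq> 0" "z \<noteq> -\<i>"
  shows "J z = 2 * pi * \<i> / (z + \<i>) * (f.extension z + T z * (cnj (h.extension (cnj z)) - cnj (h \<i>)))"
proof -
  have im: "Im (cnj z) \<noteq> 0" "Im \<i> \<noteq> 0" "cnj z \<noteq> \<i>" "Im (-\<i>) \<noteq> 0"
    using z by (auto simp: complex_eq_iff)
  let ?k = "\<lambda>t. (of_real t - z) * (of_real t - - \<i>)"
  have f_int: "integrable lborel (\<lambda>t. \<tau> t * cnj (h0 t) / ?k t)"
    and f_val: "(\<integral>t. \<tau> t * cnj (h0 t) / ?k t \<partial>lborel) = 2 * pi * \<i> * (f.extension z / (z + \<i>))"
    using f.integral_two_kernels[OF z(1) im(4) z(2)] by (simp_all add: f.extension_def)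
  have h_eq: "cnj (h0 t) / ?k t = cnj (h0 t / ((of_real t - cnj z) * (of_real t - \<i>)))" for t
    by simp
  have h_int: "integrable lborel (\<lambda>t. cnj (h0 t) / ?k t)"
    unfolding h_eq by (rule integrable_cnj[OF h.integral_two_kernels(1)[OF im(1-3)]])
  have "(\<integral>t. cnj (h0 t) / ?k t \<partial>lborel) = cnj (2 * pi * \<i> * ((h.extension (cnj z) - h.extension \<i>) / (cnj z - \<i>)))"
    unfolding h_eq using Bochner_Integration.integral_cnj[of lborel "\<lambda>t. h0 t / ((of_real t - cnj z) * (of_real t - \<i>))"]
    by (simp only: h.integral_two_kernels(2)[OF im(1-3)])
  also have "\<dots> = - (2 * pi * \<i> * ((cnj (h.extension (cnj z)) - cnj (h \<i>)) / (z + \<i>)))"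
    by (simp add: h.extension_def)
  finally have h_val: "(\<integral>t. cnj (h0 t) / ?k t \<partial>lborel) = - (2 * pi * \<i> * ((cnj (h.extension (cnj z)) - cnj (h \<i>)) / (z + \<i>)))" .
  have "J z = (\<integral>t. \<tau> t * cnj (h0 t) / ?k t - T z * (cnj (h0 t) / ?k t) \<partial>lborel)"
    unfolding J_def
    by (intro Bochner_Integration.integral_cong refl) (simp add: diff_divide_distrib right_diff_distrib mult_ac)
  also have "\<dots> = (\<integral>t. \<tau> t * cnj (h0 t) / ?k t \<partial>lborel) - T z * (\<integral>t. cnj (h0 t) / ?k t \<partial>lborel)"
    by (simp only: Bochner_Integration.integral_diff integrable_mult_right integral_mult_right_zero f_int h_int simp_thms)
  finally show ?thesis
    unfolding f_val h_val by (simp add: algebra_simps add_divide_distrib diff_divide_distrib)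
qed

lemma J_tendsto_real: "(J \<longlongrightarrow> J (complex_of_real x)) (at (complex_of_real x))"
proof -
  obtain r C where r: "r > 0"
    and C: "\<And>z t. z \<in> ball (complex_of_real x) r \<Longrightarrow>
       norm ((\<tau> t - T z) / (of_real t - z)) * norm (of_real t + \<i>) \<le> C"
    by (rule quotient_bound[of x]) blast
  show ?thesis
    unfolding J_def
  proof (rule integral_tendsto_within)
    show "integrable lborel (\<lambda>t. C * (norm (h0 t) / (norm (of_real t + \<i>))\<^sup>2))"
      by (intro integrable_mult_right integrable_h_weight)
    have "\<forall>\<^sub>F z in at (complex_of_real x). z \<in> ball (complex_of_real x) r"
      using r by (intro eventually_at_in_open') auto
    then show "\<forall>\<^sub>F z in at (complex_of_real x). AE t in lborel.
       norm (cnj (h0 t) * ((\<tau> t - T z) / (of_real t - z)) / (of_real t + \<i>))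
         \<le> C * (norm (h0 t) / (norm (of_real t + \<i>))\<^sup>2)"
    proof eventually_elim
      case (elim z)
      show ?case
      proof (rule AE_I2)
        fix t
        let ?q = "norm ((\<tau> t - T z) / (of_real t - z))" and ?n = "norm (of_real t + \<i>)"
        have n: "?n > 0" using real_plus_i_nonzero[of t] by simp
        have "norm (h0 t) * ?q / ?n = norm (h0 t) * (?q * ?n) / ?n\<^sup>2"
          using n by (simp add: power2_eq_square)
        also have "\<dots> \<le> norm (h0 t) * C / ?n\<^sup>2"
          by (intro divide_right_mono mult_left_mono C[OF elim]) auto
        finally show "norm (cnj (h0 t) * ((\<tau> t - T z) / (of_real t - z)) / (of_real t + \<i>))
         \<le> C * (norm (h0 t) / ?n\<^sup>2)"
          by (simp add: norm_mult norm_divide mult_ac)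
      qed
    qed
    show "AE t in lborel. ((\<lambda>z. cnj (h0 t) * ((\<tau> t - T z) / (of_real t - z)) / (of_real t + \<i>))
      \<longlongrightarrow> cnj (h0 t) * ((\<tau> t - \<tau> x) / (of_real t - complex_of_real x)) / (of_real t + \<i>))
        (at (complex_of_real x))"
      using AE_lborel_singleton[of x]
    proof eventually_elim
      case (elim t)
      then show ?case
        using real_plus_i_nonzero[of t]
        by (intro tendsto_divide tendsto_mult tendsto_diff tendsto_const isContD[OF isCont_real] tendsto_ident_at) auto
    qed
    show "(\<lambda>t. cnj (h0 t) * ((\<tau> t - \<tau> x) / (of_real t - complex_of_real x)) / (of_real t + \<i>))
      \<in> borel_measurable lborel"
      by measurable
    show "\<forall>\<^sub>F z in at (complex_of_real x). (\<lambda>t. cnj (h0 t) * ((\<tau> t - T z) / (of_real t - z)) / (of_real t + \<i>))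
      \<in> borel_measurable lborel"
      by (intro always_eventually allI) measurable
  qed
qed

text \<open>The correction of \<open>J\<close> that equals \<open>f\<close> in the upper half-plane and, apart from the point \<open>-\<i>\<close>, equals
\<open>T(z) cnj (h (cnj z))\<close> in the lower one.\<close>
definition G :: "complex \<Rightarrow> complex"
  where "G z = (z + \<i>) * J z / (2 * pi * \<i>) + T z * cnj (h \<i>)"

lemma G_off_real:
  assumes "Im z \<noteq> 0" "z \<noteq> -\<i>"
  shows "G z = f.extension z + T z * cnj (h.extension (cnj z))"
proof -
  have "z + \<i> \<noteq> 0" using assms by (simp add: add_eq_0_iff2)
  then show ?thesis
    unfolding G_def J_off_real[OF assms] by (simp add: right_diff_distrib)
qed

lemma isCont_G_real: "isCont G (complex_of_real x)"
  unfolding isCont_def G_def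
  by (intro tendsto_intros J_tendsto_real isContD[OF isCont_real]) simp

lemma holomorphic_reflected_h: "(\<lambda>z. cnj (h (cnj z))) holomorphic_on {z. Im z < 0}"
  by (rule holomorphic_reflection[OF h.holo])

text \<open>A continuous function that is holomorphic off a line is holomorphic. The radius is at most \<open>1 / 2\<close> in order
to keep the disc away from \<open>-\<i>\<close>.\<close>
lemma G_holomorphic_near_real:
  obtains r where "r > 0" "r \<le> 1/2" "G holomorphic_on ball (complex_of_real x) r"
proof -
  obtain r C where r: "r > 0" "r \<le> 1/2" "T holomorphic_on ball (complex_of_real x) r"
    and "\<And>z t. z \<in> ball (complex_of_real x) r \<Longrightarrow>
       norm ((\<tau> t - T z) / (of_real t - z)) * norm (of_real t + \<i>) \<le> C"
    by (rule quotient_bound[of x]) blast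
  let ?B = "ball (complex_of_real x) r"
  have ne: "z \<noteq> -\<i>" if "z \<in> ?B" for z
    using that r(2) abs_Im_le_cmod[of "of_real x - z"] by (auto simp: dist_norm)
  have "f holomorphic_on ?B \<inter> {z. Im z > 0}"
    using f.holo by (rule holomorphic_on_subset) auto
  then have up: "G holomorphic_on ?B \<inter> {z. Im z > 0}"
  proof (rule holomorphic_transform)
    show "f z = G z" if "z \<in> ?B \<inter> {z. Im z > 0}" for z
      using G_off_real[of z] ne[of z] that by (simp add: f.extension_def h.extension_def)
  qed
  have "(\<lambda>z. T z * cnj (h (cnj z))) holomorphic_on ?B \<inter> {z. Im z < 0}"
    by (intro holomorphic_intros holomorphic_on_subset[OF r(3)] holomorphic_on_subset[OF holomorphic_reflected_h]) auto
  then have low: "G holomorphic_on ?B \<inter> {z. Im z < 0}"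
  proof (rule holomorphic_transform)
    show "T z * cnj (h (cnj z)) = G z" if "z \<in> ?B \<inter> {z. Im z < 0}" for z
      using G_off_real[of z] ne[of z] that by (simp add: f.extension_def h.extension_def)
  qed
  have "isCont G z" if z: "z \<in> ?B" for z
  proof -
    consider "Im z > 0" | "Im z < 0" | "z \<in> \<real>"
      by (metis complex_is_Real_iff linorder_neqE_linordered_idom)
    then show ?thesis
    proof cases
      case 1
      then show ?thesis
        using continuous_on_interior[OF holomorphic_on_imp_continuous_on[OF up], of z] z open_half_plane[of 0]
        by (simp add: interior_open open_Int)
    next
      case 2
      then show ?thesis
        using continuous_on_interior[OF holomorphic_on_imp_continuous_on[OF low], of z] z open_halfspace_Im_lt[of 0]
        by (simp add: interior_open open_Int)
    next
      case 3
      then obtain u where "z = complex_of_real u" by (rule Reals_cases)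
      then show ?thesis by (simp only: isCont_G_real)
    qed
  qed
  then have cont: "continuous_on ?B G"
    by (intro continuous_at_imp_continuous_on ballI)
  have "G holomorphic_on ?B"
  proof (rule holomorphic_on_paste_across_line[of _ \<i> _ 0])
    show "G holomorphic_on ?B \<inter> {z. \<i> \<bullet> z < 0}" using low by simp
    show "G holomorphic_on ?B \<inter> {z. 0 < \<i> \<bullet> z}" using up by simp
  qed (use cont in simp_all)
  then show ?thesis by (rule that[OF r(1,2)])
qed

text \<open>Away from the real line the two formulas for \<open>G\<close> are meromorphic by themselves; at the point \<open>-\<i>\<close>, where
the integral \<open>J\<close> does not represent them, the formula in terms of \<open>h\<close> is taken as the definition.\<close>
lemma continuation_exists: "\<exists>g. is_continuation f g"
proof
  let ?g = "\<lambda>z. if Im z > 0 then f z else if Im z < 0 then T z * cnj (h (cnj z)) else G z"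
  have gG: "?g z = G z" if "z \<noteq> -\<i>" for z
    using that by (auto simp: G_off_real f.extension_def h.extension_def)
  have near: "\<exists>r>0. ?g holomorphic_on ball (complex_of_real x) r" for x
  proof -
    obtain r where r: "r > 0" "r \<le> 1/2" "G holomorphic_on ball (complex_of_real x) r"
      by (rule G_holomorphic_near_real)
    have "z \<noteq> -\<i>" if "z \<in> ball (complex_of_real x) r" for z
      using that r(2) abs_Im_le_cmod[of "of_real x - z"] by (auto simp: dist_norm)
    then have "?g holomorphic_on ball (complex_of_real x) r"
      using r(3) gG by (subst holomorphic_cong[OF refl, of _ _ G]) auto
    then show ?thesis using r by blast
  qed
  show "is_continuation f ?g"
  proof (rule is_continuationI[OF f.holo near])
    show "(\<lambda>z. T z * cnj (h (cnj z))) meromorphic_on {z. Im z < 0}"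
      by (intro meromorphic_on_mult meromorphic_on_subset[OF meromorphic subset_UNIV]
          reflection_meromorphic holomorphic_reflected_h)
  qed auto
qed

end

section \<open>A Bernstein inequality for the model space\<close>

sublocale model_element \<subseteq> cf: continued f
  by unfold_locales (rule continuation_exists)

context inner_bounded_deriv begin

text \<open>The squared modulus of the normalized difference quotient of \<open>\<Theta>\<close>. Its value \<open>0\<close> on the diagonal, which
comes from division by zero, affects only a null set.\<close>
definition bernstein_kernel :: "real \<Rightarrow> real \<Rightarrow> real"
  where "bernstein_kernel x t = (norm ((\<tau> t - \<tau> x) / (of_real t - complex_of_real x)))\<^sup>2 / (2 * pi)"

lemma bernstein_kernel_measurable_pair [measurable]: "(\<lambda>(x, t). bernstein_kernel x t) \<in> borel_measurable (borel \<Otimes>\<^sub>M borel)"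
  unfolding bernstein_kernel_def by measurable

lemma bernstein_kernel_nonneg: "bernstein_kernel x t \<ge> 0"
  by (simp add: bernstein_kernel_def)

lemma bernstein_kernel_symmetric: "bernstein_kernel x t = bernstein_kernel t x"
  by (simp add: bernstein_kernel_def norm_divide norm_minus_commute)

lemma nn_integral_bernstein_kernel: "(\<integral>\<^sup>+t. ennreal (bernstein_kernel x t) \<partial>lborel) \<le> ennreal (deriv_sup_norm \<Theta>)"
proof -
  let ?q = "\<lambda>t. (norm ((\<tau> t - \<tau> x) / (of_real t - complex_of_real x)))\<^sup>2"
  have "(\<integral>\<^sup>+t. ennreal (bernstein_kernel x t) \<partial>lborel) = (\<integral>\<^sup>+t. ennreal (1 / (2 * pi)) * ennreal (?q t) \<partial>lborel)"
    by (intro nn_integral_cong) (simp add: bernstein_kernel_def ennreal_mult[symmetric])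
  also have "\<dots> = ennreal (1 / (2 * pi)) * (\<integral>\<^sup>+t. ennreal (?q t) \<partial>lborel)"
    by (rule nn_integral_cmult) measurable
  also have "\<dots> \<le> ennreal (1 / (2 * pi)) * ennreal (2 * pi * norm (deriv T (complex_of_real x)))"
    by (intro mult_left_mono nn_integral_difference_quotient_real) simp
  also have "\<dots> = ennreal (norm (deriv T (complex_of_real x)))"
    by (simp add: ennreal_mult[symmetric])
  also have "\<dots> \<le> ennreal (deriv_sup_norm \<Theta>)"
    by (intro ennreal_leI norm_deriv_le_sup)
  finally show ?thesis .
qed

end

context model_element begin

abbreviation g :: "real \<Rightarrow> complex" where "g x \<equiv> continuation f (complex_of_real x)"
abbreviation g' :: "real \<Rightarrow> complex" where "g' x \<equiv> deriv (continuation f) (complex_of_real x)"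

lemma AE_norm_h0: "AE x in lborel. norm (h0 x) = norm (g x)"
  using has_boundary_values_unique[OF f.boundary cf.has_boundary_values]
  by eventually_elim (metis complex_mod_cnj mult_1 norm_T_real norm_mult)

text \<open>By Cauchy's formula \<open>2 \<pi> \<i> f'(z)\<close> is the integral of \<open>T cnj h0 / (t - z)\<^sup>2\<close>. To it are added multiples of the
integrals of \<open>cnj h0 / (t - z)\<^sup>2\<close> and of \<open>cnj (h0 T) / (t - z)\<^sup>2\<close>, which vanish because they are conjugates of
integrals of Hardy functions against a kernel with its pole in the lower half-plane. The coefficients
complete a square, and the square cancels the singularity when \<open>z\<close> approaches the real line.\<close>
lemma deriv_formula:
  assumes z: "Im z > 0"
  shows "2 * pi * \<i> * deriv f z = (\<integral>t. cnj (h0 t) * cnj (\<tau> t)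
      * ((\<tau> t - \<Theta> z) / (of_real t - z))\<^sup>2 \<partial>lborel)"
proof -
  obtain C where C: "\<And>z. Im z > 0 \<Longrightarrow> norm (\<Theta> z) \<le> C" by (rule bounded_upper) blast
  interpret hT: weighted_hardy "\<lambda>z. h z * \<Theta> z" "C * Bh" "\<lambda>t. h0 t * \<tau> t"
  proof
    show "(\<lambda>z. h z * \<Theta> z) holomorphic_on {z. Im z > 0}"
      by (intro holomorphic_intros h.holo holo)
    show "C * Bh \<ge> 0"
      using order_trans[OF norm_ge_zero C[of \<i>]] h.B_nonneg by simp
    show "(\<integral>\<^sup>+x. ennreal (norm (h (Complex x y) * \<Theta> (Complex x y) / (Complex x y + \<i>)\<^sup>2)) \<partial>lborel) \<le> ennreal (C * Bh)"
      if "y > 0" for y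
      by (rule weighted_bound_mult[OF h.bound C that h.holo])
    show "has_boundary_values (\<lambda>z. h z * \<Theta> z) (\<lambda>t. h0 t * \<tau> t)"
      using h.boundary unfolding has_boundary_values_def
      by eventually_elim (intro tendsto_mult boundary_limit)
  qed measurable
  have im: "Im z \<noteq> 0" "Im (cnj z) \<noteq> 0" using z by auto
  let ?k = "\<lambda>t. (of_real t - z)\<^sup>2"
  have F_int: "integrable lborel (\<lambda>t. \<tau> t * cnj (h0 t) / ?k t)"
    and F_val: "(\<integral>t. \<tau> t * cnj (h0 t) / ?k t \<partial>lborel) = 2 * pi * \<i> * deriv f z"
    using f.integral_double_kernel[OF im(1)] z by simp_all
  have h_eq: "cnj (h0 t) / ?k t = cnj (h0 t / (of_real t - cnj z)\<^sup>2)" for t by simp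
  have h_int: "integrable lborel (\<lambda>t. cnj (h0 t) / ?k t)"
    unfolding h_eq by (rule integrable_cnj[OF h.integral_double_kernel(1)[OF im(2)]])
  have h_val: "(\<integral>t. cnj (h0 t) / ?k t \<partial>lborel) = 0"
    unfolding h_eq using h.integral_double_kernel(2)[OF im(2)] z
      Bochner_Integration.integral_cnj[of lborel "\<lambda>t. h0 t / (of_real t - cnj z)\<^sup>2"] by simp
  have hT_eq: "cnj (h0 t) * cnj (\<tau> t) / ?k t
      = cnj (h0 t * \<tau> t / (of_real t - cnj z)\<^sup>2)" for t by simp
  have hT_int: "integrable lborel (\<lambda>t. cnj (h0 t) * cnj (\<tau> t) / ?k t)"
    unfolding hT_eq by (rule integrable_cnj[OF hT.integral_double_kernel(1)[OF im(2)]])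
  have hT_val: "(\<integral>t. cnj (h0 t) * cnj (\<tau> t) / ?k t \<partial>lborel) = 0"
    unfolding hT_eq using hT.integral_double_kernel(2)[OF im(2)] z
      Bochner_Integration.integral_cnj[of lborel "\<lambda>t. h0 t * \<tau> t / (of_real t - cnj z)\<^sup>2"] by simp
  have expand: "cnj (h0 t) * cnj (\<tau> t) * ((\<tau> t - \<Theta> z) / (of_real t - z))\<^sup>2
    = \<tau> t * cnj (h0 t) / ?k t - 2 * \<Theta> z * (cnj (h0 t) / ?k t)
      + (\<Theta> z)\<^sup>2 * (cnj (h0 t) * cnj (\<tau> t) / ?k t)" for t
  proof -
    let ?T = "\<tau> t"
    have "cnj (h0 t) * cnj ?T * (?T - \<Theta> z)\<^sup>2
       = cnj (h0 t) * ((?T * cnj ?T) * ?T) - 2 * \<Theta> z * (cnj (h0 t) * (?T * cnj ?T)) + (\<Theta> z)\<^sup>2 * (cnj (h0 t) * cnj ?T)"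
      by (simp add: power2_eq_square algebra_simps)
    also have "\<dots> = ?T * cnj (h0 t) - 2 * \<Theta> z * cnj (h0 t) + (\<Theta> z)\<^sup>2 * (cnj (h0 t) * cnj ?T)"
      unfolding T_mult_cnj by simp
    finally show ?thesis
      by (simp only: power_divide times_divide_eq_right) (simp only: add_divide_distrib diff_divide_distrib)
  qed
  show ?thesis
    unfolding expand
    by (simp only: Bochner_Integration.integral_add Bochner_Integration.integral_diff Bochner_Integration.integrable_diff
        integrable_mult_right integral_mult_right_zero F_int h_int hT_int F_val h_val hT_val simp_thms
        mult_zero_right diff_zero add_0_right)
qed

lemma norm_deriv_le_bernstein_kernel: "ennreal (norm (g' x)) \<le> (\<integral>\<^sup>+t. ennreal (bernstein_kernel x t * norm (g t)) \<partial>lborel)"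
proof -
  obtain r C where r: "r > 0"
    and C: "\<And>z t. z \<in> ball (complex_of_real x) r \<Longrightarrow>
       norm ((\<tau> t - T z) / (of_real t - z)) * norm (of_real t + \<i>) \<le> C"
    by (rule quotient_bound[of x]) blast
  let ?q = "\<lambda>t z. norm ((\<tau> t - T z) / (of_real t - z))"
  let ?z = "\<lambda>y. Complex x y"
  have bound: "(?q t z)\<^sup>2 \<le> C\<^sup>2 / (norm (of_real t + \<i>))\<^sup>2" if "z \<in> ball (complex_of_real x) r" for z t
  proof -
    have "norm (of_real t + \<i>) > 0" using real_plus_i_nonzero[of t] by simp
    then have "?q t z \<le> C / norm (of_real t + \<i>)"
      using C[OF that, of t] by (simp add: pos_le_divide_eq)
    then have "(?q t z)\<^sup>2 \<le> (C / norm (of_real t + \<i>))\<^sup>2"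
      by (intro power_mono) auto
    then show ?thesis by (simp add: power_divide)
  qed
  have dom_int: "integrable lborel (\<lambda>t. C\<^sup>2 * (norm (h0 t) / (norm (of_real t + \<i>))\<^sup>2))"
    by (intro integrable_mult_right integrable_h_weight)
  have dom: "norm (norm (h0 t) * (?q t z)\<^sup>2) \<le> C\<^sup>2 * (norm (h0 t) / (norm (of_real t + \<i>))\<^sup>2)"
    if "z \<in> ball (complex_of_real x) r" for z t
  proof -
    have "norm (h0 t) * (?q t z)\<^sup>2 \<le> norm (h0 t) * (C\<^sup>2 / (norm (of_real t + \<i>))\<^sup>2)"
      by (intro mult_left_mono bound that) simp
    then show ?thesis by (simp add: mult_ac)
  qed
  have ev: "\<forall>\<^sub>F y in at_right 0. ?z y \<in> ball (complex_of_real x) r"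
    by (rule topological_tendstoD[OF Complex_tendsto_real open_ball]) (use r in simp)
  have lim: "((\<lambda>y. \<integral>t. norm (h0 t) * (?q t (?z y))\<^sup>2 \<partial>lborel) \<longlongrightarrow>
     (\<integral>t. norm (h0 t) * (?q t (complex_of_real x))\<^sup>2 \<partial>lborel)) (at_right 0)"
  proof (rule integral_tendsto_within[OF _ _ dom_int])
    show "\<forall>\<^sub>F y in at_right 0. (\<lambda>t. norm (h0 t) * (?q t (?z y))\<^sup>2) \<in> borel_measurable lborel"
      by (intro always_eventually allI) measurable
    show "(\<lambda>t. norm (h0 t) * (?q t (complex_of_real x))\<^sup>2) \<in> borel_measurable lborel"
      by measurable
    show "\<forall>\<^sub>F y in at_right 0. AE t in lborel. norm (norm (h0 t) * (?q t (?z y))\<^sup>2)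
       \<le> C\<^sup>2 * (norm (h0 t) / (norm (of_real t + \<i>))\<^sup>2)"
      using ev by eventually_elim (intro AE_I2 dom)
    show "AE t in lborel. ((\<lambda>y. norm (h0 t) * (?q t (?z y))\<^sup>2) \<longlongrightarrow> norm (h0 t) * (?q t (complex_of_real x))\<^sup>2) (at_right 0)"
      using AE_lborel_singleton[of x]
    proof eventually_elim
      case (elim t)
      have "((\<lambda>y. T (?z y)) \<longlongrightarrow> \<tau> x) (at_right 0)"
        by (rule isCont_tendsto_compose[OF isCont_real Complex_tendsto_real])
      then show ?case using elim
        by (intro tendsto_mult tendsto_power tendsto_norm tendsto_divide tendsto_diff tendsto_const Complex_tendsto_real) auto
    qed
  qed
  have lim': "((\<lambda>y. 2 * pi * norm (deriv f (?z y))) \<longlongrightarrow> 2 * pi * norm (g' x)) (at_right 0)"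
    by (intro tendsto_intros cf.deriv_boundary_limit)
  have "2 * pi * norm (g' x) \<le> (\<integral>t. norm (h0 t) * (?q t (complex_of_real x))\<^sup>2 \<partial>lborel)"
  proof (rule tendsto_le[OF _ lim lim'])
    show "\<forall>\<^sub>F y in at_right 0. 2 * pi * norm (deriv f (?z y)) \<le> (\<integral>t. norm (h0 t) * (?q t (?z y))\<^sup>2 \<partial>lborel)"
      using eventually_Im_pos[of x]
    proof eventually_elim
      case (elim y)
      have "2 * pi * norm (deriv f (?z y)) = norm (2 * pi * \<i> * deriv f (?z y))"
        by (simp add: norm_mult)
      also have "\<dots> \<le> (\<integral>t. norm (cnj (h0 t) * cnj (\<tau> t)
          * ((\<tau> t - \<Theta> (?z y)) / (of_real t - ?z y))\<^sup>2) \<partial>lborel)"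
        unfolding deriv_formula[OF elim] by (rule integral_norm_bound)
      also have "\<dots> = (\<integral>t. norm (h0 t) * (?q t (?z y))\<^sup>2 \<partial>lborel)"
        by (simp add: norm_mult norm_power norm_T_real eq_upper[OF elim])
      finally show ?case .
    qed
  qed simp
  then have "norm (g' x) \<le> (\<integral>t. norm (h0 t) * (?q t (complex_of_real x))\<^sup>2 \<partial>lborel) / (2 * pi)"
    by (simp add: pos_le_divide_eq mult_ac)
  also have "\<dots> = (\<integral>t. bernstein_kernel x t * norm (h0 t) \<partial>lborel)"
    unfolding bernstein_kernel_def by (subst Bochner_Integration.integral_divide_zero[symmetric]) (simp add: mult_ac)
  finally have "ennreal (norm (g' x)) \<le> ennreal (\<integral>t. bernstein_kernel x t * norm (h0 t) \<partial>lborel)"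
    by (rule ennreal_leI)
  also have "\<dots> = (\<integral>\<^sup>+t. ennreal (bernstein_kernel x t * norm (h0 t)) \<partial>lborel)"
  proof (rule nn_integral_eq_integral[symmetric])
    have "integrable lborel (\<lambda>t. norm (h0 t) * (?q t (complex_of_real x))\<^sup>2)"
    proof (rule Bochner_Integration.integrable_bound[OF dom_int])
      show "AE t in lborel. norm (norm (h0 t) * (?q t (complex_of_real x))\<^sup>2)
          \<le> norm (C\<^sup>2 * (norm (h0 t) / (norm (of_real t + \<i>))\<^sup>2))"
        using dom[of "complex_of_real x"] r by (intro AE_I2) (smt (verit) centre_in_ball real_norm_def)
    qed measurable
    then have "integrable lborel (\<lambda>t. norm (h0 t) * (?q t (complex_of_real x))\<^sup>2 / (2 * pi))"
      by (rule integrable_divide_zero)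
    then show "integrable lborel (\<lambda>t. bernstein_kernel x t * norm (h0 t))"
      unfolding bernstein_kernel_def by (simp add: mult_ac)
  qed (simp add: bernstein_kernel_nonneg)
  also have "\<dots> = (\<integral>\<^sup>+t. ennreal (bernstein_kernel x t * norm (g t)) \<partial>lborel)"
    by (rule nn_integral_cong_AE) (use AE_norm_h0 in \<open>auto elim: eventually_mono\<close>)
  finally show ?thesis .
qed

end

context model_element begin

text \<open>At each \<open>x\<close> the quantity \<open>|g(x)| + \<delta> |g'(x)|\<close> is at most the integral of \<open>|g|\<close> against a unit point mass at
\<open>x\<close> plus \<open>\<delta>\<close> times the kernel, a measure of mass at most \<open>1 + \<delta> M\<close>. Jensen's inequality for
this measure contributes \<open>(1 + \<delta> M) powr (p - 1)\<close>, and integrating over \<open>x\<close>, with the symmetry of the kernel,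
contributes the last factor \<open>1 + \<delta> M\<close>.\<close>
lemma Bernstein_power_mean:
  assumes p: "1 \<le> p" and \<delta>: "0 < \<delta>"
  shows "(\<integral>\<^sup>+x. ennreal ((norm (g x) + \<delta> * norm (g' x)) powr p) \<partial>lborel)
    \<le> ennreal ((1 + \<delta> * deriv_sup_norm \<Theta>) powr p) * (\<integral>\<^sup>+x. ennreal (norm (g x) powr p) \<partial>lborel)"
proof -
  define M where "M = deriv_sup_norm \<Theta>"
  define m where "m = 1 + \<delta> * M"
  have M: "M \<ge> 0" using deriv_sup_norm_nonneg by (simp add: M_def)
  have m: "m > 0" using M \<delta> by (simp add: m_def add_pos_nonneg)
  define N where "N = (\<integral>\<^sup>+x. ennreal (norm (g x) powr p) \<partial>lborel)"
  have K\<delta>: "(\<integral>\<^sup>+t. ennreal (\<delta> * bernstein_kernel x t) \<partial>lborel) \<le> ennreal (\<delta> * M)" for x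
  proof -
    have "(\<integral>\<^sup>+t. ennreal (\<delta> * bernstein_kernel x t) \<partial>lborel) = ennreal \<delta> * (\<integral>\<^sup>+t. ennreal (bernstein_kernel x t) \<partial>lborel)"
      using \<delta> by (simp add: ennreal_mult bernstein_kernel_nonneg nn_integral_cmult)
    also have "\<dots> \<le> ennreal \<delta> * ennreal M"
      unfolding M_def by (intro mult_left_mono nn_integral_bernstein_kernel) simp
    finally show ?thesis using \<delta> M by (simp add: ennreal_mult)
  qed
  have pointwise: "ennreal ((norm (g x) + \<delta> * norm (g' x)) powr p)
     \<le> ennreal (m powr (p - 1)) * (ennreal (1 * norm (g x) powr p) + (\<integral>\<^sup>+t. ennreal (\<delta> * bernstein_kernel x t * norm (g t) powr p) \<partial>lborel))" for x
  proof (rule weighted_power_mean[OF p m])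
    have "ennreal (\<delta> * norm (g' x)) \<le> ennreal \<delta> * (\<integral>\<^sup>+t. ennreal (bernstein_kernel x t * norm (g t)) \<partial>lborel)"
      using \<delta> norm_deriv_le_bernstein_kernel[of x] by (simp add: ennreal_mult mult_left_mono)
    also have "\<dots> = (\<integral>\<^sup>+t. ennreal (\<delta> * bernstein_kernel x t * norm (g t)) \<partial>lborel)"
      using \<delta> by (simp add: nn_integral_cmult[symmetric] ennreal_mult[symmetric] bernstein_kernel_nonneg mult.assoc)
    finally show "ennreal (norm (g x) + \<delta> * norm (g' x))
      \<le> ennreal (1 * norm (g x)) + (\<integral>\<^sup>+t. ennreal (\<delta> * bernstein_kernel x t * norm (g t)) \<partial>lborel)"
      using \<delta> by (simp add: add_left_mono)
    show "ennreal 1 + (\<integral>\<^sup>+t. ennreal (\<delta> * bernstein_kernel x t) \<partial>lborel) \<le> ennreal m"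
      using add_left_mono[OF K\<delta>[of x], of "ennreal 1"] \<delta> M by (simp add: m_def)
  qed (use \<delta> in \<open>auto simp: bernstein_kernel_nonneg\<close>)
  have "(\<integral>\<^sup>+x. ennreal ((norm (g x) + \<delta> * norm (g' x)) powr p) \<partial>lborel)
    \<le> (\<integral>\<^sup>+x. ennreal (m powr (p - 1)) * (ennreal (1 * norm (g x) powr p)
         + (\<integral>\<^sup>+t. ennreal (\<delta> * bernstein_kernel x t * norm (g t) powr p) \<partial>lborel)) \<partial>lborel)"
    by (intro nn_integral_mono pointwise)
  also have "\<dots> = ennreal (m powr (p - 1)) * (N + (\<integral>\<^sup>+x. \<integral>\<^sup>+t. ennreal (\<delta> * bernstein_kernel x t * norm (g t) powr p) \<partial>lborel \<partial>lborel))"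
    by (simp add: nn_integral_cmult nn_integral_add N_def)
  also have "(\<integral>\<^sup>+x. \<integral>\<^sup>+t. ennreal (\<delta> * bernstein_kernel x t * norm (g t) powr p) \<partial>lborel \<partial>lborel)
     = (\<integral>\<^sup>+t. \<integral>\<^sup>+x. ennreal (\<delta> * bernstein_kernel x t * norm (g t) powr p) \<partial>lborel \<partial>lborel)"
    by (rule lborel_pair.Fubini') measurable
  also have "\<dots> \<le> (\<integral>\<^sup>+t. ennreal (\<delta> * M) * ennreal (norm (g t) powr p) \<partial>lborel)"
  proof (rule nn_integral_mono)
    fix t
    have "(\<integral>\<^sup>+x. ennreal (\<delta> * bernstein_kernel x t * norm (g t) powr p) \<partial>lborel)
       = (\<integral>\<^sup>+x. ennreal (\<delta> * bernstein_kernel t x) * ennreal (norm (g t) powr p) \<partial>lborel)"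
      using \<delta> by (simp add: ennreal_mult bernstein_kernel_nonneg bernstein_kernel_symmetric[of _ t])
    also have "\<dots> = (\<integral>\<^sup>+x. ennreal (\<delta> * bernstein_kernel t x) \<partial>lborel) * ennreal (norm (g t) powr p)"
      by (rule nn_integral_multc) measurable
    also have "\<dots> \<le> ennreal (\<delta> * M) * ennreal (norm (g t) powr p)"
      by (intro mult_right_mono K\<delta>) simp
    finally show "(\<integral>\<^sup>+x. ennreal (\<delta> * bernstein_kernel x t * norm (g t) powr p) \<partial>lborel) \<le> \<dots>" .
  qed
  also have "\<dots> = ennreal (\<delta> * M) * N"
    unfolding N_def by (rule nn_integral_cmult) measurable
  finally have "(\<integral>\<^sup>+x. ennreal ((norm (g x) + \<delta> * norm (g' x)) powr p) \<partial>lborel)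
     \<le> ennreal (m powr (p - 1)) * (N + ennreal (\<delta> * M) * N)"
    by (simp add: add_left_mono mult_left_mono)
  also have "N + ennreal (\<delta> * M) * N = ennreal m * N"
    using \<delta> M by (simp add: m_def distrib_right)
  also have "ennreal (m powr (p - 1)) * (ennreal m * N) = ennreal (m powr p) * N"
    using m by (simp add: ennreal_mult[symmetric] mult.assoc[symmetric] powr_diff)
  finally show ?thesis by (simp add: m_def M_def N_def)
qed

section \<open>The embedding inequality\<close>

text \<open>For \<open>s\<close> in the window, \<open>|g(x)|\<close> exceeds \<open>|g(s)|\<close> by at most the integral of \<open>|g'|\<close> over the window. Averaging
over \<open>s\<close> bounds \<open>|g(x)|\<close> by the mean of \<open>|g| + \<delta> |g'|\<close>, and the power is moved inside by Jensen's inequality.\<close>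
lemma norm_powr_le_window:
  assumes p: "1 \<le> p" and \<delta>: "0 < \<delta>"
  shows "ennreal (norm (g x) powr p) \<le> ennreal (1 / \<delta>) *
    (\<integral>\<^sup>+t. ennreal (indicator {x..x+\<delta>} t * (norm (g t) + \<delta> * norm (g' t)) powr p) \<partial>lborel)"
proof -
  let ?I = "{x..x+\<delta>}"
  have cont: "continuous_on A g" "continuous_on A g'" for A
    using cf.continuous_real cf.continuous_deriv_real by (auto intro: continuous_on_subset)
  have int: "(\<lambda>t. norm (g' t)) integrable_on {a..b}" "(\<lambda>t. norm (g t)) integrable_on {a..b}" for a b
    by (intro integrable_continuous_real continuous_intros cont)+
  define D where "D = integral ?I (\<lambda>t. norm (g' t))"
  have le: "norm (g x) \<le> norm (g s) + D" if s: "s \<in> ?I" for s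
  proof -
    have "(g' has_integral (g s - g x)) {x..s}"
    proof (rule fundamental_theorem_of_calculus)
      show "(g has_vector_derivative g' t) (at t within {x..s})" for t
      proof -
        have "(complex_of_real has_vector_derivative 1) (at t within {x..s})"
          by (auto intro!: derivative_eq_intros)
        from field_vector_diff_chain_within[OF this, of "continuation f" "g' t"] show ?thesis
          using cf.DERIV_real[of t] by (simp add: o_def has_field_derivative_at_within)
      qed
    qed (use s in simp)
    then have "norm (g s - g x) \<le> integral {x..s} (\<lambda>t. norm (g' t))"
      using int by (metis has_integral_integrable_integral integral_norm_bound_integral order_refl)
    also have "\<dots> \<le> D"
      unfolding D_def using s int by (intro integral_subset_le) auto
    finally show ?thesis
      using norm_triangle_ineq2[of "g x" "g s"] by (simp add: norm_minus_commute)
  qed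
  have "\<delta> * norm (g x) = integral ?I (\<lambda>s. norm (g x))"
    using \<delta> by simp
  also have "\<dots> \<le> integral ?I (\<lambda>s. norm (g s) + D)"
    using le int by (intro integral_le integrable_add) auto
  also have "\<dots> = integral ?I (\<lambda>s. norm (g s)) + \<delta> * D"
    using int \<delta> by (subst Henstock_Kurzweil_Integration.integral_add) auto
  also have "\<dots> = integral ?I (\<lambda>s. norm (g s) + \<delta> * norm (g' s))"
    unfolding D_def using int
    by (subst Henstock_Kurzweil_Integration.integral_add) (auto intro!: integrable_continuous_real continuous_intros cont)
  finally have window: "\<delta> * norm (g x) \<le> integral ?I (\<lambda>s. norm (g s) + \<delta> * norm (g' s))" .
  have si: "set_integrable lborel ?I (\<lambda>s. norm (g s) + \<delta> * norm (g' s))"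
    by (intro borel_integrable_atLeastAtMost' continuous_intros cont)
  then have "integral ?I (\<lambda>s. norm (g s) + \<delta> * norm (g' s)) = (\<integral>s. indicator ?I s * (norm (g s) + \<delta> * norm (g' s)) \<partial>lborel)"
    by (subst set_borel_integral_eq_integral(2)[symmetric]) (simp_all add: set_lebesgue_integral_def)
  then have "ennreal (integral ?I (\<lambda>s. norm (g s) + \<delta> * norm (g' s)))
     = (\<integral>\<^sup>+s. ennreal (indicator ?I s * (norm (g s) + \<delta> * norm (g' s))) \<partial>lborel)"
    using si \<delta> by (subst nn_integral_eq_integral) (auto simp: set_integrable_def)
  with window have s: "ennreal (\<delta> * norm (g x)) \<le> ennreal (0 * 0)
      + (\<integral>\<^sup>+s. ennreal (indicator ?I s * (norm (g s) + \<delta> * norm (g' s))) \<partial>lborel)"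
    using ennreal_leI[OF window] by simp
  have "ennreal ((\<delta> * norm (g x)) powr p) \<le> ennreal (\<delta> powr (p - 1)) * (ennreal (0 * 0 powr p)
      + (\<integral>\<^sup>+t. ennreal (indicator ?I t * (norm (g t) + \<delta> * norm (g' t)) powr p) \<partial>lborel))"
  proof (rule weighted_power_mean[OF p \<delta> _ _ _ _ _ _ _ s])
    show "ennreal 0 + (\<integral>\<^sup>+t. ennreal (indicator ?I t) \<partial>lborel) \<le> ennreal \<delta>"
      using \<delta> by (simp add: ennreal_indicator)
  qed (use \<delta> in auto)
  then have "ennreal (\<delta> powr (-p)) * ennreal ((\<delta> * norm (g x)) powr p) \<le> ennreal (\<delta> powr (-p)) * (ennreal (\<delta> powr (p - 1))
      * (\<integral>\<^sup>+t. ennreal (indicator ?I t * (norm (g t) + \<delta> * norm (g' t)) powr p) \<partial>lborel))"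
    by (intro mult_left_mono) simp_all
  also have "\<dots> = ennreal (\<delta> powr (-p) * \<delta> powr (p - 1))
      * (\<integral>\<^sup>+t. ennreal (indicator ?I t * (norm (g t) + \<delta> * norm (g' t)) powr p) \<partial>lborel)"
    by (simp add: ennreal_mult mult.assoc)
  also have "\<delta> powr (-p) * \<delta> powr (p - 1) = 1 / \<delta>"
    using \<delta> by (subst powr_add[symmetric]) (simp add: powr_minus_divide)
  also have "ennreal (\<delta> powr (-p)) * ennreal ((\<delta> * norm (g x)) powr p) = ennreal (norm (g x) powr p)"
    using \<delta> by (simp add: ennreal_mult[symmetric] powr_mult powr_minus)
  finally show ?thesis .
qed

lemma Lp_norm_pow_eq: "Lp_norm_pow p \<mu> f = (\<integral>\<^sup>+x. ennreal (norm (g x) powr p) \<partial>\<mu>)"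
  by (simp add: Lp_norm_pow_def)

text \<open>Integrating the window estimate with respect to \<open>\<mu>\<close> and exchanging the integrals leaves the measures of
the intervals \<open>[t - \<delta>, t]\<close>, which are at most \<open>\<delta>\<close> times the maximal density.\<close>
lemma Carleson_inequality:
  assumes p: "1 \<le> p" and sets: "sets \<mu> = sets borel" and \<delta>: "0 < \<delta>"
  shows "Lp_norm_pow p \<mu> f
      \<le> ennreal ((1 + \<delta> * deriv_sup_norm \<Theta>) powr p) * max_density \<mu> \<delta> * Lp_norm_pow p lborel f"
proof -
  define v where "v t = (norm (g t) + \<delta> * norm (g' t)) powr p" for t
  have v_meas [measurable]: "v \<in> borel_measurable borel" unfolding v_def by measurable
  define A where "A = ennreal ((1 + \<delta> * deriv_sup_norm \<Theta>) powr p)"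
  define N where "N = Lp_norm_pow p lborel f"
  have "1 + \<delta> * deriv_sup_norm \<Theta> > 0"
    using \<delta> deriv_sup_norm_nonneg by (simp add: add_pos_nonneg)
  then have A0: "A \<noteq> 0"
    by (simp add: A_def)
  have vN: "(\<integral>\<^sup>+t. ennreal (v t) \<partial>lborel) \<le> A * N"
    unfolding v_def A_def N_def Lp_norm_pow_eq by (rule Bernstein_power_mean[OF p \<delta>])
  have window: "ennreal (norm (g x) powr p) \<le> ennreal (1 / \<delta>) * (\<integral>\<^sup>+t. ennreal (indicator {x..x+\<delta>} t * v t) \<partial>lborel)" for x
    unfolding v_def by (rule norm_powr_le_window[OF p \<delta>])
  show ?thesis
  proof (cases "max_density \<mu> \<delta> = \<infinity>")
    case True
    show ?thesis
    proof (cases "N = 0")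
      \<comment> \<open>With \<open>0 * \<infinity> = 0\<close> on the right-hand side, the values of \<open>f\<close> must vanish at every point of the real line.\<close>
      case N0: True
      have "ennreal (norm (g x) powr p) = 0" for x
      proof -
        have "(\<integral>\<^sup>+t. ennreal (indicator {x..x+\<delta>} t * v t) \<partial>lborel) \<le> (\<integral>\<^sup>+t. ennreal (v t) \<partial>lborel)"
          by (intro nn_integral_mono ennreal_leI) (auto simp: indicator_def v_def)
        also have "\<dots> = 0" using vN N0 by simp
        finally show ?thesis using window[of x] by simp
      qed
      then show ?thesis unfolding Lp_norm_pow_eq[of p \<mu>] by simp
    next
      case False
      then have "A * max_density \<mu> \<delta> * N = \<infinity>"
        using A0 True by (simp add: ennreal_mult_eq_top_iff A_def ennreal_top_mult)
      then show ?thesis by (simp add: A_def N_def)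
    qed
  next
    case False
    define D where "D = max_density \<mu> \<delta>"
    have D_fin: "D < \<infinity>" using False by (simp add: D_def less_top)
    have interval: "emeasure \<mu> {x..x+\<delta>} \<le> ennreal \<delta> * D" for x
    proof -
      have "emeasure \<mu> {x..x+\<delta>} / ennreal \<delta> \<le> D"
        unfolding D_def max_density_def by (rule SUP_upper) simp
      then have "ennreal \<delta> * (emeasure \<mu> {x..x+\<delta>} / ennreal \<delta>) \<le> ennreal \<delta> * D"
        by (rule mult_left_mono) simp
      moreover have "ennreal \<delta> * (emeasure \<mu> {x..x+\<delta>} / ennreal \<delta>) = emeasure \<mu> {x..x+\<delta>}"
        using \<delta> by (subst ennreal_times_divide, subst mult.commute, intro mult_divide_eq_ennreal) auto
      ultimately show ?thesis by simp
    qed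
    \<comment> \<open>Finite mass on each interval of length \<open>\<delta>\<close> is what Tonelli's theorem needs.\<close>
    interpret \<mu>: sigma_finite_measure \<mu>
    proof
      show "\<exists>A. countable A \<and> A \<subseteq> sets \<mu> \<and> \<Union>A = space \<mu> \<and> (\<forall>a\<in>A. emeasure \<mu> a \<noteq> \<infinity>)"
      proof (intro exI conjI ballI)
        let ?A = "range (\<lambda>k::int. {of_int k * \<delta>..of_int k * \<delta> + \<delta>})"
        show "countable ?A" by simp
        show "?A \<subseteq> sets \<mu>" unfolding sets by (intro image_subsetI) simp
        have "x \<in> \<Union>?A" for x
        proof -
          have "of_int \<lfloor>x / \<delta>\<rfloor> * \<delta> \<le> x" "x \<le> of_int \<lfloor>x / \<delta>\<rfloor> * \<delta> + \<delta>"
            using of_int_floor_le[of "x / \<delta>"] real_of_int_floor_add_one_ge[of "x / \<delta>"] \<delta>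
            by (simp_all only: pos_le_divide_eq pos_divide_le_eq distrib_right mult_1_left)
          then have "x \<in> {of_int \<lfloor>x / \<delta>\<rfloor> * \<delta>..of_int \<lfloor>x / \<delta>\<rfloor> * \<delta> + \<delta>}"
            by simp
          then show ?thesis by (rule UN_I[OF UNIV_I])
        qed
        then have "\<Union>?A = UNIV" by (rule UNIV_eq_I[symmetric])
        moreover have "space \<mu> = UNIV" using sets_eq_imp_space_eq[OF sets] by simp
        ultimately show "\<Union>?A = space \<mu>" by simp
        fix a assume "a \<in> ?A"
        then obtain k :: int where "a = {of_int k * \<delta>..of_int k * \<delta> + \<delta>}" by (rule rangeE)
        then have "emeasure \<mu> a \<le> ennreal \<delta> * D" using interval by simp
        also have "\<dots> < \<infinity>" using D_fin by (simp add: ennreal_mult_less_top)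
        finally show "emeasure \<mu> a \<noteq> \<infinity>" by simp
      qed
    qed
    interpret pair_sigma_finite \<mu> lborel ..
    have [measurable_cong]: "sets \<mu> = sets borel" by (rule sets)
    have [measurable]: "Measurable.pred (borel \<Otimes>\<^sub>M borel) (\<lambda>z::real \<times> real. fst z \<in> {snd z - \<delta>..snd z})"
      unfolding atLeastAtMost_iff by measurable
    have "Lp_norm_pow p \<mu> f \<le> (\<integral>\<^sup>+x. ennreal (1 / \<delta>) * (\<integral>\<^sup>+t. ennreal (indicator {x..x+\<delta>} t * v t) \<partial>lborel) \<partial>\<mu>)"
      unfolding Lp_norm_pow_eq by (intro nn_integral_mono window)
    also have "\<dots> = (\<integral>\<^sup>+x. ennreal (1 / \<delta>) * (\<integral>\<^sup>+t. ennreal (v t) * indicator {t-\<delta>..t} x \<partial>lborel) \<partial>\<mu>)"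
      by (intro nn_integral_cong arg_cong2[where f = "(*)"] refl) (auto simp: indicator_def)
    also have "\<dots> = ennreal (1 / \<delta>) * (\<integral>\<^sup>+x. \<integral>\<^sup>+t. ennreal (v t) * indicator {t-\<delta>..t} x \<partial>lborel \<partial>\<mu>)"
      by (rule nn_integral_cmult) measurable
    also have "(\<integral>\<^sup>+x. \<integral>\<^sup>+t. ennreal (v t) * indicator {t-\<delta>..t} x \<partial>lborel \<partial>\<mu>)
       = (\<integral>\<^sup>+t. \<integral>\<^sup>+x. ennreal (v t) * indicator {t-\<delta>..t} x \<partial>\<mu> \<partial>lborel)"
      by (rule Fubini'[symmetric]) measurable
    also have "\<dots> = (\<integral>\<^sup>+t. ennreal (v t) * emeasure \<mu> {t-\<delta>..t} \<partial>lborel)"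
      by (intro nn_integral_cong nn_integral_cmult_indicator) (simp add: sets)
    also have "\<dots> \<le> (\<integral>\<^sup>+t. ennreal (v t) * (ennreal \<delta> * D) \<partial>lborel)"
      using interval[of "_ - \<delta>"] by (intro nn_integral_mono mult_left_mono) simp_all
    also have "\<dots> = (\<integral>\<^sup>+t. ennreal (v t) \<partial>lborel) * (ennreal \<delta> * D)"
      by (rule nn_integral_multc) measurable
    also have "\<dots> \<le> (A * N) * (ennreal \<delta> * D)"
      by (intro mult_right_mono vN) simp
    finally have "Lp_norm_pow p \<mu> f \<le> ennreal (1 / \<delta>) * ((A * N) * (ennreal \<delta> * D))"
      by (simp add: mult_left_mono)
    also have "\<dots> = (ennreal (1 / \<delta>) * ennreal \<delta>) * (A * D * N)"
      by (simp only: mult_ac)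
    also have "ennreal (1 / \<delta>) * ennreal \<delta> = 1"
      using \<delta> by (simp add: ennreal_mult[symmetric])
    finally show ?thesis
      by (simp add: A_def D_def N_def)
  qed
qed

end

text \<open>The boundary values of \<open>\<Theta>\<close> and of \<open>h\<close> in the definition of the model space are replaced by the values of the
continuation of \<open>\<Theta>\<close> and by a Borel version, with which they agree almost everywhere.\<close>
lemma model_space_element:
  assumes p: "1 \<le> p" and inner: "inner_function \<Theta>" and bd: "bounded_deriv \<Theta>"
    and f: "f \<in> model_space p \<Theta>"
  obtains h Bf Bh h0 where "model_element \<Theta> f h Bf Bh h0"
proof -
  interpret inner_bounded_deriv \<Theta> by unfold_locales (rule inner bd)+
  obtain h f\<^sub>0 \<theta> h\<^sub>0 where f': "f \<in> hardy_space p" and h: "h \<in> hardy_space p"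
    and bf: "has_boundary_values f f\<^sub>0" and b\<theta>: "has_boundary_values \<Theta> \<theta>" and bh: "has_boundary_values h h\<^sub>0"
    and eq: "AE x in lborel. f\<^sub>0 x = \<theta> x * cnj (h\<^sub>0 x)"
    using f by (auto simp: model_space_def)
  obtain h0 where h0: "h0 \<in> borel_measurable borel" "has_boundary_values h h0" "AE x in lborel. h\<^sub>0 x = h0 x"
    using has_boundary_values_measurable_version[OF hardy_space_holomorphic[OF h] bh] by blast
  have bf': "has_boundary_values f (\<lambda>x. \<tau> x * cnj (h0 x))"
  proof (rule has_boundary_values_AE_cong[OF bf])
    show "AE x in lborel. f\<^sub>0 x = \<tau> x * cnj (h0 x)"
      using eq h0(3) has_boundary_values_unique[OF b\<theta> has_boundary_values]
      by eventually_elim simp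
  qed
  note [measurable] = h0(1)
  obtain Bf where Bf: "Bf \<ge> 0"
    "\<And>y. y > 0 \<Longrightarrow> (\<integral>\<^sup>+x. ennreal (norm (f (Complex x y) / (Complex x y + \<i>)\<^sup>2)) \<partial>lborel) \<le> ennreal Bf"
    by (rule weighted_bound_hardy_space[OF f' p]) blast
  obtain Bh where Bh: "Bh \<ge> 0"
    "\<And>y. y > 0 \<Longrightarrow> (\<integral>\<^sup>+x. ennreal (norm (h (Complex x y) / (Complex x y + \<i>)\<^sup>2)) \<partial>lborel) \<le> ennreal Bh"
    by (rule weighted_bound_hardy_space[OF h p]) blast
  have "weighted_hardy h Bh h0"
    by unfold_locales (use hardy_space_holomorphic[OF h] Bh h0 in auto)
  moreover have "weighted_hardy f Bf (\<lambda>x. \<tau> x * cnj (h0 x))"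
  proof
    show "(\<lambda>x. \<tau> x * cnj (h0 x)) \<in> borel_measurable borel" by measurable
  qed (use hardy_space_holomorphic[OF f'] Bf bf' in auto)
  ultimately have "model_element \<Theta> f h Bf Bh h0"
    by (intro model_element.intro model_element_axioms.intro inner_bounded_deriv_axioms)
  then show ?thesis by (rule that)
qed

theorem theorem5p1:
  fixes p \<delta> :: real and \<Theta> :: "complex \<Rightarrow> complex" and \<mu> :: "real measure"
  assumes "1 \<le> p"
    and "inner_function \<Theta>" and "bounded_deriv \<Theta>"
    and "sets \<mu> = sets borel"
    and "0 < \<delta>"
  shows "\<forall>f\<in>model_space p \<Theta>.
    Lp_norm_pow p \<mu> f
      \<le> ennreal ((1 + \<delta> * deriv_sup_norm \<Theta>) powr p) * max_density \<mu> \<delta> * Lp_norm_pow p lborel f"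
proof
  fix f assume "f \<in> model_space p \<Theta>"
  then obtain h Bf Bh h0 where "model_element \<Theta> f h Bf Bh h0"
    using model_space_element assms(1-3) by blast
  then interpret model_element \<Theta> f h Bf Bh h0 .
  show "Lp_norm_pow p \<mu> f
      \<le> ennreal ((1 + \<delta> * deriv_sup_norm \<Theta>) powr p) * max_density \<mu> \<delta> * Lp_norm_pow p lborel f"
    using assms by (intro Carleson_inequality)
qed

end
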